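(* Let $d\in\mathbb{N}$, let $P$ be a stationary and ergodic probability measure on $\Omega=[0,1]^{\mathcal{K}^d}$, and fix an integer $0\le q<d$ and $t\in[0,1]$. Then there exists a non-random constant $\widehat\beta_q(t)$ (depending on $d,q,t$) such that $$\lim_{n\to\infty}\frac{1}{|\Lambda_n|}\beta_q^n(t)=\widehat\beta_q(t)\quad\text{almost surely.}$$
   Context: An elementary interval is a closed interval $[l,l+1]$ or a degenerate interval $[l]=[l,l]$ with $l\in\mathbb{Z}$. An elementary cube in $\mathbb{R}^d$ is a product $Q=I_1\times\cdots\times I_d$ of elementary intervals; its dimension is the number of nondegenerate factors. $\mathcal{K}^d$ denotes the set of all elementary cubes in $\mathbb{R}^d$. A cubical set is a (possibly infinite) union of elementary cubes. For a cubical set $X$, the cubical chain complex has $C_k(X)$ the free $\mathbb{Z}$-module generated by the $k$-dimensional elementary cubes contained in $X$, with the standard cubical boundary operator $\partial\widehat Q=\sum_{j=1}^k(-1)^{j-1}(\widehat{Q_j^+}-\widehat{Q_j^-})$, where $Q_j^\pm$ replace the $j$-th nondegenerate factor $[l_j,l_j+1]$ by $[l_j+1]$, resp. $[l_j]$. $H_k(X)$ is its homology; for bounded $X$, $H_k(X)\cong T_k\oplus\mathbb{Z}^{\beta_k(X)}$ with $T_k$ torsion, and $\beta_k(X)$ is the $k$-th Betti number. Random model: $\Omega=[0,1]^{\mathcal{K}^d}$ with product topology and Borel $\sigma$-field; configurations $\omega=(\omega_Q)_{Q\in\mathcal{K}^d}$. For $x\in\mathbb{Z}^d$, $\tau_x\omega=(\omega_{-x+Q})_{Q}$.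 $P$ is stationary if $P(\tau_x^{-1}A)=P(A)$ for all $x\in\mathbb{Z}^d$ and measurable $A$, and ergodic if every $A$ with $\tau_x^{-1}A=A$ for all $x$ has $P(A)\in\{0,1\}$. For $t\in[0,1]$, $X(t)=\bigcup\{Q\in\mathcal{K}^d:\omega_Q\le t\}$, $\Lambda_n=[-n,n]^d$, $X^n(t)=X(t)\cap\Lambda_n$, $\beta_q^n(t)=\beta_q(X^n(t))$, and $|\cdot|$ is Lebesgue measure (so $|\Lambda_n|=(2n)^d$). *)

theory Defs
  imports "HOL-Probability.Probability"
begin

text \<open>Elementary cubes in R^d.  A cube is a function nat => int * bool; coordinate i
  (for i < d) is the interval [l, l+1] if the cube maps i to (l, True) and the
  degenerate interval [l] if it maps i to (l, False).  Coordinates i >= d are fixed to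
  (0, False).  Points of R^d are functions nat => real vanishing from index d on.\<close>

type_synonym cube = "nat \<Rightarrow> int \<times> bool"

definition Kd :: "nat \<Rightarrow> cube set" where
  "Kd d = {Q. \<forall>i\<ge>d. Q i = (0, False)}"

definition cube_set :: "cube \<Rightarrow> (nat \<Rightarrow> real) set" where
  "cube_set Q = {x. \<forall>i. if snd (Q i)
       then real_of_int (fst (Q i)) \<le> x i \<and> x i \<le> real_of_int (fst (Q i)) + 1
       else x i = real_of_int (fst (Q i))}"

definition cdim :: "nat \<Rightarrow> cube \<Rightarrow> nat" where
  "cdim d Q = card {i. i < d \<and> snd (Q i)}"

definition cubes_in :: "nat \<Rightarrow> (nat \<Rightarrow> real) set \<Rightarrow> nat \<Rightarrow> cube set" where
  "cubes_in d S k = {Q \<in> Kd d. cdim d Q = k \<and> cube_set Q \<subseteq> S}"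

definition face_up :: "cube \<Rightarrow> nat \<Rightarrow> cube" where
  "face_up Q i = Q(i := (fst (Q i) + 1, False))"

definition face_down :: "cube \<Rightarrow> nat \<Rightarrow> cube" where
  "face_down Q i = Q(i := (fst (Q i), False))"

text \<open>Cubical boundary of a single elementary cube, as an integer chain.  The
  nondegenerate coordinate i is the j-th one with j - 1 = number of nondegenerate
  coordinates below i.\<close>
definition bd_cube :: "nat \<Rightarrow> cube \<Rightarrow> cube \<Rightarrow> int" where
  "bd_cube d Q P = (\<Sum>i\<in>{i. i < d \<and> snd (Q i)}.
      (-1) ^ card {i'. i' < i \<and> snd (Q i')} *
      ((if P = face_up Q i then 1 else 0) - (if P = face_down Q i then 1 else 0)))"

type_synonym chain = "cube \<Rightarrow> int"

definition chains :: "nat \<Rightarrow> (nat \<Rightarrow> real) set \<Rightarrow> nat \<Rightarrow> chain set" where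
  "chains d S k = {c. finite {Q. c Q \<noteq> 0} \<and> (\<forall>Q. c Q \<noteq> 0 \<longrightarrow> Q \<in> cubes_in d S k)}"

definition bd :: "nat \<Rightarrow> chain \<Rightarrow> chain" where
  "bd d c = (\<lambda>P. \<Sum>Q\<in>{Q. c Q \<noteq> 0}. c Q * bd_cube d Q P)"

definition cycles :: "nat \<Rightarrow> (nat \<Rightarrow> real) set \<Rightarrow> nat \<Rightarrow> chain set" where
  "cycles d S k = {c \<in> chains d S k. bd d c = (\<lambda>_. 0)}"

definition boundaries :: "nat \<Rightarrow> (nat \<Rightarrow> real) set \<Rightarrow> nat \<Rightarrow> chain set" where
  "boundaries d S k = bd d ` chains d S (Suc k)"

text \<open>Betti number: the rank of the abelian group H_k = cycles / boundaries, i.e. the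
  maximal number of elements of H_k that are linearly independent over the integers.
  For a finitely generated H_k = T + Z^beta this is beta.\<close>
definition homology_independent :: "nat \<Rightarrow> (nat \<Rightarrow> real) set \<Rightarrow> nat \<Rightarrow> chain set \<Rightarrow> bool" where
  "homology_independent d S k Z \<longleftrightarrow> finite Z \<and> Z \<subseteq> cycles d S k \<and>
     (\<forall>a :: chain \<Rightarrow> int. (\<lambda>P. \<Sum>z\<in>Z. a z * z P) \<in> boundaries d S k \<longrightarrow> (\<forall>z\<in>Z. a z = 0))"

definition betti :: "nat \<Rightarrow> (nat \<Rightarrow> real) set \<Rightarrow> nat \<Rightarrow> nat" where
  "betti d S k = Sup {card Z | Z. homology_independent d S k Z}"

type_synonym config = "cube \<Rightarrow> real"

definition Omega_space :: "nat \<Rightarrow> config measure" where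
  "Omega_space d = Pi\<^sub>M (Kd d) (\<lambda>_. restrict_space borel {0..1::real})"

definition Zd :: "nat \<Rightarrow> (nat \<Rightarrow> int) set" where
  "Zd d = {x. \<forall>i\<ge>d. x i = 0}"

definition cube_shift :: "(nat \<Rightarrow> int) \<Rightarrow> cube \<Rightarrow> cube" where
  "cube_shift x Q = (\<lambda>i. (fst (Q i) + x i, snd (Q i)))"

definition tau :: "nat \<Rightarrow> (nat \<Rightarrow> int) \<Rightarrow> config \<Rightarrow> config" where
  "tau d x \<omega> = (\<lambda>Q\<in>Kd d. \<omega> (cube_shift (\<lambda>i. - x i) Q))"

definition stationary :: "nat \<Rightarrow> config measure \<Rightarrow> bool" where
  "stationary d P \<longleftrightarrow> (\<forall>x\<in>Zd d. \<forall>A\<in>sets P.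
      measure P (tau d x -` A \<inter> space P) = measure P A)"

definition ergodic :: "nat \<Rightarrow> config measure \<Rightarrow> bool" where
  "ergodic d P \<longleftrightarrow> (\<forall>A\<in>sets P. (\<forall>x\<in>Zd d. tau d x -` A \<inter> space P = A) \<longrightarrow>
      measure P A = 0 \<or> measure P A = 1)"

definition Xt :: "nat \<Rightarrow> config \<Rightarrow> real \<Rightarrow> (nat \<Rightarrow> real) set" where
  "Xt d \<omega> t = \<Union>{cube_set Q | Q. Q \<in> Kd d \<and> \<omega> Q \<le> t}"

definition Lambda :: "nat \<Rightarrow> nat \<Rightarrow> (nat \<Rightarrow> real) set" where
  "Lambda d n = {x. (\<forall>i<d. - real n \<le> x i \<and> x i \<le> real n) \<and> (\<forall>i\<ge>d. x i = 0)}"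

definition betti_n :: "nat \<Rightarrow> nat \<Rightarrow> config \<Rightarrow> real \<Rightarrow> nat \<Rightarrow> nat" where
  "betti_n d q \<omega> t n = betti d (Xt d \<omega> t \<inter> Lambda d n) q"

end

theory Submission
  imports Defs "HOL-Library.Function_Algebras"
begin

text \<open>Over the rationals \<open>\<beta>\<^sub>q\<close> equals the number of \<open>q\<close>-cubes minus the ranks of the boundary
  operators in degrees \<open>q\<close> and \<open>q + 1\<close>. Each of these three quantities is a monotone, subadditive,
  translation-invariant function of the finite set of cubes, bounded by its cardinality and additive
  on sets of cubes without common faces. Comparing the box with its tilings by blocks of side \<open>m\<close>,
  and averaging over the \<open>m\<^sup>d\<close> positions of the tiling, such a quantity divided by the volume differs
  from an ergodic average of a bounded local observable by \<open>O(1/m) + o(1)\<close>.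
  The ergodic averages over centred boxes converge by iterating Birkhoff's theorem over the coordinate
  directions, and their limits are constant by ergodicity.\<close>

section \<open>The ergodic theorem for lattice actions\<close>

text \<open>Betti numbers cannot enter the block comparison directly: adding a cube may create a
  cycle or fill one, so they are not monotone. The rank formula trades them for three monotone
  quantities, which are treated separately and subtracted only at the end. A single tiling would
  lead to averages over the sublattice of multiples of \<open>m\<close>, for which an ergodic
  \<open>P\<close> may fail to be ergodic. Summing over all offsets makes each lattice point the
  corner of exactly one block, so that averages over the full lattice appear. Superadditivity is
  available only for blocks without common faces, so neighbouring blocks are kept apart by a gap of
  one lattice point. This shrinking is the source of the error O(1/m); the errors near the surface
  of the large box vanish as \<open>n\<close> grows.\<close>

definition rlimsup :: "(nat \<Rightarrow> real) \<Rightarrow> real" where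
  "rlimsup u = real_of_ereal (limsup (\<lambda>n. ereal (u n)))"

text \<open>Two-sided boundedness keeps the limit superior finite, so that
  \<open>real_of_ereal\<close> does not return its default value.\<close>

lemma ereal_rlimsup:
  assumes "\<And>n. a \<le> u n" "\<And>n. u n \<le> b"
  shows "ereal (rlimsup u) = limsup (\<lambda>n. ereal (u n))"
proof -
  have "limsup (\<lambda>n. ereal (u n)) \<le> ereal b"
    using assms by (intro Limsup_bounded) auto
  moreover have "ereal a \<le> liminf (\<lambda>n. ereal (u n))"
    using assms by (intro Liminf_bounded) auto
  then have "ereal a \<le> limsup (\<lambda>n. ereal (u n))"
    using Liminf_le_Limsup[of sequentially "\<lambda>n. ereal (u n)"] by (auto intro: order_trans)
  ultimately show ?thesis
    unfolding rlimsup_def by (cases "limsup (\<lambda>n. ereal (u n))") auto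
qed

lemma rlimsup_bounds:
  assumes "\<And>n. a \<le> u n" "\<And>n. u n \<le> b"
  shows "a \<le> rlimsup u" "rlimsup u \<le> b"
proof -
  have "ereal (rlimsup u) \<le> ereal b"
    unfolding ereal_rlimsup[OF assms] using assms by (intro Limsup_bounded) auto
  then show "rlimsup u \<le> b" by simp
  have "ereal a \<le> liminf (\<lambda>n. ereal (u n))"
    using assms by (intro Liminf_bounded) auto
  then have "ereal a \<le> ereal (rlimsup u)"
    unfolding ereal_rlimsup[OF assms]
    using Liminf_le_Limsup[of sequentially "\<lambda>n. ereal (u n)"] by (auto intro: order_trans)
  then show "a \<le> rlimsup u" by simp
qed

lemma rlimsup_cong_diff:
  assumes "\<And>n. a \<le> u n" "\<And>n. u n \<le> b" "(\<lambda>n. v n - u n) \<longlonglongrightarrow> 0"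
  shows "rlimsup v = rlimsup u"
proof -
  have "limsup (\<lambda>n. ereal (v n - u n) + ereal (u n)) = ereal 0 + limsup (\<lambda>n. ereal (u n))"
    using assms(3) by (intro ereal_limsup_lim_add) auto
  then show ?thesis by (simp add: rlimsup_def)
qed

lemma rlimsup_frequently:
  assumes "\<And>n. a \<le> u n" "\<And>n. u n \<le> b" "0 < e"
  shows "\<exists>n\<ge>N. rlimsup u - e \<le> u n"
proof (rule ccontr)
  assume "\<not> ?thesis"
  then have "\<And>n. n \<ge> N \<Longrightarrow> u n \<le> rlimsup u - e" by force
  then have "limsup (\<lambda>n. ereal (u n)) \<le> ereal (rlimsup u - e)"
    by (intro Limsup_bounded) (auto simp: eventually_sequentially)
  then show False using assms(3) by (simp flip: ereal_rlimsup[OF assms(1,2)])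
qed

text \<open>The last hypothesis says that the upper limit is at most the lower one. The lower limit
  is written as minus the upper limit of \<open>- u\<close>, so that estimates for upper limits
  serve both sides.\<close>

lemma tendsto_rlimsup:
  assumes "\<And>n. a \<le> u n" "\<And>n. u n \<le> b"
    and "rlimsup u \<le> - rlimsup (\<lambda>n. - u n)"
  shows "u \<longlonglongrightarrow> rlimsup u"
proof -
  have m: "ereal (rlimsup (\<lambda>n. - u n)) = limsup (\<lambda>n. ereal (- u n))"
    using assms by (intro ereal_rlimsup[of "-b" _ "-a"]) auto
  have "limsup (\<lambda>n. ereal (- u n)) = - liminf (\<lambda>n. ereal (u n))"
    using ereal_Limsup_uminus[of sequentially "\<lambda>n. ereal (u n)"] by simp
  then have li: "liminf (\<lambda>n. ereal (u n)) = ereal (- rlimsup (\<lambda>n. - u n))"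
    using m by (metis ereal_uminus_uminus uminus_ereal.simps(1))
  have "limsup (\<lambda>n. ereal (u n)) \<le> liminf (\<lambda>n. ereal (u n))"
    using assms(3) by (simp add: li flip: ereal_rlimsup[OF assms(1,2)])
  then have "limsup (\<lambda>n. ereal (u n)) = liminf (\<lambda>n. ereal (u n))"
    using Liminf_le_Limsup[of sequentially "\<lambda>n. ereal (u n)"] by (auto intro: antisym)
  then have "(\<lambda>n. ereal (u n)) \<longlonglongrightarrow> ereal (rlimsup u)"
    by (subst tendsto_iff_Liminf_eq_Limsup) (auto simp: ereal_rlimsup[OF assms(1,2)])
  then show ?thesis by simp
qed

lemma rlimsup_eq:
  assumes "u \<longlonglongrightarrow> l"
  shows "rlimsup u = l"
proof -
  have "(\<lambda>n. ereal (u n)) \<longlonglongrightarrow> ereal l" using assms by simp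
  from lim_imp_Limsup[OF _ this] show ?thesis by (simp add: rlimsup_def)
qed

lemma borel_measurable_rlimsup [measurable]:
  assumes [measurable]: "\<And>n. u n \<in> borel_measurable M"
  shows "(\<lambda>x. rlimsup (\<lambda>n. u n x)) \<in> borel_measurable M"
  unfolding rlimsup_def by measurable

section \<open>The pointwise ergodic theorem for one transformation\<close>

lemma sum_lessThan_add:
  fixes g :: "nat \<Rightarrow> real"
  shows "(\<Sum>i<n + m. g (k + i)) = (\<Sum>i<n. g (k + i)) + (\<Sum>i<m. g (k + n + i))"
  by (induction m) (auto simp: add_ac)

text \<open>Greedy cutting: good stretches are removed from the front until at most \<open>m\<close>
  terms remain. The remaining terms are nonnegative, and ignoring them costs at most
  \<open>m * a\<close>.\<close>

lemma sum_lower_bound_by_blocks: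
  fixes g :: "nat \<Rightarrow> real"
  assumes "\<And>k. 0 \<le> g k" "0 \<le> a"
    and "\<And>k. \<exists>n\<in>{1..m}. real n * a \<le> (\<Sum>i<n. g (k + i))"
  shows "(real l - real m) * a \<le> (\<Sum>i<l. g (k + i))"
proof (induction l arbitrary: k rule: less_induct)
  case (less l)
  show ?case
  proof (cases "l \<le> m")
    case True
    then have "(real l - real m) * a \<le> 0" using assms(2) by (simp add: mult_nonpos_nonneg)
    also have "0 \<le> (\<Sum>i<l. g (k + i))" using assms(1) by (simp add: sum_nonneg)
    finally show ?thesis .
  next
    case False
    obtain n where n: "n \<in> {1..m}" "real n * a \<le> (\<Sum>i<n. g (k + i))" using assms(3) by blast
    have l: "l = n + (l - n)" using n False by auto
    have "(\<Sum>i<l. g (k + i)) = (\<Sum>i<n. g (k + i)) + (\<Sum>i<l - n. g (k + n + i))"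
      using sum_lessThan_add[where n=n and m="l-n" and k=k and g=g] l by simp
    moreover have "(real (l - n) - real m) * a \<le> (\<Sum>i<l - n. g (k + n + i))"
      using n False by (intro less.IH) auto
    moreover have "(real l - real m) * a = real n * a + (real (l - n) - real m) * a"
      using n False by (simp add: of_nat_diff algebra_simps)
    ultimately show ?thesis using n(2) by linarith
  qed
qed

text \<open>Dividing by \<open>l\<close> and letting it grow removes the loss at the end of the
  orbit.\<close>

lemma linear_bound_imp_le:
  fixes I J :: real
  assumes "\<And>l::nat. (real l - real m) * J \<le> real l * I"
  shows "J \<le> I"
proof (rule ccontr)
  assume "\<not> J \<le> I"
  then obtain l where "real m * J < real l * (J - I)"
    using reals_Archimedean3[of "J - I"] by auto
  then show False using assms[of l] by (simp add: algebra_simps)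
qed

definition mpt :: "'a measure \<Rightarrow> ('a \<Rightarrow> 'a) \<Rightarrow> bool" where
  "mpt M T \<longleftrightarrow> T \<in> measurable M M \<and> distr M M T = M"

lemma mptD: "mpt M T \<Longrightarrow> T \<in> measurable M M"
  by (simp add: mpt_def)

lemma mpt_funpow: "mpt M T \<Longrightarrow> mpt M (T ^^ n)"
proof (induction n)
  case 0
  then show ?case by (simp add: mpt_def distr_id[unfolded id_def] id_def)
next
  case (Suc n)
  then have "mpt M (T ^^ n)" "mpt M T" by auto
  then show ?case using distr_distr[of T M M "T ^^ n" M] by (auto simp: mpt_def comp_def)
qed

lemma mpt_integral:
  fixes f :: "'a \<Rightarrow> real"
  assumes "mpt M T" "f \<in> borel_measurable M"
  shows "(\<integral>x. f (T x) \<partial>M) = (\<integral>x. f x \<partial>M)"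
  using integral_distr[of T M M f] assms by (simp add: mpt_def)

definition orbit_avg :: "('a \<Rightarrow> 'a) \<Rightarrow> ('a \<Rightarrow> real) \<Rightarrow> nat \<Rightarrow> 'a \<Rightarrow> real" where
  "orbit_avg T f n x = (\<Sum>i<n. f ((T ^^ i) x)) / real n"

text \<open>The case \<open>r = 0\<close> is included: the quotient is then 0 by convention, so
  averages of length \<open>n = 0\<close> obey the same bounds.\<close>

lemma average_bounds:
  fixes g :: "'i \<Rightarrow> real"
  assumes "\<And>i. i \<in> I \<Longrightarrow> 0 \<le> g i" "\<And>i. i \<in> I \<Longrightarrow> g i \<le> C" "0 \<le> C" "real (card I) \<le> r"
  shows "0 \<le> sum g I / r" "sum g I / r \<le> C"
proof -
  have r: "0 \<le> r" using assms(4) by linarith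
  show "0 \<le> sum g I / r" using assms(1) r by (intro divide_nonneg_nonneg sum_nonneg) auto
  have "sum g I \<le> real (card I) * C" using sum_bounded_above[of I g C] assms(2) by auto
  also have "\<dots> \<le> r * C" using assms(3,4) by (intro mult_right_mono) auto
  finally show "sum g I / r \<le> C" using r assms(3)
    by (cases "r = 0") (auto simp: divide_le_eq mult.commute)
qed

context prob_space
begin

lemma integrable_bounded:
  fixes f :: "'a \<Rightarrow> real"
  assumes "f \<in> borel_measurable M" "\<forall>x\<in>space M. 0 \<le> f x \<and> f x \<le> C"
  shows "integrable M f"
  using assms by (intro integrable_const_bound[of _ C]) auto

context
  fixes T :: "'a \<Rightarrow> 'a" and f :: "'a \<Rightarrow> real" and C :: real
  assumes T: "mpt M T" and f[measurable]: "f \<in> borel_measurable M"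
    and fb: "\<forall>x\<in>space M. 0 \<le> f x \<and> f x \<le> C"
begin

lemma bounded_nonneg: "x \<in> space M \<Longrightarrow> 0 \<le> f x" and bounded_le: "x \<in> space M \<Longrightarrow> f x \<le> C"
  using fb by auto

lemma funpow_space: "x \<in> space M \<Longrightarrow> (T ^^ i) x \<in> space M"
  using mptD[OF mpt_funpow[OF T]] by (rule measurable_space)

lemma funpow_measurable [measurable]: "(T ^^ i) \<in> measurable M M"
  using mptD[OF mpt_funpow[OF T]] .

lemma bound_nonneg: "0 \<le> C"
  using not_empty bounded_nonneg bounded_le by force

lemma orbit_avg_bounds:
  assumes "x \<in> space M"
  shows "0 \<le> orbit_avg T f n x" "orbit_avg T f n x \<le> C"
  unfolding orbit_avg_def using assms funpow_space bounded_nonneg bounded_le bound_nonneg by (intro average_bounds; simp)+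

lemma borel_measurable_orbit_avg [measurable]: "orbit_avg T f n \<in> borel_measurable M"
  unfolding orbit_avg_def[abs_def] by measurable

text \<open>Moving the starting point by one step exchanges a single term of the sum, which changes
  the average by at most \<open>C / n\<close>.\<close>

lemma rlimsup_orbit_avg_T:
  assumes x: "x \<in> space M"
  shows "rlimsup (\<lambda>n. orbit_avg T f n (T x)) = rlimsup (\<lambda>n. orbit_avg T f n x)"
proof (rule rlimsup_cong_diff[where a = 0 and b = C])
  have eq: "orbit_avg T f n (T x) - orbit_avg T f n x = (f ((T ^^ n) x) - f x) / real n" for n
  proof -
    have "(\<Sum>i<n. f ((T ^^ i) (T x))) + f x = (\<Sum>i<n. f ((T ^^ i) x)) + f ((T ^^ n) x)"
      using sum.lessThan_Suc_shift[of "\<lambda>i. f ((T ^^ i) x)" n]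
      by (simp add: funpow_swap1)
    then show ?thesis by (simp add: orbit_avg_def diff_divide_distrib[symmetric] algebra_simps)
  qed
  have "\<bar>(f ((T ^^ n) x) - f x) / real n\<bar> \<le> C / real n" for n
    using bounded_nonneg[OF funpow_space[OF x, of n]] bounded_le[OF funpow_space[OF x, of n]] bounded_nonneg[OF x] bounded_le[OF x]
    by (auto simp: abs_divide intro!: divide_right_mono)
  then have "eventually (\<lambda>n. norm ((f ((T ^^ n) x) - f x) / real n) \<le> C / real n) sequentially"
    by (simp only: real_norm_def eventually_True)
  then show "(\<lambda>n. orbit_avg T f n (T x) - orbit_avg T f n x) \<longlonglongrightarrow> 0"
    unfolding eq by (rule Lim_null_comparison) (rule lim_const_over_n)
qed (use orbit_avg_bounds[OF x] in auto)

lemma rlimsup_orbit_avg_funpow: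
  assumes x: "x \<in> space M"
  shows "rlimsup (\<lambda>n. orbit_avg T f n ((T ^^ i) x)) = rlimsup (\<lambda>n. orbit_avg T f n x)"
  by (induction i) (auto simp: rlimsup_orbit_avg_T funpow_space x)

text \<open>Katznelson--Weiss: cut an orbit into stretches of length at most \<open>m'\<close> on which the average of
  \<open>f\<close> almost attains its limit superior; the points without such a stretch form the small set \<open>B m\<close>,
  where \<open>f\<close> is increased by \<open>C\<close>.\<close>

lemma integral_rlimsup_orbit_avg_le:
  "(\<integral>x. rlimsup (\<lambda>n. orbit_avg T f n x) \<partial>M) \<le> (\<integral>x. f x \<partial>M)"
proof (rule field_le_epsilon)
  fix e :: real assume e: "0 < e"
  define F where "F x = rlimsup (\<lambda>n. orbit_avg T f n x)" for x
  \<comment> \<open>The total loss is \<open>(1 + C) * \<epsilon>\<close>: one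
    \<open>\<epsilon>\<close> from lowering \<open>F\<close>, and \<open>C * \<epsilon>\<close> from
    raising \<open>f\<close> on a set of measure below \<open>\<epsilon>\<close>.\<close>
  define \<epsilon> where "\<epsilon> = e / (1 + C)"
  have \<epsilon>: "0 < \<epsilon>" using e bound_nonneg by (simp add: \<epsilon>_def)
  have F[measurable]: "F \<in> borel_measurable M" unfolding F_def[abs_def] by measurable
  have Fb: "0 \<le> F x" "F x \<le> C" if "x \<in> space M" for x
    unfolding F_def using orbit_avg_bounds[OF that] by (auto intro: rlimsup_bounds)
  have Fe: "F x - \<epsilon> \<le> C" if "x \<in> space M" for x
    using Fb(2)[OF that] \<epsilon> by linarith
  define B where "B m = {x\<in>space M. \<forall>n\<in>{1..m}. orbit_avg T f n x < F x - \<epsilon>}" for m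
  have B[measurable]: "B m \<in> sets M" for m unfolding B_def by measurable
  have "(\<Inter>m. B m) = {}"
  proof (rule ccontr)
    assume "(\<Inter>m. B m) \<noteq> {}"
    then obtain x where x: "\<And>m. x \<in> B m" by auto
    then have xs: "x \<in> space M" by (auto simp: B_def)
    obtain n where "n \<ge> 1" "F x - \<epsilon> \<le> orbit_avg T f n x"
      using rlimsup_frequently[of 0 "\<lambda>n. orbit_avg T f n x", where N = 1, OF orbit_avg_bounds[OF xs] \<epsilon>] by (auto simp: F_def)
    then show False using x[of n] by (force simp: B_def)
  qed
  moreover have "(\<lambda>m. measure M (B m)) \<longlonglongrightarrow> measure M (\<Inter>m. B m)"
    by (rule finite_Lim_measure_decseq) (auto simp: B_def decseq_def)
  ultimately have "(\<lambda>m. measure M (B m)) \<longlonglongrightarrow> 0" by simp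
  from order_tendstoD(2)[OF this \<epsilon>] obtain m where m: "measure M (B m) < \<epsilon>"
    by (auto simp: eventually_sequentially)
  \<comment> \<open>Points of \<open>B m\<close> use a stretch of length one, which must be allowed
    even if \<open>m = 0\<close>.\<close>
  define m' where "m' = max 1 m"
  define g where "g x = f x + C * indicator (B m) x" for x
  have g[measurable]: "g \<in> borel_measurable M" unfolding g_def by measurable
  have g0: "0 \<le> g x" and gC: "g x \<le> 2 * C" and gf: "f x \<le> g x" if "x \<in> space M" for x
    using bounded_nonneg[OF that] bounded_le[OF that] bound_nonneg by (auto simp: g_def indicator_def)
  \<comment> \<open>Truncation at 0 is needed because the cutting argument drops the last terms
    against a nonnegative threshold, while \<open>F x - \<epsilon>\<close> may be negative.\<close>
  define a where "a x = max 0 (F x - \<epsilon>)" for x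
  have block: "\<exists>n\<in>{1..m'}. real n * a x \<le> (\<Sum>i<n. g ((T ^^ i) x))" if x: "x \<in> space M" for x
  proof (cases "x \<in> B m")
    case True
    have "a x \<le> C" using Fb[OF x] \<epsilon> bound_nonneg by (auto simp: a_def)
    then show ?thesis using True bounded_nonneg[OF x] by (intro bexI[of _ 1]) (auto simp: g_def m'_def)
  next
    case False
    then obtain n where n: "n \<in> {1..m}" "F x - \<epsilon> \<le> orbit_avg T f n x"
      using x by (auto simp: B_def not_less)
    then have "a x \<le> orbit_avg T f n x" using orbit_avg_bounds[OF x] by (auto simp: a_def)
    then have "real n * a x \<le> (\<Sum>i<n. f ((T ^^ i) x))"
      using n by (simp add: orbit_avg_def field_simps)
    also have "\<dots> \<le> (\<Sum>i<n. g ((T ^^ i) x))" using gf funpow_space[OF x] by (intro sum_mono) auto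
    finally show ?thesis using n by (intro bexI[of _ n]) (auto simp: m'_def)
  qed
  have "(real l - real m') * (\<integral>x. a x \<partial>M) \<le> real l * (\<integral>x. g x \<partial>M)" for l
  proof -
    have ig: "integrable M (\<lambda>x. g ((T ^^ i) x))" for i
      using g0 gC funpow_space by (intro integrable_bounded[of _ "2*C"]) auto
    have "(real l - real m') * (\<integral>x. a x \<partial>M) = (\<integral>x. (real l - real m') * a x \<partial>M)" by simp
    also have "\<dots> \<le> (\<integral>x. (\<Sum>i<l. g ((T ^^ i) x)) \<partial>M)"
    proof (intro integral_mono)
      show "integrable M (\<lambda>x. (real l - real m') * a x)"
        using Fe bound_nonneg unfolding a_def
        by (intro integrable_mult_right integrable_bounded[of _ C]) auto
      show "integrable M (\<lambda>x. \<Sum>i<l. g ((T ^^ i) x))" using ig by auto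
      fix x assume x: "x \<in> space M"
      have "(real l - real m') * a x \<le> (\<Sum>i<l. g ((T ^^ (0 + i)) x))"
      proof (rule sum_lower_bound_by_blocks)
        fix k
        \<comment> \<open>The upper limit is constant along the orbit, so one threshold works
          wherever the next stretch starts.\<close>
        have "a ((T ^^ k) x) = a x"
          by (simp add: a_def F_def rlimsup_orbit_avg_funpow x)
        then show "\<exists>n\<in>{1..m'}. real n * a x \<le> (\<Sum>i<n. g ((T ^^ (k + i)) x))"
          using block[OF funpow_space[OF x, of k]]
          by (simp add: funpow_add[of k] add.commute[of k] comp_def funpow_add)
      qed (use g0 funpow_space x in \<open>auto simp: a_def\<close>)
      then show "(real l - real m') * a x \<le> (\<Sum>i<l. g ((T ^^ i) x))" by simp
    qed
    also have "\<dots> = (\<Sum>i<l. \<integral>x. g ((T ^^ i) x) \<partial>M)" using ig by (rule Bochner_Integration.integral_sum)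
    also have "\<dots> = real l * (\<integral>x. g x \<partial>M)"
      by (simp add: mpt_integral[OF mpt_funpow[OF T] g])
    finally show ?thesis .
  qed
  then have "(\<integral>x. a x \<partial>M) \<le> (\<integral>x. g x \<partial>M)" by (rule linear_bound_imp_le)
  also have "(\<integral>x. g x \<partial>M) = (\<integral>x. f x \<partial>M) + C * measure M (B m)"
    unfolding g_def using integrable_bounded[OF f fb]
    by (subst Bochner_Integration.integral_add) (auto simp: less_top[symmetric] intro!: integrable_real_indicator)
  finally have 1: "(\<integral>x. a x \<partial>M) \<le> (\<integral>x. f x \<partial>M) + C * \<epsilon>"
    using m bound_nonneg mult_left_mono[of "measure M (B m)" \<epsilon> C] by linarith
  have iF: "integrable M F" using Fb by (intro integrable_bounded) auto
  have "(\<integral>x. F x \<partial>M) - \<epsilon> = (\<integral>x. F x - \<epsilon> \<partial>M)" using iF by (simp add: prob_space)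
  also have "\<dots> \<le> (\<integral>x. a x \<partial>M)" using iF Fe bound_nonneg
    by (intro integral_mono) (auto simp: a_def intro!: integrable_bounded[of _ C])
  finally have "(\<integral>x. F x \<partial>M) \<le> (\<integral>x. f x \<partial>M) + (1 + C) * \<epsilon>"
    using 1 by (simp add: algebra_simps)
  also have "(1 + C) * \<epsilon> = e" using bound_nonneg by (simp add: \<epsilon>_def)
  finally show "(\<integral>x. rlimsup (\<lambda>n. orbit_avg T f n x) \<partial>M) \<le> (\<integral>x. f x \<partial>M) + e"
    by (simp add: F_def)
qed

end

text \<open>The integral inequality is applied to \<open>f\<close> and to \<open>C - f\<close>,
  which is again nonnegative. With \<open>F\<close> and \<open>F'\<close> the two upper limits,
  \<open>F + F' - C\<close> is the upper minus the lower limit of the averages of \<open>f\<close>,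
  hence nonnegative, while its integral is at most 0. So it vanishes almost everywhere, and both
  integral inequalities are equalities.\<close>

lemma birkhoff:
  fixes f :: "'a \<Rightarrow> real"
  assumes T: "mpt M T" and f[measurable]: "f \<in> borel_measurable M"
    and fb: "\<forall>x\<in>space M. 0 \<le> f x \<and> f x \<le> C"
  obtains g where "g \<in> borel_measurable M" "\<forall>x\<in>space M. 0 \<le> g x \<and> g x \<le> C"
    "(\<integral>x. g x \<partial>M) = (\<integral>x. f x \<partial>M)"
    "AE x in M. (\<lambda>n. orbit_avg T f n x) \<longlonglongrightarrow> g x"
proof -
  define F where "F x = rlimsup (\<lambda>n. orbit_avg T f n x)" for x
  define F' where "F' x = rlimsup (\<lambda>n. orbit_avg T (\<lambda>x. C - f x) n x)" for x
  note b = orbit_avg_bounds[OF T f fb]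
  note [measurable] = borel_measurable_orbit_avg[OF T f fb]
  have f'b: "\<forall>x\<in>space M. 0 \<le> C - f x \<and> C - f x \<le> C"
    using fb by auto
  have f': "(\<lambda>x. C - f x) \<in> borel_measurable M" by measurable
  note b' = orbit_avg_bounds[OF T f' f'b]
  note [measurable] = borel_measurable_orbit_avg[OF T f' f'b]
  have F[measurable]: "F \<in> borel_measurable M" "F' \<in> borel_measurable M"
    unfolding F_def[abs_def] F'_def[abs_def] by measurable
  have Fb: "0 \<le> F x" "F x \<le> C" "0 \<le> F' x" "F' x \<le> C" if "x \<in> space M" for x
    unfolding F_def F'_def by (rule rlimsup_bounds[of 0 _ C], rule b b', rule that, rule b b', rule that)+
  have iF: "integrable M F" "integrable M F'" using Fb by (auto intro!: integrable_bounded[of _ C])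
  have F'eq: "F' x = C + rlimsup (\<lambda>n. - orbit_avg T f n x)" if "x \<in> space M" for x
  proof -
    have "F' x = rlimsup (\<lambda>n. C + - orbit_avg T f n x)"
      unfolding F'_def
    proof (rule rlimsup_cong_diff[where a = 0 and b = C])
      \<comment> \<open>The identity can fail at \<open>n = 0\<close>, where both averages are 0 by
        the convention for division.\<close>
      have "eventually (\<lambda>n. orbit_avg T (\<lambda>x. C - f x) n x - (C + - orbit_avg T f n x) = 0) sequentially"
        using eventually_gt_at_top[of 0]
        by eventually_elim (auto simp: orbit_avg_def sum_subtractf diff_divide_distrib)
      then show "(\<lambda>n. orbit_avg T (\<lambda>x. C - f x) n x - (C + - orbit_avg T f n x)) \<longlonglongrightarrow> 0"
        by (rule tendsto_eventually)
    qed (use b[OF that] in auto)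
    also have "\<dots> = C + rlimsup (\<lambda>n. - orbit_avg T f n x)"
    proof -
      have "limsup (\<lambda>n. ereal C + ereal (- orbit_avg T f n x)) = ereal C + limsup (\<lambda>n. ereal (- orbit_avg T f n x))"
        by (intro ereal_limsup_lim_add) auto
      moreover have r: "ereal (rlimsup (\<lambda>n. - orbit_avg T f n x)) = limsup (\<lambda>n. ereal (- orbit_avg T f n x))"
        using b[OF that] by (intro ereal_rlimsup[of "-C" _ 0]) auto
      ultimately have "limsup (\<lambda>n. ereal (C + - orbit_avg T f n x)) = ereal (C + rlimsup (\<lambda>n. - orbit_avg T f n x))"
        unfolding r[symmetric] by simp
      then show ?thesis unfolding rlimsup_def[of "\<lambda>n. C + - orbit_avg T f n x"] by simp
    qed
    finally show ?thesis .
  qed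
  have i1: "(\<integral>x. F x \<partial>M) \<le> (\<integral>x. f x \<partial>M)"
    unfolding F_def by (rule integral_rlimsup_orbit_avg_le[OF T f fb])
  have "(\<integral>x. F' x \<partial>M) \<le> (\<integral>x. C - f x \<partial>M)"
    unfolding F'_def by (rule integral_rlimsup_orbit_avg_le[OF T f' f'b])
  also have "\<dots> = C - (\<integral>x. f x \<partial>M)"
    using integrable_bounded[OF f fb] by (simp add: prob_space)
  finally have i2: "(\<integral>x. F' x \<partial>M) \<le> C - (\<integral>x. f x \<partial>M)" .
  have ge: "C \<le> F x + F' x" if x: "x \<in> space M" for x
  proof (rule field_le_epsilon)
    fix e :: real assume e: "0 < e"
    have ev: "eventually (\<lambda>n. u n < rlimsup u + e) sequentially"
      if "\<And>n. a \<le> u n" "\<And>n. u n \<le> b" "0 < e" for u :: "nat \<Rightarrow> real" and a b e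
    proof -
      have "limsup (\<lambda>n. ereal (u n)) < ereal (rlimsup u + e)"
        using that(3) by (simp flip: ereal_rlimsup[OF that(1,2)])
      from Limsup_lessD[OF this] show ?thesis by simp
    qed
    have "eventually (\<lambda>n. orbit_avg T f n x < F x + e/2) sequentially"
      unfolding F_def using b[OF x] e by (intro ev) auto
    moreover have "eventually (\<lambda>n. - orbit_avg T f n x < rlimsup (\<lambda>n. - orbit_avg T f n x) + e/2) sequentially"
      using b[OF x] e by (intro ev[of "-C" _ 0]) auto
    ultimately have "eventually (\<lambda>n. C \<le> F x + F' x + e) sequentially"
      by eventually_elim (simp add: F'eq[OF x])
    then show "C \<le> F x + F' x + e" by simp
  qed
  have "(\<integral>x. F x + F' x - C \<partial>M) = (\<integral>x. F x \<partial>M) + (\<integral>x. F' x \<partial>M) - C"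
    using iF by (simp add: prob_space)
  then have "(\<integral>x. F x + F' x - C \<partial>M) \<le> 0" using i1 i2 by simp
  moreover have "0 \<le> (\<integral>x. F x + F' x - C \<partial>M)" using ge by (intro integral_nonneg_AE) auto
  ultimately have z: "(\<integral>x. F x + F' x - C \<partial>M) = 0" by simp
  then have "AE x in M. F x + F' x - C = 0"
    using iF ge by (subst (asm) integral_nonneg_eq_0_iff_AE) auto
  then have conv: "AE x in M. (\<lambda>n. orbit_avg T f n x) \<longlonglongrightarrow> F x"
  proof (rule AE_mp, intro AE_I2 impI)
    fix x assume x: "x \<in> space M" and 0: "F x + F' x - C = 0"
    show "(\<lambda>n. orbit_avg T f n x) \<longlonglongrightarrow> F x"
      unfolding F_def
    proof (rule tendsto_rlimsup[OF b[OF x]])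
      show "rlimsup (\<lambda>n. orbit_avg T f n x) \<le> - rlimsup (\<lambda>n. - orbit_avg T f n x)"
        using 0 F'eq[OF x] by (simp add: F_def)
    qed
  qed
  have "(\<integral>x. F x \<partial>M) = (\<integral>x. f x \<partial>M)"
    using z i1 i2 iF by (simp add: prob_space)
  then show ?thesis using that[OF F(1) _ _ conv] Fb by auto
qed

end

section \<open>Two-sided averages for actions of the integers\<close>

definition flow :: "'a measure \<Rightarrow> (int \<Rightarrow> 'a \<Rightarrow> 'a) \<Rightarrow> bool" where
  "flow M S \<longleftrightarrow> (\<forall>k. mpt M (S k)) \<and> (\<forall>x\<in>space M. S 0 x = x \<and> (\<forall>j k. S (j + k) x = S j (S k x)))"

definition flow_avg :: "(int \<Rightarrow> 'a \<Rightarrow> 'a) \<Rightarrow> ('a \<Rightarrow> real) \<Rightarrow> nat \<Rightarrow> 'a \<Rightarrow> real" where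
  "flow_avg S f n x = (\<Sum>k\<in>{- int n..<int n}. f (S k x)) / (2 * real n)"

lemma sum_symmetric_interval:
  fixes h :: "int \<Rightarrow> real"
  shows "(\<Sum>k\<in>{- int n..<int n}. h k) = (\<Sum>i<n. h (int i)) + (\<Sum>i<n. h (- 1 - int i))"
proof (induction n)
  case (Suc n)
  have "{- int (Suc n)..<int (Suc n)} = insert (- 1 - int n) (insert (int n) {- int n..<int n})"
    by auto
  then show ?case using Suc by simp
qed simp

lemma flow_measurable [measurable_dest]: "flow M S \<Longrightarrow> S k \<in> measurable M M"
  by (simp add: flow_def mptD)

lemma flow_space: "flow M S \<Longrightarrow> x \<in> space M \<Longrightarrow> S k x \<in> space M"
  using flow_measurable by (metis measurable_space)

lemma flow_avg_bounds:
  assumes "flow M S" "\<forall>x\<in>space M. 0 \<le> f x \<and> f x \<le> C" "x \<in> space M"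
  shows "0 \<le> flow_avg S f n x" "flow_avg S f n x \<le> C"
proof -
  have "0 \<le> C" using assms(2,3) by force
  moreover have "0 \<le> f (S k x) \<and> f (S k x) \<le> C" for k
    using assms(2) flow_space[OF assms(1,3)] by blast
  ultimately show "0 \<le> flow_avg S f n x" "flow_avg S f n x \<le> C"
    unfolding flow_avg_def by (intro average_bounds; simp)+
qed

lemma borel_measurable_flow_avg [measurable (raw)]:
  assumes S: "flow M S" and [measurable]: "f \<in> borel_measurable M"
  shows "flow_avg S f n \<in> borel_measurable M"
  using flow_measurable[OF S, measurable] unfolding flow_avg_def[abs_def] by measurable

context prob_space
begin

text \<open>The negative times form the forward orbit of \<open>S (-1)\<close> started at
  \<open>S (-1) x\<close>. The one-sided theorem is applied in both directions; each limit has the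
  integral of \<open>f\<close>, and so has their mean.\<close>

lemma flow_avg_tendsto:
  fixes f :: "'a \<Rightarrow> real"
  assumes S: "flow M S" and f[measurable]: "f \<in> borel_measurable M"
    and fb: "\<forall>x\<in>space M. 0 \<le> f x \<and> f x \<le> C"
  obtains g where "g \<in> borel_measurable M" "\<forall>x\<in>space M. 0 \<le> g x \<and> g x \<le> C"
    "(\<integral>x. g x \<partial>M) = (\<integral>x. f x \<partial>M)" "AE x in M. (\<lambda>n. flow_avg S f n x) \<longlonglongrightarrow> g x"
proof -
  note [measurable] = flow_measurable[OF S]
  have mp: "mpt M (S k)" for k using S by (simp add: flow_def)
  have add: "S (j + k) x = S j (S k x)" and zero: "S 0 x = x" if "x \<in> space M" for j k x
    using S that by (auto simp: flow_def)
  have pow: "(S s ^^ i) x = S (int i * s) x" if "x \<in> space M" for i x s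
  proof (induction i)
    case (Suc i)
    then show ?case using that by (simp add: add[symmetric] algebra_simps)
  qed (simp add: zero that)
  obtain g where g[measurable]: "g \<in> borel_measurable M" and gb: "\<forall>x\<in>space M. 0 \<le> g x \<and> g x \<le> C"
    and gi: "(\<integral>x. g x \<partial>M) = (\<integral>x. f x \<partial>M)" and gl: "AE x in M. (\<lambda>n. orbit_avg (S 1) f n x) \<longlonglongrightarrow> g x"
    using birkhoff[OF mp f fb] by blast
  have f'b: "\<forall>x\<in>space M. 0 \<le> f (S (-1) x) \<and> f (S (-1) x) \<le> C" using fb flow_space[OF S] by auto
  have f': "(\<lambda>x. f (S (-1) x)) \<in> borel_measurable M" by measurable
  obtain g' where g'[measurable]: "g' \<in> borel_measurable M" and g'b: "\<forall>x\<in>space M. 0 \<le> g' x \<and> g' x \<le> C"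
    and g'i: "(\<integral>x. g' x \<partial>M) = (\<integral>x. f (S (-1) x) \<partial>M)"
    and g'l: "AE x in M. (\<lambda>n. orbit_avg (S (-1)) (\<lambda>x. f (S (-1) x)) n x) \<longlonglongrightarrow> g' x"
    using birkhoff[OF mp f' f'b] by blast
  have eq: "flow_avg S f n x = (orbit_avg (S 1) f n x + orbit_avg (S (-1)) (\<lambda>x. f (S (-1) x)) n x) / 2"
    if x: "x \<in> space M" for n x
    unfolding flow_avg_def orbit_avg_def sum_symmetric_interval pow[OF x]
    by (simp add: add[OF x, symmetric] add_divide_distrib mult.commute)
  have "AE x in M. (\<lambda>n. flow_avg S f n x) \<longlonglongrightarrow> (g x + g' x) / 2"
    using gl g'l AE_space
    by eventually_elim (auto simp: eq intro!: tendsto_intros)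
  moreover have "(\<integral>x. (g x + g' x) / 2 \<partial>M) = (\<integral>x. f x \<partial>M)"
    using integrable_bounded[OF g gb] integrable_bounded[OF g' g'b] gi g'i mpt_integral[OF mp f, of "-1"]
    by simp
  moreover have "\<forall>x\<in>space M. 0 \<le> (g x + g' x) / 2 \<and> (g x + g' x) / 2 \<le> C"
    using gb g'b by fastforce
  ultimately show ?thesis using that[of "\<lambda>x. (g x + g' x) / 2"] by simp
qed

text \<open>For \<open>n \<ge> N\<close> the averages of \<open>fs n\<close> and \<open>f\<close> differ by at most the average of
  \<open>sup\<^sub>m\<^sub>\<ge>\<^sub>N \<bar>fs m - f\<bar>\<close>, whose integral tends to \<open>0\<close> with \<open>N\<close>.\<close>

lemma flow_avg_tendsto_seq:
  fixes f :: "'a \<Rightarrow> real"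
  assumes S: "flow M S" and f[measurable]: "f \<in> borel_measurable M" "\<And>n. fs n \<in> borel_measurable M"
    and fb: "\<forall>x\<in>space M. 0 \<le> f x \<and> f x \<le> C"
    and fsb: "\<And>n. \<forall>x\<in>space M. 0 \<le> fs n x \<and> fs n x \<le> C"
    and lim: "AE x in M. (\<lambda>n. fs n x) \<longlonglongrightarrow> f x"
  obtains g where "g \<in> borel_measurable M" "\<forall>x\<in>space M. 0 \<le> g x \<and> g x \<le> C"
    "AE x in M. (\<lambda>n. flow_avg S (fs n) n x) \<longlonglongrightarrow> g x"
proof -
  define h where "h N x = (SUP m. \<bar>fs (N + m) x - f x\<bar>)" for N x
  have dist: "0 \<le> \<bar>fs m x - f x\<bar>" "\<bar>fs m x - f x\<bar> \<le> C" if "x \<in> space M" for m x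
    using fb[rule_format, OF that] fsb[rule_format, OF that, of m] by auto
  then have bdd: "bdd_above (range (\<lambda>m. \<bar>fs (N + m) x - f x\<bar>))" if "x \<in> space M" for N x
    using that by (intro bdd_aboveI2[of _ _ C]) auto
  have h[measurable]: "h N \<in> borel_measurable M" for N
    unfolding h_def[abs_def] using bdd by (intro borel_measurable_cSUP) auto
  have hdist: "\<bar>fs m x - f x\<bar> \<le> h N x" if "x \<in> space M" "m \<ge> N" for m N x
    unfolding h_def using that by (intro cSUP_upper2[OF bdd, of x "m - N"]) auto
  have hb: "\<forall>x\<in>space M. 0 \<le> h N x \<and> h N x \<le> C" for N
  proof (intro ballI conjI)
    fix x assume x: "x \<in> space M"
    show "0 \<le> h N x" using hdist[OF x, of N N] by linarith
    show "h N x \<le> C" unfolding h_def using dist[OF x] by (intro cSUP_least) auto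
  qed
  have "AE x in M. (\<lambda>N. h N x) \<longlonglongrightarrow> 0"
    using lim AE_space
  proof eventually_elim
    fix x assume l: "(\<lambda>n. fs n x) \<longlonglongrightarrow> f x" and x: "x \<in> space M"
    show "(\<lambda>N. h N x) \<longlonglongrightarrow> 0"
    proof (rule LIMSEQ_I)
      fix r :: real assume r: "0 < r"
      then obtain N where N: "\<And>n. n \<ge> N \<Longrightarrow> \<bar>fs n x - f x\<bar> < r/2"
        using LIMSEQ_D[OF l, of "r/2"] by auto
      have "h n x \<le> r/2" if "n \<ge> N" for n
        unfolding h_def using N that by (intro cSUP_least) (auto intro: less_imp_le)
      then show "\<exists>N. \<forall>n\<ge>N. norm (h n x - 0) < r"
        using hb x r by (intro exI[of _ N]) fastforce
    qed
  qed
  then have "(\<lambda>N. \<integral>x. h N x \<partial>M) \<longlonglongrightarrow> (\<integral>x. 0 \<partial>M)"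
    using hb by (intro integral_dominated_convergence[where w = "\<lambda>_. C"]) auto
  then have hlim: "(\<lambda>N. \<integral>x. h N x \<partial>M) \<longlonglongrightarrow> 0" by simp
  define u where "u n x = \<bar>flow_avg S (fs n) n x - flow_avg S f n x\<bar>" for n x
  have [measurable]: "flow_avg S (fs n) n \<in> borel_measurable M" "flow_avg S f n \<in> borel_measurable M" for n
    using borel_measurable_flow_avg[OF S] by auto
  have um[measurable]: "u n \<in> borel_measurable M" for n unfolding u_def[abs_def] by measurable
  have ub: "0 \<le> u n x" "u n x \<le> C" if "x \<in> space M" for n x
    using flow_avg_bounds[OF S fb that, of n] flow_avg_bounds[OF S fsb that, of n n] by (auto simp: u_def)
  have uh: "u n x \<le> flow_avg S (h N) n x" if x: "x \<in> space M" and n: "n \<ge> N" for n N x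
  proof -
    have "u n x = \<bar>\<Sum>k\<in>{- int n..<int n}. fs n (S k x) - f (S k x)\<bar> / (2 * real n)"
      by (simp add: u_def flow_avg_def sum_subtractf flip: diff_divide_distrib)
    also have "\<dots> \<le> (\<Sum>k\<in>{- int n..<int n}. \<bar>fs n (S k x) - f (S k x)\<bar>) / (2 * real n)"
      by (intro divide_right_mono sum_abs) auto
    also have "\<dots> \<le> flow_avg S (h N) n x"
      unfolding flow_avg_def using hdist[OF flow_space[OF S x] n] by (intro divide_right_mono sum_mono) auto
    finally show ?thesis .
  qed
  define D where "D x = rlimsup (\<lambda>n. u n x)" for x
  have [measurable]: "D \<in> borel_measurable M" unfolding D_def[abs_def] by measurable
  have Db: "\<forall>x\<in>space M. 0 \<le> D x \<and> D x \<le> C"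
    unfolding D_def using ub by (auto intro: rlimsup_bounds[of 0 _ C])
  \<comment> \<open>For every \<open>N\<close> the limit of the averages of \<open>h N\<close>
    dominates \<open>D\<close> and has the same integral as \<open>h N\<close>; this is where the
    equality of integrals in \<open>flow_avg_tendsto\<close> is used.\<close>
  have "(\<integral>x. D x \<partial>M) \<le> (\<integral>x. h N x \<partial>M)" for N
  proof -
    obtain g where g[measurable]: "g \<in> borel_measurable M" and gb: "\<forall>x\<in>space M. 0 \<le> g x \<and> g x \<le> C"
      and gi: "(\<integral>x. g x \<partial>M) = (\<integral>x. h N x \<partial>M)" and gl: "AE x in M. (\<lambda>n. flow_avg S (h N) n x) \<longlonglongrightarrow> g x"
      using flow_avg_tendsto[OF S h hb] by blast
    have "AE x in M. D x \<le> g x"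
      using gl AE_space
    proof eventually_elim
      fix x assume l: "(\<lambda>n. flow_avg S (h N) n x) \<longlonglongrightarrow> g x" and x: "x \<in> space M"
      have "ereal (D x) = limsup (\<lambda>n. ereal (u n x))"
        unfolding D_def using ub[OF x] by (rule ereal_rlimsup)
      also have "\<dots> \<le> limsup (\<lambda>n. ereal (flow_avg S (h N) n x))"
        using uh[OF x] by (intro Limsup_mono) (auto simp: eventually_sequentially)
      also have "\<dots> = ereal (g x)" using l by (intro lim_imp_Limsup) auto
      finally show "D x \<le> g x" by simp
    qed
    then have "(\<integral>x. D x \<partial>M) \<le> (\<integral>x. g x \<partial>M)"
      using integrable_bounded[OF _ Db] integrable_bounded[OF g gb] by (intro integral_mono_AE) auto
    then show ?thesis using gi by simp
  qed
  then have "(\<integral>x. D x \<partial>M) \<le> 0" using hlim by (intro LIMSEQ_le_const) auto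
  moreover have "0 \<le> (\<integral>x. D x \<partial>M)" using Db by (intro integral_nonneg_AE) auto
  ultimately have "(\<integral>x. D x \<partial>M) = 0" by simp
  then have D0: "AE x in M. D x = 0"
    using integrable_bounded[OF _ Db] Db by (subst (asm) integral_nonneg_eq_0_iff_AE) auto
  obtain g where g: "g \<in> borel_measurable M" "\<forall>x\<in>space M. 0 \<le> g x \<and> g x \<le> C"
    "AE x in M. (\<lambda>n. flow_avg S f n x) \<longlonglongrightarrow> g x"
    using flow_avg_tendsto[OF S f(1) fb] by blast
  have "AE x in M. (\<lambda>n. flow_avg S (fs n) n x) \<longlonglongrightarrow> g x"
    using g(3) D0 AE_space
  proof eventually_elim
    fix x assume l: "(\<lambda>n. flow_avg S f n x) \<longlonglongrightarrow> g x" and D: "D x = 0" and x: "x \<in> space M"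
    have "rlimsup (\<lambda>n. - u n x) \<le> 0" using ub[OF x] by (intro rlimsup_bounds[of "-C"]) auto
    then have "(\<lambda>n. u n x) \<longlonglongrightarrow> rlimsup (\<lambda>n. u n x)"
      using D by (intro tendsto_rlimsup[OF ub[OF x]]) (simp add: D_def)
    then have "(\<lambda>n. \<bar>flow_avg S (fs n) n x - flow_avg S f n x\<bar>) \<longlonglongrightarrow> 0"
      using D by (simp add: D_def u_def)
    then have "(\<lambda>n. flow_avg S (fs n) n x - flow_avg S f n x) \<longlonglongrightarrow> 0"
      by (simp add: tendsto_rabs_zero_iff)
    from tendsto_add[OF this l] show "(\<lambda>n. flow_avg S (fs n) n x) \<longlonglongrightarrow> g x" by simp
  qed
  then show ?thesis using that g by blast
qed

text \<open>The constant is the essential supremum of \<open>h\<close>, obtained as the infimum of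
  the levels whose sublevel set has full probability. Below it, sublevel sets have probability 0,
  and countably many levels pinch \<open>h\<close> from both sides.\<close>

lemma AE_const_of_zero_one:
  fixes h :: "'a \<Rightarrow> real"
  assumes [measurable]: "h \<in> borel_measurable M" and hb: "\<forall>x\<in>space M. 0 \<le> h x \<and> h x \<le> C"
    and zo: "\<And>a. prob {x\<in>space M. h x \<le> a} = 0 \<or> prob {x\<in>space M. h x \<le> a} = 1"
  shows "\<exists>c. AE x in M. h x = c"
proof -
  define A where "A = {a. prob {x\<in>space M. h x \<le> a} = 1}"
  define c where "c = Inf A"
  have "{x\<in>space M. h x \<le> C} = space M" using hb by auto
  then have CA: "C \<in> A" by (simp add: A_def prob_space)
  have "0 \<le> a" if "a \<in> A" for a
  proof (rule ccontr)
    assume "\<not> 0 \<le> a"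
    then have "{x\<in>space M. h x \<le> a} = {}" using hb by force
    then show False using that unfolding A_def mem_Collect_eq by (metis measure_empty zero_neq_one)
  qed
  then have bdd: "bdd_below A" by (rule bdd_belowI)
  have "AE x in M. h x \<le> c + 1 / real (Suc n)" for n
  proof -
    have "c < c + 1 / real (Suc n)" by simp
    then obtain a where a: "a \<in> A" "a < c + 1 / real (Suc n)"
      using CA bdd unfolding c_def by (metis cInf_less_iff empty_iff)
    then have "AE x in M. h x \<le> a" using prob_eq_1[of "{x\<in>space M. h x \<le> a}"] by (auto simp: A_def)
    then show ?thesis using a by (auto elim!: eventually_mono)
  qed
  then have "AE x in M. \<forall>n. h x \<le> c + 1 / real (Suc n)" by (simp add: AE_all_countable)
  moreover have "AE x in M. c - 1 / real (Suc n) \<le> h x" for n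
  proof -
    have "c - 1 / real (Suc n) < c" by simp
    then have "c - 1 / real (Suc n) \<notin> A" using bdd cInf_lower[of _ A] unfolding c_def by force
    then have "prob {x\<in>space M. h x \<le> c - 1 / real (Suc n)} = 0" using zo by (auto simp: A_def)
    then have "AE x in M. \<not> h x \<le> c - 1 / real (Suc n)"
      by (subst AE_iff_measurable[OF _ refl]) (auto simp: emeasure_eq_measure)
    then show ?thesis by eventually_elim simp
  qed
  then have "AE x in M. \<forall>n. c - 1 / real (Suc n) \<le> h x"
    by (simp add: AE_all_countable)
  ultimately have "AE x in M. h x = c"
  proof eventually_elim
    fix x assume 1: "\<forall>n. h x \<le> c + 1 / real (Suc n)" and 2: "\<forall>n. c - 1 / real (Suc n) \<le> h x"
    have l: "(\<lambda>n. 1 / real (Suc n)) \<longlonglongrightarrow> 0" by (rule LIMSEQ_Suc[OF lim_const_over_n])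
    have "(\<lambda>n. c + 1 / real (Suc n)) \<longlonglongrightarrow> c + 0" by (intro tendsto_intros l)
    then have "h x \<le> c + 0" by (rule LIMSEQ_le_const) (use 1 in blast)
    moreover have "(\<lambda>n. c - 1 / real (Suc n)) \<longlonglongrightarrow> c - 0" by (intro tendsto_intros l)
    then have "c - 0 \<le> h x" by (rule LIMSEQ_le_const2) (use 2 in blast)
    ultimately show "h x = c" by simp
  qed
  then show ?thesis by blast
qed

end

section \<open>Boxes of lattice points and multiparameter averages\<close>

definition ibox :: "nat \<Rightarrow> int \<Rightarrow> int \<Rightarrow> (nat \<Rightarrow> int) set" where
  "ibox d a b = {x \<in> Zd d. \<forall>i<d. a \<le> x i \<and> x i < b}"

lemma ibox_0: "ibox 0 a b = {\<lambda>_. 0}"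
  by (auto simp: ibox_def Zd_def)

lemma ibox_Suc: "ibox (Suc j) a b = (\<lambda>(k, x). x(j := k)) ` ({a..<b} \<times> ibox j a b)"
proof (intro equalityI subsetI)
  fix x assume x: "x \<in> ibox (Suc j) a b"
  then have "x = (\<lambda>(k, x). x(j := k)) (x j, x(j := 0))" by simp
  moreover have "(x j, x(j := 0)) \<in> {a..<b} \<times> ibox j a b"
    using x by (auto simp: ibox_def Zd_def)
  ultimately show "x \<in> (\<lambda>(k, x). x(j := k)) ` ({a..<b} \<times> ibox j a b)" by (rule image_eqI)
qed (auto simp: ibox_def Zd_def less_Suc_eq)

lemma inj_on_ibox_Suc: "inj_on (\<lambda>(k, x). x(j := k)) ({a..<b} \<times> ibox j a b)"
proof (rule inj_onI, clarsimp)
  fix k x l y assume "x \<in> ibox j a b" "y \<in> ibox j a b" and eq: "x(j := k) = y(j := l)"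
  then have "x j = y j" by (simp add: ibox_def Zd_def)
  moreover have "x i = y i" if "i \<noteq> j" for i using fun_cong[OF eq, of i] that by simp
  ultimately have "x = y" by (metis ext)
  then show "k = l \<and> x = y" using fun_cong[OF eq, of j] by simp
qed

lemma finite_ibox [simp]: "finite (ibox d a b)"
  by (induction d) (auto simp: ibox_0 ibox_Suc)

text \<open>Because the sides are half-open, the box from \<open>- n\<close> to \<open>n\<close> has
  exactly \<open>(2 * n) ^ d\<close> points, the volume of \<open>Lambda d n\<close>.\<close>

lemma card_ibox: "card (ibox d a b) = nat (b - a) ^ d"
  by (induction d) (auto simp: ibox_0 ibox_Suc card_image[OF inj_on_ibox_Suc] card_cartesian_product)

lemma real_card_ibox: "a \<le> b \<Longrightarrow> real (card (ibox d a b)) = real_of_int (b - a) ^ d"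
  by (simp add: card_ibox)

lemma sum_ibox_Suc:
  "(\<Sum>x\<in>ibox (Suc j) a b. h x) = (\<Sum>k\<in>{a..<b}. \<Sum>x\<in>ibox j a b. h (x(j := k)))"
  unfolding ibox_Suc sum.reindex[OF inj_on_ibox_Suc] by (simp add: sum.cartesian_product split_def)

lemma ibox_mono: "a' \<le> a \<Longrightarrow> b \<le> b' \<Longrightarrow> ibox d a b \<subseteq> ibox d a' b'"
  by (force simp: ibox_def)

text \<open>Surface against volume: changing all sides of a box by a fixed amount \<open>c\<close>,
  positive or negative, has a vanishing relative effect.\<close>

lemma power_shift_ratio_tendsto:
  "(\<lambda>n. ((2 * real n + c) ^ d - (2 * real n) ^ d) / (2 * real n) ^ d) \<longlonglongrightarrow> 0"
proof -
  have "(\<lambda>n. (1 + (c / 2) / real n) ^ d - 1) \<longlonglongrightarrow> (1 + 0) ^ d - 1"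
    by (intro tendsto_intros lim_const_over_n)
  then have "(\<lambda>n. (1 + (c / 2) / real n) ^ d - 1) \<longlonglongrightarrow> 0" by simp
  moreover have "eventually (\<lambda>n. (1 + (c / 2) / real n) ^ d - 1
      = ((2 * real n + c) ^ d - (2 * real n) ^ d) / (2 * real n) ^ d) sequentially"
    using eventually_gt_at_top[of 0]
  proof eventually_elim
    fix n :: nat assume n: "0 < n"
    then have "1 + (c / 2) / real n = (2 * real n + c) / (2 * real n)" by (simp add: field_simps)
    then show "(1 + (c / 2) / real n) ^ d - 1 = ((2 * real n + c) ^ d - (2 * real n) ^ d) / (2 * real n) ^ d"
      using n by (simp add: power_divide diff_divide_distrib)
  qed
  ultimately show ?thesis by (rule Lim_transform_eventually)
qed

definition lattice_action :: "nat \<Rightarrow> 'a measure \<Rightarrow> ((nat \<Rightarrow> int) \<Rightarrow> 'a \<Rightarrow> 'a) \<Rightarrow> bool" where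
  "lattice_action d M S \<longleftrightarrow> (\<forall>x\<in>Zd d. mpt M (S x)) \<and>
     (\<forall>w\<in>space M. S (\<lambda>_. 0) w = w \<and> (\<forall>x\<in>Zd d. \<forall>y\<in>Zd d. S (\<lambda>i. x i + y i) w = S x (S y w)))"

definition box_avg :: "nat \<Rightarrow> ((nat \<Rightarrow> int) \<Rightarrow> 'a \<Rightarrow> 'a) \<Rightarrow> ('a \<Rightarrow> real) \<Rightarrow> nat \<Rightarrow> 'a \<Rightarrow> real" where
  "box_avg d S f n w = (\<Sum>x\<in>ibox d (- int n) (int n). f (S x w)) / (2 * real n) ^ d"

lemma Zd_mono: "j \<le> d \<Longrightarrow> Zd j \<subseteq> Zd d"
  by (auto simp: Zd_def)

lemma lattice_action_space:
  "lattice_action d M S \<Longrightarrow> x \<in> Zd d \<Longrightarrow> w \<in> space M \<Longrightarrow> S x w \<in> space M"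
  using measurable_space[of "S x" M M w] by (auto simp: lattice_action_def mpt_def)

lemma box_avg_bounds:
  assumes S: "lattice_action d M S" and j: "j \<le> d"
    and fb: "\<forall>x\<in>space M. 0 \<le> f x \<and> f x \<le> C" and w: "w \<in> space M"
  shows "0 \<le> box_avg j S f n w \<and> box_avg j S f n w \<le> C"
proof -
  have C: "0 \<le> C" using fb w by force
  have b: "0 \<le> f (S x w) \<and> f (S x w) \<le> C" if "x \<in> ibox j (- int n) (int n)" for x
    using fb lattice_action_space[OF S _ w, of x] that Zd_mono[OF j] by (auto simp: ibox_def)
  have r: "real (card (ibox j (- int n) (int n))) \<le> (2 * real n) ^ j"
    unfolding card_ibox of_nat_power by (intro power_mono) auto
  show ?thesis unfolding box_avg_def using b C r by (intro conjI average_bounds; simp)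
qed

lemma borel_measurable_box_avg:
  assumes S: "lattice_action d M S" and j: "j \<le> d" and [measurable]: "f \<in> borel_measurable M"
  shows "box_avg j S f n \<in> borel_measurable M"
proof -
  have "S x \<in> measurable M M" if "x \<in> ibox j (- int n) (int n)" for x
    using S that Zd_mono[OF j] by (auto simp: lattice_action_def ibox_def mpt_def)
  then show ?thesis unfolding box_avg_def[abs_def]
    by (intro borel_measurable_divide borel_measurable_sum) (auto intro: measurable_compose)
qed

context prob_space
begin

text \<open>Induction on the number of directions. All sides grow with the same \<open>n\<close>, so
  the function averaged in the new direction is itself the \<open>n\<close>-th average over the
  earlier ones; this is why \<open>flow_avg_tendsto_seq\<close> allows a function that varies with
  \<open>n\<close>.\<close>

lemma box_avg_tendsto:
  assumes S: "lattice_action d M S" and f: "f \<in> borel_measurable M"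
    and fb: "\<forall>x\<in>space M. 0 \<le> f x \<and> f x \<le> C" and j: "j \<le> d"
  shows "\<exists>g. g \<in> borel_measurable M \<and> (\<forall>x\<in>space M. 0 \<le> g x \<and> g x \<le> C) \<and>
    (AE w in M. (\<lambda>n. box_avg j S f n w) \<longlonglongrightarrow> g w)"
  using j
proof (induction j)
  case 0
  have "box_avg 0 S f n w = f w" if "w \<in> space M" for n w
    using S that by (simp add: box_avg_def ibox_0 lattice_action_def)
  then have "AE w in M. (\<lambda>n. box_avg 0 S f n w) \<longlonglongrightarrow> f w" by (intro AE_I2) simp
  then show ?case using f fb by blast
next
  case (Suc j)
  define e where "e k = (\<lambda>_. 0)(j := k)" for k :: int
  have e: "e k \<in> Zd d" for k using Suc.prems by (auto simp: e_def Zd_def)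
  have fl: "flow M (\<lambda>k. S (e k))"
  proof -
    have "e 0 = (\<lambda>_. 0)" "e (k + l) = (\<lambda>i. e k i + e l i)" for k l by (auto simp: e_def)
    then show ?thesis using S e by (simp add: flow_def lattice_action_def)
  qed
  obtain g where g: "g \<in> borel_measurable M" "\<forall>x\<in>space M. 0 \<le> g x \<and> g x \<le> C"
    "AE w in M. (\<lambda>n. box_avg j S f n w) \<longlonglongrightarrow> g w"
    using Suc by auto
  have jd: "j \<le> d" using Suc.prems by simp
  have "\<forall>x\<in>space M. 0 \<le> box_avg j S f n x \<and> box_avg j S f n x \<le> C" for n
    using box_avg_bounds[OF S jd fb] by blast
  then obtain g' where g': "g' \<in> borel_measurable M" "\<forall>x\<in>space M. 0 \<le> g' x \<and> g' x \<le> C"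
    "AE x in M. (\<lambda>n. flow_avg (\<lambda>k. S (e k)) (box_avg j S f n) n x) \<longlonglongrightarrow> g' x"
    using flow_avg_tendsto_seq[OF fl g(1) borel_measurable_box_avg[OF S jd f] g(2) _ g(3)] by blast
  have avg: "flow_avg (\<lambda>k. S (e k)) (box_avg j S f n) n w = box_avg (Suc j) S f n w"
    if w: "w \<in> space M" for n w
  proof -
    have "S x (S (e k) w) = S (x(j := k)) w" if "x \<in> ibox j (- int n) (int n)" for x k
    proof -
      have "x \<in> Zd d" using that Zd_mono[OF jd] by (auto simp: ibox_def)
      moreover have "x(j := k) = (\<lambda>i. x i + e k i)" using that by (auto simp: ibox_def Zd_def e_def)
      ultimately show ?thesis using S w e by (simp add: lattice_action_def)
    qed
    then show ?thesis
      by (simp add: flow_avg_def box_avg_def sum_ibox_Suc sum_divide_distrib[symmetric] mult_ac)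
  qed
  have "AE x in M. (\<lambda>n. box_avg (Suc j) S f n x) \<longlonglongrightarrow> g' x"
    using g'(3) AE_space by eventually_elim (simp add: avg)
  then show ?case using g' by blast
qed

text \<open>The box and its translate have equally many points and both lie in the box enlarged by
  \<open>m\<close>. Each of the two sums therefore differs from the sum over the enlarged box by at
  most \<open>C\<close> per additional point, and these points are negligible against the
  volume.\<close>

lemma rlimsup_box_avg_invariant:
  assumes S: "lattice_action d M S"
    and fb: "\<forall>x\<in>space M. 0 \<le> f x \<and> f x \<le> C" and y: "y \<in> Zd d" and w: "w \<in> space M"
  shows "rlimsup (\<lambda>n. box_avg d S f n (S y w)) = rlimsup (\<lambda>n. box_avg d S f n w)"
proof (rule rlimsup_cong_diff[where a = 0 and b = C])
  have C: "0 \<le> C" using fb w by force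
  define m where "m = nat (\<Sum>i<d. \<bar>y i\<bar>)"
  have ym: "\<bar>y i\<bar> \<le> int m" if "i < d" for i
    unfolding m_def using that member_le_sum[of i "{..<d}" "\<lambda>i. \<bar>y i\<bar>"] by (simp add: sum_nonneg)
  define h where "h x = f (S x w)" for x
  have hb: "0 \<le> h x" "h x \<le> C" if "x \<in> Zd d" for x
    using fb lattice_action_space[OF S that w] by (auto simp: h_def)
  define sh where "sh x = (\<lambda>i. x i + y i)" for x :: "nat \<Rightarrow> int"
  have inj: "inj_on sh A" for A by (rule inj_onI) (auto simp: sh_def fun_eq_iff)
  define B where "B n = ibox d (- int n) (int n)" for n
  have BZ: "B n \<subseteq> Zd d" for n by (auto simp: B_def ibox_def)
  have shB: "sh ` B n \<subseteq> B (n + m)" for n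
  proof (rule image_subsetI)
    fix x assume x: "x \<in> B n"
    have "- int (n + m) \<le> x i + y i \<and> x i + y i < int (n + m)" if "i < d" for i
      using x ym[OF that] that by (force simp: B_def ibox_def)
    then show "sh x \<in> B (n + m)" using x y by (auto simp: B_def ibox_def sh_def Zd_def)
  qed
  have bound: "(\<Sum>x\<in>B (n + m). h x) - real (card (B (n + m)) - card (B n)) * C \<le> (\<Sum>x\<in>A. h x)"
    "(\<Sum>x\<in>A. h x) \<le> (\<Sum>x\<in>B (n + m). h x)"
    if A: "A \<subseteq> B (n + m)" "card A = card (B n)" for A n
  proof -
    have fin: "finite (B (n + m))" by (simp add: B_def)
    have "(\<Sum>x\<in>B (n + m) - A. h x) \<le> real (card (B (n + m) - A)) * C"
      using hb BZ by (intro sum_bounded_above) auto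
    moreover have "card (B (n + m) - A) = card (B (n + m)) - card (B n)"
      using A fin by (simp add: card_Diff_subset finite_subset)
    moreover have "(\<Sum>x\<in>B (n + m). h x) = (\<Sum>x\<in>B (n + m) - A. h x) + (\<Sum>x\<in>A. h x)"
      using A fin by (intro sum.subset_diff)
    ultimately show "(\<Sum>x\<in>B (n + m). h x) - real (card (B (n + m)) - card (B n)) * C \<le> (\<Sum>x\<in>A. h x)"
      by simp
    show "(\<Sum>x\<in>A. h x) \<le> (\<Sum>x\<in>B (n + m). h x)"
      using A fin hb(1)[OF subsetD[OF BZ]] by (intro sum_mono2) auto
  qed
  have avg: "box_avg d S f n w = (\<Sum>x\<in>B n. h x) / (2 * real n) ^ d"
    "box_avg d S f n (S y w) = (\<Sum>x\<in>sh ` B n. h x) / (2 * real n) ^ d" for n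
  proof -
    have "f (S x (S y w)) = h (sh x)" if "x \<in> B n" for x
      using S BZ[of n] y w that by (auto simp: h_def sh_def lattice_action_def)
    then show "box_avg d S f n (S y w) = (\<Sum>x\<in>sh ` B n. h x) / (2 * real n) ^ d"
      by (simp add: box_avg_def sum.reindex[OF inj] flip: B_def)
    show "box_avg d S f n w = (\<Sum>x\<in>B n. h x) / (2 * real n) ^ d" by (simp add: box_avg_def h_def B_def)
  qed
  have cd: "real (card (B (n + m)) - card (B n)) = (2 * real n + 2 * real m) ^ d - (2 * real n) ^ d" for n
  proof -
    have "card (B n) \<le> card (B (n + m))" unfolding B_def by (intro card_mono ibox_mono) auto
    then have "real (card (B (n + m)) - card (B n)) = real (card (B (n + m))) - real (card (B n))"
      by (rule of_nat_diff)
    also have "\<dots> = (2 * real n + 2 * real m) ^ d - (2 * real n) ^ d"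
      by (simp add: B_def real_card_ibox algebra_simps)
    finally show ?thesis .
  qed
  have "\<bar>box_avg d S f n (S y w) - box_avg d S f n w\<bar>
      \<le> ((2 * real n + 2 * real m) ^ d - (2 * real n) ^ d) / (2 * real n) ^ d * C" for n
  proof -
    have "B n \<subseteq> B (n + m)" unfolding B_def by (intro ibox_mono) auto
    note 1 = bound[OF this refl] and 2 = bound[OF shB card_image[OF inj], of n]
    have "\<bar>(\<Sum>x\<in>sh ` B n. h x) - (\<Sum>x\<in>B n. h x)\<bar> \<le> ((2 * real n + 2 * real m) ^ d - (2 * real n) ^ d) * C"
      using 1 2 unfolding cd by linarith
    then show ?thesis unfolding avg diff_divide_distrib[symmetric] abs_divide
      by (simp add: divide_right_mono)
  qed
  then have ev: "eventually (\<lambda>n. norm (box_avg d S f n (S y w) - box_avg d S f n w)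
      \<le> ((2 * real n + 2 * real m) ^ d - (2 * real n) ^ d) / (2 * real n) ^ d * C) sequentially"
    by (simp only: real_norm_def eventually_True)
  have "(\<lambda>n. ((2 * real n + 2 * real m) ^ d - (2 * real n) ^ d) / (2 * real n) ^ d * C) \<longlonglongrightarrow> 0"
    using tendsto_mult[OF power_shift_ratio_tendsto[of "2 * real m" d] tendsto_const[of C]] by simp
  with ev show "(\<lambda>n. box_avg d S f n (S y w) - box_avg d S f n w) \<longlonglongrightarrow> 0"
    by (rule Lim_null_comparison)
qed (use box_avg_bounds[OF S order_refl fb w] in auto)

text \<open>Ergodicity is formulated for strictly invariant sets. An almost everywhere limit is
  determined only up to null sets, whereas the upper limit \<open>h\<close> is defined and invariant
  at every point of the space, so its sublevel sets qualify. It agrees with the limit almost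
  everywhere.\<close>

lemma ergodic_box_avg_tendsto:
  assumes S: "lattice_action d M S"
    and erg: "\<And>A. A \<in> sets M \<Longrightarrow> (\<forall>x\<in>Zd d. S x -` A \<inter> space M = A) \<Longrightarrow> prob A = 0 \<or> prob A = 1"
    and f: "f \<in> borel_measurable M" and fb: "\<forall>x\<in>space M. 0 \<le> f x \<and> f x \<le> C"
  shows "\<exists>c. AE w in M. (\<lambda>n. box_avg d S f n w) \<longlonglongrightarrow> c"
proof -
  define h where "h w = rlimsup (\<lambda>n. box_avg d S f n w)" for w
  note [measurable] = borel_measurable_box_avg[OF S order_refl f]
  have h[measurable]: "h \<in> borel_measurable M" unfolding h_def[abs_def] by measurable
  have hb: "\<forall>x\<in>space M. 0 \<le> h x \<and> h x \<le> C"
    unfolding h_def using box_avg_bounds[OF S order_refl fb]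
    by (auto intro: rlimsup_bounds[of 0 _ C])
  have "\<exists>c. AE x in M. h x = c"
  proof (rule AE_const_of_zero_one[OF h hb])
    fix a
    show "prob {x \<in> space M. h x \<le> a} = 0 \<or> prob {x \<in> space M. h x \<le> a} = 1"
    proof (rule erg)
      show "\<forall>x\<in>Zd d. S x -` {x \<in> space M. h x \<le> a} \<inter> space M = {x \<in> space M. h x \<le> a}"
        using rlimsup_box_avg_invariant[OF S fb] lattice_action_space[OF S] by (auto simp: h_def)
    qed measurable
  qed
  then obtain c where c: "AE x in M. h x = c" ..
  obtain g where "AE w in M. (\<lambda>n. box_avg d S f n w) \<longlonglongrightarrow> g w"
    using box_avg_tendsto[OF S f fb order_refl] by blast
  then have "AE w in M. (\<lambda>n. box_avg d S f n w) \<longlonglongrightarrow> c"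
    using c by eventually_elim (use rlimsup_eq in \<open>force simp: h_def\<close>)
  then show ?thesis ..
qed

end

section \<open>Betti numbers as differences of ranks\<close>

context vector_space
begin

lemma dim_mono_finite:
  assumes "V \<subseteq> span W" "finite W"
  shows "dim V \<le> dim W"
proof -
  obtain B where B: "B \<subseteq> W" "independent B" "W \<subseteq> span B" "card B = dim W"
    using basis_exists[of W] by blast
  have "V \<subseteq> span B" using assms(1) span_minimal[OF B(3) subspace_span] by (rule order_trans)
  then show ?thesis using dim_le_card[of V B] B finite_subset[OF B(1) assms(2)] by simp
qed

lemma dim_Un_le:
  assumes "finite S" "finite T"
  shows "dim (S \<union> T) \<le> dim S + dim T"
proof -
  obtain B where B: "B \<subseteq> S" "independent B" "S \<subseteq> span B" "card B = dim S"
    using basis_exists[of S] by blast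
  obtain C where C: "C \<subseteq> T" "independent C" "T \<subseteq> span C" "card C = dim T"
    using basis_exists[of T] by blast
  have "S \<union> T \<subseteq> span (B \<union> C)"
    using B(3) C(3) span_mono[of B "B \<union> C"] span_mono[of C "B \<union> C"] by auto
  moreover have "finite (B \<union> C)"
    using finite_subset[OF B(1) assms(1)] finite_subset[OF C(1) assms(2)] by simp
  ultimately have "dim (S \<union> T) \<le> card (B \<union> C)" by (rule dim_le_card)
  also have "\<dots> \<le> card B + card C" by (rule card_Un_le)
  finally show ?thesis using B(4) C(4) by simp
qed

lemma independent_Un:
  assumes "independent B" "independent C" "span B \<inter> span C \<subseteq> {0}" "finite B" "finite C"
  shows "B \<inter> C = {}" "independent (B \<union> C)"
proof -
  have "b = 0" if "b \<in> B" "b \<in> C" for b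
    using assms(3) span_base[OF that(1)] span_base[OF that(2)] by auto
  then show dis: "B \<inter> C = {}" using dependent_zero[of B] assms(1) by auto
  show "independent (B \<union> C)"
  proof (rule independent_if_scalars_zero)
    fix u x assume s: "(\<Sum>x\<in>B \<union> C. u x *s x) = 0" and x: "x \<in> B \<union> C"
    let ?b = "\<Sum>x\<in>B. u x *s x" and ?c = "\<Sum>x\<in>C. u x *s x"
    have bc: "?b + ?c = 0" using s dis assms(4,5) by (simp add: sum.union_disjoint)
    then have eq: "?b = - ?c" by (simp add: eq_neg_iff_add_eq_0)
    have b: "?b \<in> span B" by (intro span_sum span_scale span_base)
    have "?c \<in> span C" by (intro span_sum span_scale span_base)
    then have "?b \<in> span C" using span_neg[of ?c C] eq by simp
    then have b0: "?b = 0" using b assms(3) by blast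
    have c0: "?c = 0" using bc unfolding b0 by simp
    have "u x = 0" if "x \<in> B" by (rule independentD[OF assms(1,4) order_refl b0 that])
    moreover have "u x = 0" if "x \<in> C" by (rule independentD[OF assms(2,5) order_refl c0 that])
    ultimately show "u x = 0" using x by blast
  qed (use assms in auto)
qed

lemma span_Diff_Int_span:
  assumes "independent C" "finite C" "B \<subseteq> C"
  shows "span (C - B) \<inter> span B \<subseteq> {0}"
proof
  fix x assume x: "x \<in> span (C - B) \<inter> span B"
  have "x \<in> range (\<lambda>u. \<Sum>v\<in>C - B. u v *s v)" using x assms(2) by (simp add: span_finite)
  then obtain u where u: "x = (\<Sum>v\<in>C - B. u v *s v)" by blast
  have "x \<in> range (\<lambda>u. \<Sum>v\<in>B. u v *s v)"
    using x finite_subset[OF assms(3,2)] by (simp add: span_finite)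
  then obtain w where w: "x = (\<Sum>v\<in>B. w v *s v)" by blast
  define r where "r v = (if v \<in> B then - w v else u v)" for v
  have "(\<Sum>v\<in>C. r v *s v) = (\<Sum>v\<in>C - B. r v *s v) + (\<Sum>v\<in>B. r v *s v)"
    by (rule sum.subset_diff[OF assms(3,2)])
  also have "(\<Sum>v\<in>C - B. r v *s v) = x" unfolding u by (intro sum.cong) (auto simp: r_def)
  also have "(\<Sum>v\<in>B. r v *s v) = - x" unfolding w sum_negf[symmetric]
    by (intro sum.cong) (auto simp: r_def)
  finally have 0: "(\<Sum>v\<in>C. r v *s v) = 0" by simp
  have "u v = 0" if v: "v \<in> C - B" for v
    using independentD[OF assms(1,2) order_refl 0, of v] v by (simp add: r_def)
  then show "x \<in> {0}" unfolding u by simp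
qed

text \<open>Serves twice: for cycles that are independent modulo boundaries, and for the boundaries
  of cubes in separated sets.\<close>

lemma dim_Un_direct:
  assumes "finite S" "finite T" "span S \<inter> span T \<subseteq> {0}"
  shows "dim (S \<union> T) = dim S + dim T"
proof -
  obtain B where B: "B \<subseteq> S" "independent B" "S \<subseteq> span B" "card B = dim S"
    using basis_exists[of S] by blast
  obtain C where C: "C \<subseteq> T" "independent C" "T \<subseteq> span C" "card C = dim T"
    using basis_exists[of T] by blast
  have fin: "finite B" "finite C"
    using finite_subset[OF B(1) assms(1)] finite_subset[OF C(1) assms(2)] by simp_all
  have "span B \<inter> span C \<subseteq> {0}" using assms(3) span_mono[OF B(1)] span_mono[OF C(1)] by auto
  note BC = independent_Un[OF B(2) C(2) this fin]
  have "S \<union> T \<subseteq> span (B \<union> C)"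
    using B(3) C(3) span_mono[of B "B \<union> C"] span_mono[of C "B \<union> C"] by auto
  then have "dim (S \<union> T) = card (B \<union> C)"
    by (rule basis_card_eq_dim[OF Un_mono[OF B(1) C(1)] _ BC(2), symmetric])
  also have "\<dots> = card B + card C" using fin BC(1) by (rule card_Un_disjoint)
  finally show ?thesis unfolding B(4) C(4) .
qed

end

context vector_space_pair
begin

text \<open>Rank-nullity localised to the span of a finite independent set, since the space of all
  functions on cubes is infinite dimensional. A basis \<open>K\<close> of the kernel is extended to
  a basis \<open>B\<close> of the span; \<open>f\<close> is injective on the span of
  \<open>B - K\<close>, whose image spans the whole image.\<close>

lemma dim_kernel_plus_dim_image:
  assumes lf: "Vector_Spaces.linear s1 s2 f" and S: "vs1.independent S" "finite S"
  shows "vs1.dim {x \<in> vs1.span S. f x = 0} + vs2.dim (f ` S) = card S"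
proof -
  interpret f: Vector_Spaces.linear s1 s2 f by fact
  let ?K = "{x \<in> vs1.span S. f x = 0}"
  obtain K where K: "K \<subseteq> ?K" "vs1.independent K" "?K \<subseteq> vs1.span K" "card K = vs1.dim ?K"
    by (rule vs1.basis_exists)
  from K(1) have KS: "K \<subseteq> vs1.span S" by blast
  obtain B where B: "K \<subseteq> B" "B \<subseteq> vs1.span S" "vs1.independent B" "vs1.span S \<subseteq> vs1.span B"
    by (rule vs1.maximal_independent_subset_extend[OF KS K(2)])
  have sp: "vs1.span B = vs1.span S"
    by (intro order_antisym vs1.span_minimal vs1.subspace_span B)
  have finB: "finite B" using vs1.independent_span_bound[OF S(2) B(3,2)] by simp
  have cB: "card B = card S"
    using vs1.dim_span_eq_card_independent[OF B(3)] vs1.dim_span_eq_card_independent[OF S(1)] sp by simp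
  let ?E = "B - K"
  have indE: "vs1.independent ?E" by (rule vs1.independent_mono[OF B(3) Diff_subset])
  have int: "vs1.span ?E \<inter> vs1.span K \<subseteq> {0}"
    by (rule vs1.span_Diff_Int_span[OF B(3) finB B(1)])
  have inj: "inj_on f (vs1.span ?E)"
  proof (subst f.inj_on_iff_eq_0)
    show "\<forall>x\<in>vs1.span ?E. f x = 0 \<longrightarrow> x = 0"
    proof (intro ballI impI)
      fix x assume x: "x \<in> vs1.span ?E" "f x = 0"
      then have "x \<in> ?K" using sp vs1.span_mono[of ?E B] by auto
      then show "x = 0" using K(3) int x(1) by auto
    qed
  qed (rule vs1.subspace_span)
  have "vs2.independent (f ` ?E)" using f.independent_injective_image[OF indE inj] .
  then have "vs2.dim (f ` ?E) = card (f ` ?E)" by (rule vs2.dim_eq_card_independent)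
  also have "\<dots> = card ?E" by (rule card_image[OF inj_on_subset[OF inj vs1.span_superset]])
  finally have dE: "vs2.dim (f ` ?E) = card B - card K"
    using finB B(1) by (simp add: card_Diff_subset finite_subset)
  have "vs2.span (f ` S) = f ` vs1.span B" using f.span_image[of S] sp by simp
  also have "\<dots> = vs2.span (f ` B)" by (simp add: f.span_image)
  also have "\<dots> = vs2.span (f ` ?E)"
  proof -
    have "f ` B = f ` ?E \<union> f ` K" using B(1) by auto
    moreover have "f ` K \<subseteq> {0}" using K(1) by auto
    ultimately have "f ` B \<subseteq> insert 0 (f ` ?E)" by auto
    then have "vs2.span (f ` B) \<subseteq> vs2.span (f ` ?E)"
      using vs2.span_mono vs2.span_insert_0 by blast
    moreover have "vs2.span (f ` ?E) \<subseteq> vs2.span (f ` B)" by (intro vs2.span_mono) auto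
    ultimately show ?thesis by auto
  qed
  finally have "vs2.dim (f ` S) = vs2.dim (f ` ?E)" by (rule vs2.span_eq_dim)
  then show ?thesis using dE cB K(4) card_mono[OF finB B(1)] by simp
qed

end

section \<open>Rational-valued functions as a vector space\<close>

definition fscale :: "rat \<Rightarrow> ('a \<Rightarrow> rat) \<Rightarrow> 'a \<Rightarrow> rat" where
  "fscale c f = (\<lambda>x. c * f x)"

lemma fscale_apply [simp]: "fscale c f x = c * f x"
  by (simp add: fscale_def)

global_interpretation fs: vector_space fscale
  by unfold_locales (auto simp: fun_eq_iff algebra_simps)

global_interpretation fsp: vector_space_pair fscale fscale ..

lemma sum_fun_apply: "(\<Sum>i\<in>I. f i) x = (\<Sum>i\<in>I. f i x)"
  by (induction I rule: infinite_finite_induct) auto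

definition unit_fun :: "'a \<Rightarrow> 'a \<Rightarrow> rat" where
  "unit_fun a = (\<lambda>b. if b = a then 1 else 0)"

lemma inj_unit_fun: "inj unit_fun"
  by (rule injI) (metis unit_fun_def zero_neq_one)

lemma span_unit_fun:
  assumes "finite A"
  shows "fs.span (unit_fun ` A) = {f. \<forall>a. a \<notin> A \<longrightarrow> f a = 0}"
proof
  have "fs.subspace {f. \<forall>a. a \<notin> A \<longrightarrow> f a = 0}"
    by (auto simp: fs.subspace_def)
  then show "fs.span (unit_fun ` A) \<subseteq> {f. \<forall>a. a \<notin> A \<longrightarrow> f a = 0}"
    by (intro fs.span_minimal) (auto simp: unit_fun_def split: if_splits)
  show "{f. \<forall>a. a \<notin> A \<longrightarrow> f a = 0} \<subseteq> fs.span (unit_fun ` A)"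
  proof
    fix f :: "'a \<Rightarrow> rat" assume f: "f \<in> {f. \<forall>a. a \<notin> A \<longrightarrow> f a = 0}"
    have "f = (\<Sum>a\<in>A. fscale (f a) (unit_fun a))"
      using f assms by (auto simp: fun_eq_iff sum_fun_apply unit_fun_def if_distrib[of "\<lambda>x. _ * x"] cong: if_cong)
    also have "\<dots> \<in> fs.span (unit_fun ` A)" by (intro fs.span_sum fs.span_scale fs.span_base) auto
    finally show "f \<in> fs.span (unit_fun ` A)" .
  qed
qed

lemma independent_unit_fun:
  assumes "finite A"
  shows "fs.independent (unit_fun ` A)"
proof (rule fs.independent_if_scalars_zero)
  fix u x assume s: "(\<Sum>x\<in>unit_fun ` A. fscale (u x) x) = 0" and x: "x \<in> unit_fun ` A"
  then obtain a where a: "a \<in> A" "x = unit_fun a" by auto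
  have "0 = (\<Sum>x\<in>unit_fun ` A. fscale (u x) x) a" using s by simp
  also have "\<dots> = (\<Sum>b\<in>A. u (unit_fun b) * unit_fun b a)"
    by (simp add: sum.reindex inj_on_subset[OF inj_unit_fun] sum_fun_apply)
  also have "\<dots> = u x" using a assms
    by (simp add: unit_fun_def if_distrib[of "\<lambda>x. _ * x"] cong: if_cong)
  finally show "u x = 0" by simp
qed (use assms in simp)

lemma common_denominator:
  fixes u :: "'i \<Rightarrow> rat"
  assumes "finite I"
  shows "\<exists>N::int. N \<noteq> 0 \<and> (\<forall>i\<in>I. of_int N * u i \<in> \<int>)"
  using assms
proof (induction I)
  case empty
  then show ?case by (intro exI[of _ 1]) auto
next
  case (insert i I)
  then obtain N :: int where N: "N \<noteq> 0" "\<forall>i\<in>I. of_int N * u i \<in> \<int>" by auto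
  obtain p q :: int where pq: "u i = of_int p / of_int q" "q \<noteq> 0"
    by (cases "u i") (auto simp: Fract_of_int_quotient)
  have "of_int (N * q) * u i = of_int (N * p)" using pq by simp
  then have "of_int (N * q) * u i \<in> \<int>" by (metis Ints_of_int)
  moreover have "of_int (N * q) * u j \<in> \<int>" if "j \<in> I" for j
  proof -
    have "of_int (N * q) * u j = of_int q * (of_int N * u j)" by simp
    also have "\<dots> \<in> \<int>" by (rule Ints_mult[OF Ints_of_int N(2)[rule_format, OF that]])
    finally show ?thesis .
  qed
  ultimately show ?case using N pq by (intro exI[of _ "N * q"]) auto
qed

section \<open>The cubical boundary operator\<close>

definition ndeg :: "nat \<Rightarrow> cube \<Rightarrow> nat set" where
  "ndeg d Q = {i. i < d \<and> snd (Q i)}"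

definition face_sign :: "cube \<Rightarrow> nat \<Rightarrow> int" where
  "face_sign Q i = (-1) ^ card {i'. i' < i \<and> snd (Q i')}"

lemma finite_ndeg [simp]: "finite (ndeg d Q)"
  by (simp add: ndeg_def)

lemma bd_cube_alt:
  "bd_cube d Q P = (\<Sum>i\<in>ndeg d Q. face_sign Q i * (of_bool (P = face_up Q i) - of_bool (P = face_down Q i)))"
  unfolding bd_cube_def ndeg_def face_sign_def by (intro sum.cong) auto

lemma ndeg_face:
  "ndeg d (face_up Q i) = ndeg d Q - {i}" "ndeg d (face_down Q i) = ndeg d Q - {i}"
  by (auto simp: ndeg_def face_up_def face_down_def split: if_splits)

text \<open>Collapsing direction \<open>i\<close> lowers by one the position of each later
  nondegenerate direction and leaves the earlier positions unchanged.\<close>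

lemma face_sign_face:
  assumes "i \<noteq> j" "snd (Q i)"
  shows "face_sign (face_up Q i) j = (if i < j then - face_sign Q j else face_sign Q j)"
    and "face_sign (face_down Q i) j = (if i < j then - face_sign Q j else face_sign Q j)"
proof -
  define B where "B = {k. k < j \<and> snd (Q k)}"
  have eq: "{k. k < j \<and> snd (face_up Q i k)} = B - {i}" "{k. k < j \<and> snd (face_down Q i k)} = B - {i}"
    by (auto simp: B_def face_up_def face_down_def split: if_splits)
  have fin: "finite B" by (simp add: B_def)
  have "(-1) ^ card (B - {i}) = (if i < j then - ((-1) ^ card B) else (-1) ^ card B :: int)"
  proof (cases "i < j")
    case True
    then have "i \<in> B" using assms by (simp add: B_def)
    then have "card B = Suc (card (B - {i}))" using fin by (rule card.remove[rotated])
    then show ?thesis using True by simp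
  next
    case False
    then have "B - {i} = B" by (auto simp: B_def)
    then show ?thesis using False by simp
  qed
  then show "face_sign (face_up Q i) j = (if i < j then - face_sign Q j else face_sign Q j)"
    and "face_sign (face_down Q i) j = (if i < j then - face_sign Q j else face_sign Q j)"
    unfolding face_sign_def eq by (simp_all add: B_def)
qed

lemma sum_antisymmetric_zero:
  fixes g :: "'a \<Rightarrow> 'a \<Rightarrow> int"
  assumes "\<And>i j. g i j = - g j i"
  shows "(\<Sum>i\<in>I. \<Sum>j\<in>I. g i j) = 0"
proof -
  have "(\<Sum>i\<in>I. \<Sum>j\<in>I. g i j) = (\<Sum>i\<in>I. \<Sum>j\<in>I. g j i)" by (rule sum.swap)
  also have "\<dots> = (\<Sum>i\<in>I. \<Sum>j\<in>I. - g i j)" by (intro sum.cong refl assms)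
  also have "\<dots> = - (\<Sum>i\<in>I. \<Sum>j\<in>I. g i j)" by (simp add: sum_negf)
  finally show ?thesis by simp
qed

text \<open>The boundary of a boundary vanishes. Collapsing two directions in either order yields
  the same four cubes, so \<open>T\<close> is symmetric off the diagonal, while the signs for the
  two orders are opposite. Setting \<open>g\<close> to 0 on the diagonal lets both sums run over all
  nondegenerate directions.\<close>

lemma bd_bd_cube:
  "(\<Sum>i\<in>ndeg d Q. face_sign Q i * (bd_cube d (face_up Q i) R - bd_cube d (face_down Q i) R)) = 0"
proof -
  define T where "T i j = (of_bool (R = face_up (face_up Q i) j) - of_bool (R = face_down (face_up Q i) j)
    - of_bool (R = face_up (face_down Q i) j) + of_bool (R = face_down (face_down Q i) j) :: int)" for i j
  define g where "g i j = (if i = j then 0 else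
    (if i < j then - 1 else 1) * face_sign Q i * face_sign Q j * T i j)" for i j
  have T: "T i j = T j i" if "i \<noteq> j" for i j
  proof -
    have "face_up (face_up Q i) j = face_up (face_up Q j) i"
      "face_down (face_up Q i) j = face_up (face_down Q j) i"
      "face_up (face_down Q i) j = face_down (face_up Q j) i"
      "face_down (face_down Q i) j = face_down (face_down Q j) i"
      using that by (simp_all add: face_up_def face_down_def fun_upd_twist)
    then show ?thesis by (simp add: T_def)
  qed
  have "face_sign Q i * (bd_cube d (face_up Q i) R - bd_cube d (face_down Q i) R) = (\<Sum>j\<in>ndeg d Q. g i j)"
    if i: "i \<in> ndeg d Q" for i
  proof -
    have si: "snd (Q i)" using i by (simp add: ndeg_def)
    have "face_sign Q i * (bd_cube d (face_up Q i) R - bd_cube d (face_down Q i) R) = (\<Sum>j\<in>ndeg d Q - {i}. g i j)"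
      unfolding bd_cube_alt ndeg_face sum_subtractf[symmetric] sum_distrib_left
    proof (intro sum.cong refl)
      fix j assume "j \<in> ndeg d Q - {i}"
      then have ij: "i \<noteq> j" by auto
      show "face_sign Q i * (face_sign (face_up Q i) j * (of_bool (R = face_up (face_up Q i) j) - of_bool (R = face_down (face_up Q i) j)) -
         face_sign (face_down Q i) j * (of_bool (R = face_up (face_down Q i) j) - of_bool (R = face_down (face_down Q i) j))) = g i j"
        unfolding face_sign_face[of i j Q, OF ij si] using ij
        by (auto simp: g_def T_def algebra_simps)
    qed
    also have "\<dots> = (\<Sum>j\<in>ndeg d Q. g i j)"
      by (intro sum.mono_neutral_left) (auto simp: g_def)
    finally show ?thesis .
  qed
  then have "(\<Sum>i\<in>ndeg d Q. face_sign Q i * (bd_cube d (face_up Q i) R - bd_cube d (face_down Q i) R))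
    = (\<Sum>i\<in>ndeg d Q. \<Sum>j\<in>ndeg d Q. g i j)" by (rule sum.cong[OF refl])
  also have "\<dots> = 0"
  proof (rule sum_antisymmetric_zero)
    show "g i j = - g j i" for i j
      using T[of i j] by (auto simp: g_def)
  qed
  finally show ?thesis .
qed

lemma cube_set_face:
  assumes "i \<in> ndeg d Q"
  shows "cube_set (face_up Q i) \<subseteq> cube_set Q" "cube_set (face_down Q i) \<subseteq> cube_set Q"
proof -
  have s: "snd (Q i)" using assms by (simp add: ndeg_def)
  show "cube_set (face_up Q i) \<subseteq> cube_set Q"
  proof
    fix x assume x: "x \<in> cube_set (face_up Q i)"
    have "x i = real_of_int (fst (Q i)) + 1"
      using x s by (auto simp: cube_set_def face_up_def dest!: spec[of _ i])
    moreover have "if snd (Q j) then real_of_int (fst (Q j)) \<le> x j \<and> x j \<le> real_of_int (fst (Q j)) + 1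
       else x j = real_of_int (fst (Q j))" if "j \<noteq> i" for j
      using x that by (auto simp: cube_set_def face_up_def dest!: spec[of _ j])
    ultimately show "x \<in> cube_set Q" using s unfolding cube_set_def by (smt (verit) mem_Collect_eq)
  qed
  show "cube_set (face_down Q i) \<subseteq> cube_set Q"
  proof
    fix x assume x: "x \<in> cube_set (face_down Q i)"
    have "x i = real_of_int (fst (Q i))"
      using x s by (auto simp: cube_set_def face_down_def dest!: spec[of _ i])
    moreover have "if snd (Q j) then real_of_int (fst (Q j)) \<le> x j \<and> x j \<le> real_of_int (fst (Q j)) + 1
       else x j = real_of_int (fst (Q j))" if "j \<noteq> i" for j
      using x that by (auto simp: cube_set_def face_down_def dest!: spec[of _ j])
    ultimately show "x \<in> cube_set Q" using s unfolding cube_set_def by (smt (verit) mem_Collect_eq)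
  qed
qed

lemma cdim_alt: "cdim d Q = card (ndeg d Q)"
  by (simp add: cdim_def ndeg_def)

text \<open>As a point set a face lies inside its cube. Hence the cubes contained in
  \<open>S\<close> are closed under faces for every \<open>S\<close>, and their chains form a
  complex.\<close>

lemma face_in_cubes_in:
  assumes "Q \<in> cubes_in d S (Suc k)" "i \<in> ndeg d Q"
  shows "face_up Q i \<in> cubes_in d S k" "face_down Q i \<in> cubes_in d S k"
proof -
  have i: "i < d" using assms(2) by (simp add: ndeg_def)
  have "card (ndeg d Q - {i}) = k" using assms by (simp add: cubes_in_def cdim_alt)
  moreover have "face_up Q i \<in> Kd d" "face_down Q i \<in> Kd d"
    using assms(1) i by (auto simp: cubes_in_def Kd_def face_up_def face_down_def)
  ultimately show "face_up Q i \<in> cubes_in d S k" "face_down Q i \<in> cubes_in d S k"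
    using assms(1) cube_set_face[OF assms(2)] by (auto simp: cubes_in_def cdim_alt ndeg_face)
qed

section \<open>The rank formula for the Betti number\<close>

definition bd_vec :: "nat \<Rightarrow> cube \<Rightarrow> cube \<Rightarrow> rat" where
  "bd_vec d Q = (\<lambda>P. of_int (bd_cube d Q P))"

definition bd_rank :: "nat \<Rightarrow> cube set \<Rightarrow> nat" where
  "bd_rank d A = fs.dim (bd_vec d ` A)"

definition chain_vec :: "chain \<Rightarrow> cube \<Rightarrow> rat" where
  "chain_vec c = (\<lambda>P. of_int (c P))"

text \<open>Summing over a fixed \<open>A\<close> instead of the support of \<open>c\<close> makes
  the map linear on all functions, including those with infinite support.\<close>

definition bd_lin :: "nat \<Rightarrow> cube set \<Rightarrow> (cube \<Rightarrow> rat) \<Rightarrow> cube \<Rightarrow> rat" where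
  "bd_lin d A c = (\<Sum>Q\<in>A. fscale (c Q) (bd_vec d Q))"

lemma linear_bd_lin: "Vector_Spaces.linear fscale fscale (bd_lin d A)"
proof -
  interpret l: Vector_Spaces.linear fscale fscale "bd_lin d A"
    by unfold_locales
      (auto simp: bd_lin_def fun_eq_iff sum_fun_apply algebra_simps sum.distrib sum_distrib_left)
  show ?thesis by unfold_locales
qed

lemma bd_lin_unit_fun:
  assumes "finite A" "Q \<in> A"
  shows "bd_lin d A (unit_fun Q) = bd_vec d Q"
  using assms
  by (intro ext) (simp add: bd_lin_def unit_fun_def sum_fun_apply if_distrib[of "\<lambda>x. x * _"] cong: if_cong)

lemma bd_vec_alt:
  "bd_vec d Q = (\<Sum>i\<in>ndeg d Q. fscale (of_int (face_sign Q i)) (unit_fun (face_up Q i) - unit_fun (face_down Q i)))"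
  unfolding bd_vec_def bd_cube_alt by (auto simp: fun_eq_iff sum_fun_apply unit_fun_def intro!: sum.cong)

lemma bd_lin_bd_vec:
  assumes "finite A" "\<And>i. i \<in> ndeg d Q \<Longrightarrow> face_up Q i \<in> A \<and> face_down Q i \<in> A"
  shows "bd_lin d A (bd_vec d Q) = 0"
proof -
  interpret l: Vector_Spaces.linear fscale fscale "bd_lin d A" by (rule linear_bd_lin)
  have "bd_lin d A (bd_vec d Q) =
      (\<Sum>i\<in>ndeg d Q. fscale (of_int (face_sign Q i)) (bd_vec d (face_up Q i) - bd_vec d (face_down Q i)))"
    unfolding bd_vec_alt[of d Q] l.sum l.scale l.diff
    using assms by (intro sum.cong refl) (simp add: bd_lin_unit_fun)
  also have "\<dots> = 0"
  proof
    fix R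
    have "(\<Sum>i\<in>ndeg d Q. fscale (of_int (face_sign Q i)) (bd_vec d (face_up Q i) - bd_vec d (face_down Q i))) R
      = of_int (\<Sum>i\<in>ndeg d Q. face_sign Q i * (bd_cube d (face_up Q i) R - bd_cube d (face_down Q i) R))"
      by (simp add: sum_fun_apply bd_vec_def)
    then show "(\<Sum>i\<in>ndeg d Q. fscale (of_int (face_sign Q i)) (bd_vec d (face_up Q i) - bd_vec d (face_down Q i))) R = 0 R"
      unfolding bd_bd_cube by simp
  qed
  finally show ?thesis .
qed

lemma inj_chain_vec: "inj chain_vec"
  by (rule injI) (auto simp: chain_vec_def fun_eq_iff)

lemma chain_vec_bd:
  assumes "finite A" "\<And>Q. c Q \<noteq> 0 \<Longrightarrow> Q \<in> A"
  shows "chain_vec (bd d c) = bd_lin d A (chain_vec c)"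
proof
  fix P
  have eq: "(\<Sum>Q\<in>{Q. c Q \<noteq> 0}. c Q * bd_cube d Q P) = (\<Sum>Q\<in>A. c Q * bd_cube d Q P)"
    using assms by (intro sum.mono_neutral_left) auto
  show "chain_vec (bd d c) P = bd_lin d A (chain_vec c) P"
    unfolding chain_vec_def bd_def eq by (simp add: bd_lin_def sum_fun_apply bd_vec_def)
qed

text \<open>A rational relation becomes an integral one after clearing denominators, so independence of
  integral cycles modulo integral boundaries is independence modulo rational boundaries.\<close>

lemma homology_independent_iff:
  assumes fin: "finite (cubes_in d S (Suc k))" and Z: "finite Z" "Z \<subseteq> cycles d S k"
  shows "homology_independent d S k Z \<longleftrightarrow>
    (\<forall>u. (\<Sum>z\<in>Z. fscale (u z) (chain_vec z)) \<in> fs.span (bd_vec d ` cubes_in d S (Suc k)) \<longrightarrow> (\<forall>z\<in>Z. u z = 0))"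
    (is "_ \<longleftrightarrow> ?R")
proof
  let ?A = "cubes_in d S (Suc k)"
  assume hi: "homology_independent d S k Z"
  show ?R
  proof (intro allI impI ballI)
    fix u z assume s: "(\<Sum>z\<in>Z. fscale (u z) (chain_vec z)) \<in> fs.span (bd_vec d ` ?A)" and z: "z \<in> Z"
    interpret l: Vector_Spaces.linear fscale fscale "bd_lin d ?A" by (rule linear_bd_lin)
    have "bd_vec d ` ?A = bd_lin d ?A ` unit_fun ` ?A"
      using fin by (auto simp: bd_lin_unit_fun image_image)
    then have "fs.span (bd_vec d ` ?A) = bd_lin d ?A ` fs.span (unit_fun ` ?A)" by (simp add: l.span_image)
    with s obtain w where w: "(\<Sum>z\<in>Z. fscale (u z) (chain_vec z)) = bd_lin d ?A w"
      "\<And>Q. Q \<notin> ?A \<Longrightarrow> w Q = 0" by (auto simp: span_unit_fun[OF fin])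
    obtain N1 :: int where N1: "N1 \<noteq> 0" "\<forall>z\<in>Z. of_int N1 * u z \<in> \<int>" using common_denominator[OF Z(1)] by blast
    obtain N2 :: int where N2: "N2 \<noteq> 0" "\<forall>Q\<in>?A. of_int N2 * w Q \<in> \<int>" using common_denominator[OF fin] by blast
    define N where "N = N1 * N2"
    have N: "N \<noteq> 0" using N1 N2 by (simp add: N_def)
    have "\<exists>a. of_int a = of_int N * u z" if "z \<in> Z" for z
    proof -
      have "of_int N * u z = of_int N2 * (of_int N1 * u z)" by (simp add: N_def)
      also have "\<dots> \<in> \<int>" by (rule Ints_mult[OF Ints_of_int N1(2)[rule_format, OF that]])
      finally show ?thesis by (metis Ints_cases)
    qed
    then obtain a where a: "\<And>z. z \<in> Z \<Longrightarrow> of_int (a z) = of_int N * u z" by metis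
    have "\<exists>b. of_int b = of_int N * w Q" for Q
    proof (cases "Q \<in> ?A")
      case True
      have "of_int N * w Q = of_int N1 * (of_int N2 * w Q)" by (simp add: N_def)
      also have "\<dots> \<in> \<int>" by (rule Ints_mult[OF Ints_of_int N2(2)[rule_format, OF True]])
      finally show ?thesis by (metis Ints_cases)
    next
      case False
      then show ?thesis using w(2) by (intro exI[of _ 0]) simp
    qed
    then obtain b where b: "\<And>Q. of_int (b Q) = of_int N * w Q" by metis
    have bA: "Q \<in> ?A" if "b Q \<noteq> 0" for Q
      using b[of Q] w(2)[of Q] that by force
    have bc: "b \<in> chains d S (Suc k)"
      using bA finite_subset[OF _ fin, of "{Q. b Q \<noteq> 0}"] by (auto simp: chains_def)
    have "chain_vec (\<lambda>P. \<Sum>z\<in>Z. a z * z P) = fscale (of_int N) (\<Sum>z\<in>Z. fscale (u z) (chain_vec z))"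
    proof
      fix P
      have "chain_vec (\<lambda>P. \<Sum>z\<in>Z. a z * z P) P = (\<Sum>z\<in>Z. of_int (a z) * of_int (z P))"
        by (simp add: chain_vec_def)
      also have "\<dots> = (\<Sum>z\<in>Z. of_int N * (u z * of_int (z P)))"
        by (intro sum.cong refl) (simp add: a)
      finally show "chain_vec (\<lambda>P. \<Sum>z\<in>Z. a z * z P) P = fscale (of_int N) (\<Sum>z\<in>Z. fscale (u z) (chain_vec z)) P"
        by (simp add: sum_fun_apply chain_vec_def sum_distrib_left)
    qed
    also have "\<dots> = bd_lin d ?A (fscale (of_int N) w)" unfolding w(1) by (simp add: l.scale)
    also have "fscale (of_int N) w = chain_vec b" by (simp add: chain_vec_def fun_eq_iff b)
    also have "bd_lin d ?A (chain_vec b) = chain_vec (bd d b)" using chain_vec_bd[OF fin bA] by simp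
    finally have "(\<lambda>P. \<Sum>z\<in>Z. a z * z P) = bd d b" using inj_chain_vec by (simp add: inj_eq)
    then have "(\<lambda>P. \<Sum>z\<in>Z. a z * z P) \<in> boundaries d S k" using bc by (auto simp: boundaries_def)
    then have "a z = 0" using hi z by (auto simp: homology_independent_def)
    then show "u z = 0" using a[OF z] N by simp
  qed
next
  let ?A = "cubes_in d S (Suc k)"
  assume R: ?R
  show "homology_independent d S k Z"
    unfolding homology_independent_def
  proof (intro conjI allI impI Z)
    fix a assume "(\<lambda>P. \<Sum>z\<in>Z. a z * z P) \<in> boundaries d S k"
    then obtain b where b: "b \<in> chains d S (Suc k)" "(\<lambda>P. \<Sum>z\<in>Z. a z * z P) = bd d b"
      by (auto simp: boundaries_def)
    have "(\<Sum>z\<in>Z. fscale (of_int (a z)) (chain_vec z)) = chain_vec (\<lambda>P. \<Sum>z\<in>Z. a z * z P)"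
      by (simp add: fun_eq_iff sum_fun_apply chain_vec_def)
    also have "\<dots> = bd_lin d ?A (chain_vec b)"
      unfolding b(2) using b(1) by (intro chain_vec_bd[OF fin]) (auto simp: chains_def)
    also have "\<dots> \<in> fs.span (bd_vec d ` ?A)"
      unfolding bd_lin_def by (intro fs.span_sum fs.span_scale fs.span_base) auto
    finally have "\<forall>z\<in>Z. rat_of_int (a z) = 0" by (rule spec[OF R, THEN mp])
    then show "\<forall>z\<in>Z. a z = 0" by simp
  qed
qed

text \<open>Rank-nullity turns the number of \<open>k\<close>-cubes minus the rank in degree
  \<open>k\<close> into the dimension of the space \<open>K\<close> of rational cycles. It remains
  to see that the largest homologically independent family has the codimension of the boundaries in
  \<open>K\<close> as its size. A maximal family arises by extending a basis of the boundaries to a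
  basis of \<open>K\<close> and clearing denominators in the added vectors.\<close>

lemma betti_eq:
  assumes fin: "finite (cubes_in d S k)" "finite (cubes_in d S (Suc k))"
  shows "betti d S k + bd_rank d (cubes_in d S k) + bd_rank d (cubes_in d S (Suc k)) = card (cubes_in d S k)"
proof -
  let ?A = "cubes_in d S k" and ?A' = "cubes_in d S (Suc k)"
  let ?V = "fs.span (unit_fun ` ?A)" and ?B = "bd_vec d ` ?A'"
  define K where "K = {x \<in> ?V. bd_lin d ?A x = 0}"
  interpret l: Vector_Spaces.linear fscale fscale "bd_lin d ?A" by (rule linear_bd_lin)
  have img: "bd_lin d ?A ` unit_fun ` ?A = bd_vec d ` ?A"
    using fin by (auto simp: bd_lin_unit_fun image_image)
  have "fs.dim K + fs.dim (bd_lin d ?A ` unit_fun ` ?A) = card (unit_fun ` ?A)"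
    unfolding K_def using fin(1)
    by (intro fsp.dim_kernel_plus_dim_image linear_bd_lin independent_unit_fun) auto
  then have dK: "fs.dim K + bd_rank d ?A = card ?A"
    unfolding img by (simp add: bd_rank_def card_image inj_on_subset[OF inj_unit_fun])
  have subK: "fs.subspace K"
    using fs.subspace_inter[OF fs.subspace_span[of "unit_fun ` ?A"] l.subspace_kernel]
    by (simp add: K_def Int_def conj_commute)
  have KV: "K \<subseteq> ?V" by (auto simp: K_def)
  have BK: "?B \<subseteq> K"
  proof (rule image_subsetI)
    fix Q assume Q: "Q \<in> ?A'"
    have "bd_vec d Q \<in> ?V"
      unfolding bd_vec_alt using face_in_cubes_in[OF Q]
      by (intro fs.span_sum fs.span_scale fs.span_diff fs.span_base) auto
    moreover have "bd_lin d ?A (bd_vec d Q) = 0" using face_in_cubes_in[OF Q] fin by (intro bd_lin_bd_vec) auto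
    ultimately show "bd_vec d Q \<in> K" by (simp add: K_def)
  qed
  have cyc: "z \<in> cycles d S k \<longleftrightarrow> chain_vec z \<in> K" for z
  proof
    assume z: "z \<in> cycles d S k"
    then have zA: "\<And>Q. z Q \<noteq> 0 \<Longrightarrow> Q \<in> ?A" by (auto simp: cycles_def chains_def)
    have "bd_lin d ?A (chain_vec z) = chain_vec (bd d z)" using chain_vec_bd[OF fin(1) zA] by simp
    also have "\<dots> = 0" using z by (simp add: cycles_def chain_vec_def fun_eq_iff)
    finally show "chain_vec z \<in> K" using zA by (auto simp: K_def span_unit_fun[OF fin(1)] chain_vec_def)
  next
    assume z: "chain_vec z \<in> K"
    then have zA: "Q \<in> ?A" if "z Q \<noteq> 0" for Q
      using that by (auto simp: K_def span_unit_fun[OF fin(1)] chain_vec_def)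
    have "chain_vec (bd d z) = 0" using chain_vec_bd[OF fin(1) zA] z by (simp add: K_def)
    then have "bd d z = (\<lambda>_. 0)" by (simp add: chain_vec_def fun_eq_iff)
    then show "z \<in> cycles d S k"
      using zA finite_subset[OF _ fin(1), of "{Q. z Q \<noteq> 0}"] by (auto simp: cycles_def chains_def)
  qed
  \<comment> \<open>Upper bound: the span of independent cycles meets the boundaries only in 0, and
    the sum of the two spaces fits into \<open>K\<close>.\<close>
  have le: "card Z + bd_rank d ?A' \<le> fs.dim K" if hi: "homology_independent d S k Z" for Z
  proof -
    have Z: "finite Z" "Z \<subseteq> cycles d S k" using hi by (auto simp: homology_independent_def)
    have ind: "\<And>u. (\<Sum>z\<in>Z. fscale (u z) (chain_vec z)) \<in> fs.span ?B \<Longrightarrow> \<forall>z\<in>Z. u z = 0"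
      using hi homology_independent_iff[OF fin(2) Z] by blast
    have inj: "inj_on chain_vec Z" by (rule inj_on_subset[OF inj_chain_vec]) simp
    have ind': "\<forall>z\<in>Z. u (chain_vec z) = 0" if "(\<Sum>x\<in>chain_vec ` Z. fscale (u x) x) \<in> fs.span ?B" for u
      using that ind[of "\<lambda>z. u (chain_vec z)"] by (simp add: sum.reindex[OF inj])
    have "fs.independent (chain_vec ` Z)"
    proof (rule fs.independent_if_scalars_zero)
      fix u x assume "(\<Sum>x\<in>chain_vec ` Z. fscale (u x) x) = 0" "x \<in> chain_vec ` Z"
      then show "u x = 0" using ind'[of u] fs.span_zero[of ?B] by auto
    qed (use Z in simp)
    then have "fs.dim (chain_vec ` Z) = card Z"
      by (simp add: fs.dim_eq_card_independent card_image[OF inj])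
    moreover have "fs.dim (chain_vec ` Z \<union> ?B) = fs.dim (chain_vec ` Z) + fs.dim ?B"
    proof (rule fs.dim_Un_direct)
      show "fs.span (chain_vec ` Z) \<inter> fs.span ?B \<subseteq> {0}"
      proof
        fix x assume x: "x \<in> fs.span (chain_vec ` Z) \<inter> fs.span ?B"
        then obtain u where u: "x = (\<Sum>v\<in>chain_vec ` Z. fscale (u v) v)"
          using fs.span_finite[of "chain_vec ` Z"] Z by auto
        then have "\<forall>z\<in>Z. u (chain_vec z) = 0" using ind'[of u] x by auto
        then show "x \<in> {0}" unfolding u by (auto intro!: sum.neutral)
      qed
    qed (use Z fin in auto)
    moreover have "fs.dim (chain_vec ` Z \<union> ?B) \<le> fs.dim K"
    proof -
      obtain C where C: "C \<subseteq> K" "fs.independent C" "K \<subseteq> fs.span C" "card C = fs.dim K" by (rule fs.basis_exists)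
      have "finite C" using fs.independent_span_bound[OF _ C(2)] C(1) KV fin(1) by (meson finite_imageI order_trans)
      moreover have "chain_vec ` Z \<union> ?B \<subseteq> K" using BK Z(2) cyc by auto
      then have "chain_vec ` Z \<union> ?B \<subseteq> fs.span C" using C(3) by (rule order_trans)
      ultimately show ?thesis using fs.dim_le_card[of "chain_vec ` Z \<union> ?B" C] C(4) by simp
    qed
    ultimately show ?thesis by (simp add: bd_rank_def)
  qed
  obtain B' where B': "B' \<subseteq> ?B" "fs.independent B'" "?B \<subseteq> fs.span B'" "card B' = fs.dim ?B"
    by (rule fs.basis_exists)
  have B'K: "B' \<subseteq> K" using B'(1) BK by (rule order_trans)
  obtain C where C: "B' \<subseteq> C" "C \<subseteq> K" "fs.independent C" "K \<subseteq> fs.span C"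
    by (rule fs.maximal_independent_subset_extend[OF B'K B'(2)])
  have finC: "finite C"
    using fs.independent_span_bound[OF _ C(3), of "unit_fun ` ?A"] C(2) KV fin(1) by auto
  have cC: "card C = fs.dim K" by (rule fs.basis_card_eq_dim[OF C(2,4,3)])
  \<comment> \<open>Basis vectors of \<open>K\<close> are rational, but
    \<open>homology_independent\<close> asks for integral cycles; scaling by a nonzero integer
    affects neither \<open>K\<close> nor independence.\<close>
  have "\<exists>N z. N \<noteq> 0 \<and> chain_vec z = fscale (of_int N) c" if c: "c \<in> C" for c
  proof -
    obtain N :: int where N: "N \<noteq> 0" "\<forall>Q\<in>?A. of_int N * c Q \<in> \<int>"
      using common_denominator[OF fin(1)] by blast
    have "\<exists>m::int. of_int m = of_int N * c Q" for Q
    proof (cases "Q \<in> ?A")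
      case True
      then show ?thesis using N(2) by (metis Ints_cases)
    next
      case False
      then have "c Q = 0" using c C(2) KV by (auto simp: span_unit_fun[OF fin(1)])
      then show ?thesis by (intro exI[of _ 0]) simp
    qed
    then obtain z where "\<And>Q. rat_of_int (z Q) = of_int N * c Q" by metis
    then have "chain_vec z = fscale (of_int N) c" by (simp add: chain_vec_def fun_eq_iff)
    then show ?thesis using N(1) by blast
  qed
  then obtain N \<zeta> where N: "\<And>c. c \<in> C \<Longrightarrow> N c \<noteq> 0"
    and \<zeta>: "\<And>c. c \<in> C \<Longrightarrow> chain_vec (\<zeta> c) = fscale (of_int (N c)) c" by metis
  let ?E = "C - B'"
  have finB': "finite B'" by (rule finite_subset[OF C(1) finC])
  have main: "u c = 0" if s: "(\<Sum>c\<in>?E. fscale (u c) c) \<in> fs.span ?B" and c: "c \<in> ?E" for u c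
  proof -
    let ?x = "\<Sum>c\<in>?E. fscale (u c) c"
    have "fs.span ?B \<subseteq> fs.span B'" by (intro fs.span_minimal B'(3) fs.subspace_span)
    moreover have "?x \<in> fs.span ?E" by (intro fs.span_sum fs.span_scale fs.span_base)
    ultimately have "?x = 0" using s fs.span_Diff_Int_span[OF C(3) finC C(1)] by blast
    then show ?thesis
      by (rule fs.independentD[OF fs.independent_mono[OF C(3) Diff_subset] finite_Diff[OF finC] order_refl _ c])
  qed
  \<comment> \<open>Two basis vectors sharing an integral multiple would be proportional.
    Injectivity keeps the cardinality, which is what \<open>betti\<close> counts.\<close>
  have inj\<zeta>: "inj_on \<zeta> ?E"
  proof (rule inj_onI, rule ccontr)
    fix c c' assume c: "c \<in> ?E" "c' \<in> ?E" and eq: "\<zeta> c = \<zeta> c'" and ne: "c \<noteq> c'"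
    define u where "u v = (if v = c then rat_of_int (N c) else if v = c' then - of_int (N c') else 0)" for v
    have "(\<Sum>v\<in>?E. fscale (u v) v) = (\<Sum>v\<in>{c, c'}. fscale (u v) v)"
      using c finC by (intro sum.mono_neutral_right) (auto simp: u_def)
    also have "\<dots> = fscale (of_int (N c)) c - fscale (of_int (N c')) c'"
      using ne by (auto simp: u_def fun_eq_iff)
    also have "\<dots> = 0" using \<zeta>[of c] \<zeta>[of c'] c eq by simp
    finally have "(\<Sum>v\<in>?E. fscale (u v) v) \<in> fs.span ?B" using fs.span_zero by simp
    then have "u c = 0" using c(1) by (rule main)
    then show False using N[of c] c by (simp add: u_def)
  qed
  have hi: "homology_independent d S k (\<zeta> ` ?E)"
  proof (subst homology_independent_iff[OF fin(2)])
    show "\<zeta> ` ?E \<subseteq> cycles d S k"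
      using \<zeta> C(2) fs.subspace_scale[OF subK] by (auto simp: cyc)
    show "\<forall>u. (\<Sum>z\<in>\<zeta> ` ?E. fscale (u z) (chain_vec z)) \<in> fs.span ?B \<longrightarrow> (\<forall>z\<in>\<zeta> ` ?E. u z = 0)"
    proof (intro allI impI ballI)
      fix u z assume s: "(\<Sum>z\<in>\<zeta> ` ?E. fscale (u z) (chain_vec z)) \<in> fs.span ?B" and z: "z \<in> \<zeta> ` ?E"
      then obtain c where c: "c \<in> ?E" "z = \<zeta> c" by auto
      have "(\<Sum>z\<in>\<zeta> ` ?E. fscale (u z) (chain_vec z)) = (\<Sum>c\<in>?E. fscale (u (\<zeta> c) * of_int (N c)) c)"
        unfolding sum.reindex[OF inj\<zeta>] by (intro sum.cong refl) (simp add: \<zeta> fun_eq_iff)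
      with s have "u (\<zeta> c) * of_int (N c) = 0" using main[of "\<lambda>c. u (\<zeta> c) * of_int (N c)" c] c by simp
      then show "u z = 0" using N[of c] c by simp
    qed
  qed (use finC in auto)
  have cE: "card (\<zeta> ` ?E) + bd_rank d ?A' = fs.dim K"
    using card_image[OF inj\<zeta>] card_Diff_subset[OF finB' C(1)] card_mono[OF finC C(1)] cC B'(4)
    by (simp add: bd_rank_def)
  have "betti d S k = card (\<zeta> ` ?E)"
    unfolding betti_def
  proof (rule cSup_eq_maximum)
    show "card (\<zeta> ` ?E) \<in> {card Z |Z. homology_independent d S k Z}" using hi by blast
    show "x \<le> card (\<zeta> ` ?E)" if "x \<in> {card Z |Z. homology_independent d S k Z}" for x
      using that le cE by force
  qed
  then show ?thesis using cE dK by simp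
qed

section \<open>Block decomposition\<close>

definition corner :: "cube \<Rightarrow> nat \<Rightarrow> int" where
  "corner Q = (\<lambda>i. fst (Q i))"

definition cubes_at :: "nat \<Rightarrow> (nat \<Rightarrow> int) set \<Rightarrow> cube set" where
  "cubes_at d U = {Q \<in> Kd d. corner Q \<in> U}"

lemma corner_Zd: "Q \<in> Kd d \<Longrightarrow> corner Q \<in> Zd d"
  by (simp add: Kd_def Zd_def corner_def)

text \<open>A cube is determined by its lower corner and its set of nondegenerate directions; this
  is the origin of the constant \<open>2 ^ d\<close> in all later estimates.\<close>

lemma cubes_at_finite_card:
  assumes "finite U"
  shows "finite (cubes_at d U)" "card (cubes_at d U) \<le> 2 ^ d * card U"
proof -
  let ?h = "\<lambda>Q. (corner Q, ndeg d Q)"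
  have inj: "inj_on ?h (cubes_at d U)"
  proof (rule inj_onI, rule ext)
    fix Q R i assume Q: "Q \<in> cubes_at d U" "R \<in> cubes_at d U" "?h Q = ?h R"
    then have "fst (Q i) = fst (R i)" by (auto simp: corner_def dest: fun_cong[of _ _ i])
    moreover have "snd (Q i) = snd (R i)"
    proof (cases "i < d")
      case True
      have "i \<in> ndeg d Q \<longleftrightarrow> i \<in> ndeg d R" using Q(3) by simp
      then show ?thesis using True by (simp add: ndeg_def)
    next
      case False
      then show ?thesis using Q(1,2) by (simp add: cubes_at_def Kd_def)
    qed
    ultimately show "Q i = R i" by (rule prod_eqI)
  qed
  have sub: "?h ` cubes_at d U \<subseteq> U \<times> Pow {..<d}" by (auto simp: cubes_at_def ndeg_def)
  have fin: "finite (U \<times> Pow {..<d})" using assms by simp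
  show "finite (cubes_at d U)" using finite_imageD[OF finite_subset[OF sub fin] inj] .
  have "card (cubes_at d U) \<le> card (U \<times> Pow {..<d})" by (rule card_inj_on_le[OF inj sub fin])
  then show "card (cubes_at d U) \<le> 2 ^ d * card U" by (simp add: card_cartesian_product card_Pow mult.commute)
qed

text \<open>The faces of a cube with lower corner coordinate \<open>l\<close> have coordinate
  \<open>l\<close> or \<open>l + 1\<close>. A distance of 2 in some coordinate is thus the smallest
  that excludes a common face.\<close>

definition separated :: "nat \<Rightarrow> (nat \<Rightarrow> int) set \<Rightarrow> (nat \<Rightarrow> int) set \<Rightarrow> bool" where
  "separated d U V \<longleftrightarrow> (\<forall>x\<in>U. \<forall>y\<in>V. \<exists>i<d. 2 \<le> \<bar>x i - y i\<bar>)"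

text \<open>The axioms are chosen so that the number of cubes of given dimension and the rank of
  their boundaries both qualify. For separated sets only superadditivity is required, since
  \<open>F_Un_le\<close> supplies the other inequality.\<close>

locale cube_functional =
  fixes d :: nat and F :: "cube set \<Rightarrow> real"
  assumes F_nonneg: "0 \<le> F A"
    and F_le_card: "finite A \<Longrightarrow> F A \<le> real (card A)"
    and F_mono: "finite B \<Longrightarrow> A \<subseteq> B \<Longrightarrow> F A \<le> F B"
    and F_Un_le: "finite A \<Longrightarrow> finite B \<Longrightarrow> F (A \<union> B) \<le> F A + F B"
    and F_Un_separated: "finite A \<Longrightarrow> finite B \<Longrightarrow> A \<subseteq> Kd d \<Longrightarrow> B \<subseteq> Kd d \<Longrightarrow>
      separated d (corner ` A) (corner ` B) \<Longrightarrow> F A + F B \<le> F (A \<union> B)"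
    and F_shift: "x \<in> Zd d \<Longrightarrow> A \<subseteq> Kd d \<Longrightarrow> F (cube_shift x ` A) = F A"
begin

context
  fixes G :: "cube set"
begin

text \<open>Each cube of \<open>Kd d\<close> sits at exactly one lattice point, its corner, so that
  partitions of lattice boxes induce partitions of the cubes.\<close>

definition \<Phi> :: "(nat \<Rightarrow> int) set \<Rightarrow> real" where
  "\<Phi> U = F (G \<inter> cubes_at d U)"

lemma finite_G_cubes_at: "finite U \<Longrightarrow> finite (G \<inter> cubes_at d U)"
  by (simp add: cubes_at_finite_card)

lemma \<Phi>_nonneg: "0 \<le> \<Phi> U"
  by (simp add: \<Phi>_def F_nonneg)

lemma \<Phi>_le_card:
  assumes "finite U"
  shows "\<Phi> U \<le> 2 ^ d * real (card U)"
proof -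
  have "\<Phi> U \<le> real (card (G \<inter> cubes_at d U))"
    unfolding \<Phi>_def by (intro F_le_card finite_G_cubes_at assms)
  also have "\<dots> \<le> real (card (cubes_at d U))"
    using cubes_at_finite_card[OF assms] by (intro of_nat_mono card_mono) auto
  also have "\<dots> \<le> real (2 ^ d * card U)"
    using cubes_at_finite_card[OF assms] by (intro of_nat_mono)
  finally show ?thesis by simp
qed

lemma \<Phi>_mono: "finite V \<Longrightarrow> U \<subseteq> V \<Longrightarrow> \<Phi> U \<le> \<Phi> V"
  unfolding \<Phi>_def by (intro F_mono finite_G_cubes_at) (auto simp: cubes_at_def)

lemma \<Phi>_Un_le: "finite U \<Longrightarrow> finite V \<Longrightarrow> \<Phi> (U \<union> V) \<le> \<Phi> U + \<Phi> V"
proof -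
  assume fin: "finite U" "finite V"
  have "G \<inter> cubes_at d (U \<union> V) = (G \<inter> cubes_at d U) \<union> (G \<inter> cubes_at d V)" by (auto simp: cubes_at_def)
  then show ?thesis unfolding \<Phi>_def using fin by (simp add: F_Un_le finite_G_cubes_at)
qed

lemma \<Phi>_empty: "\<Phi> {} = 0"
  using \<Phi>_le_card[of "{}"] \<Phi>_nonneg[of "{}"] by simp

lemma \<Phi>_UN_le:
  assumes "finite I" "\<And>i. i \<in> I \<Longrightarrow> finite (U i)"
  shows "\<Phi> (\<Union>i\<in>I. U i) \<le> (\<Sum>i\<in>I. \<Phi> (U i))"
  using assms
proof (induction I)
  case (insert i I)
  have "\<Phi> (\<Union>i\<in>insert i I. U i) \<le> \<Phi> (U i) + \<Phi> (\<Union>i\<in>I. U i)"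
    using insert by (simp add: \<Phi>_Un_le)
  also have "\<dots> \<le> (\<Sum>i\<in>insert i I. \<Phi> (U i))" using insert by simp
  finally show ?case .
qed (simp add: \<Phi>_empty)

text \<open>Additional lattice points cost at most \<open>2 ^ d\<close> each. All boundary effects
  are estimated through this bound.\<close>

lemma \<Phi>_le_subset:
  assumes "finite V" "U \<subseteq> V"
  shows "\<Phi> V \<le> \<Phi> U + 2 ^ d * (real (card V) - real (card U))"
proof -
  have fU: "finite U" using assms by (rule finite_subset[rotated])
  have "V = U \<union> (V - U)" using assms by auto
  then have "\<Phi> V \<le> \<Phi> U + \<Phi> (V - U)" using \<Phi>_Un_le[of U "V - U"] fU assms by simp
  also have "\<Phi> (V - U) \<le> 2 ^ d * real (card (V - U))" using assms by (intro \<Phi>_le_card) auto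
  also have "real (card (V - U)) = real (card V) - real (card U)"
    using assms fU card_mono[OF assms] by (simp add: card_Diff_subset of_nat_diff)
  finally show ?thesis by simp
qed

lemma \<Phi>_UN_separated:
  assumes "finite I" "\<And>i. i \<in> I \<Longrightarrow> finite (U i)"
    and "\<And>i j. i \<in> I \<Longrightarrow> j \<in> I \<Longrightarrow> i \<noteq> j \<Longrightarrow> separated d (U i) (U j)"
  shows "(\<Sum>i\<in>I. \<Phi> (U i)) \<le> \<Phi> (\<Union>i\<in>I. U i)"
  using assms
proof (induction I)
  case (insert i I)
  let ?V = "\<Union>i\<in>I. U i"
  have fin: "finite (U i)" "finite ?V" using insert.hyps insert.prems(1) by auto
  have "separated d (U i) ?V"
    unfolding separated_def
  proof (intro ballI)
    fix x y assume x: "x \<in> U i" and "y \<in> ?V"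
    then obtain j where j: "j \<in> I" "y \<in> U j" by auto
    have "separated d (U i) (U j)" using insert.hyps j by (intro insert.prems(2)) auto
    then show "\<exists>k<d. 2 \<le> \<bar>x k - y k\<bar>" using x j by (auto simp: separated_def)
  qed
  then have sep: "separated d (corner ` (G \<inter> cubes_at d (U i))) (corner ` (G \<inter> cubes_at d ?V))"
    by (auto simp: separated_def cubes_at_def)
  have "(\<Sum>i\<in>insert i I. \<Phi> (U i)) \<le> \<Phi> (U i) + \<Phi> ?V"
    using insert by simp
  also have "\<dots> \<le> F ((G \<inter> cubes_at d (U i)) \<union> (G \<inter> cubes_at d ?V))"
    unfolding \<Phi>_def using sep fin
    by (intro F_Un_separated finite_G_cubes_at) (auto simp: cubes_at_def)
  also have "(G \<inter> cubes_at d (U i)) \<union> (G \<inter> cubes_at d ?V) = G \<inter> cubes_at d (\<Union>i\<in>insert i I. U i)"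
    by (auto simp: cubes_at_def)
  finally show ?case by (simp add: \<Phi>_def)
qed (simp add: \<Phi>_empty)

end
end

section \<open>Comparing a box with its tilings\<close>

definition block :: "nat \<Rightarrow> (nat \<Rightarrow> int) \<Rightarrow> int \<Rightarrow> (nat \<Rightarrow> int) set" where
  "block d x m = (\<lambda>y i. x i + y i) ` ibox d 0 m"

lemma finite_block [simp]: "finite (block d x m)"
  by (simp add: block_def)

lemma block_iff:
  assumes "x \<in> Zd d"
  shows "y \<in> block d x m \<longleftrightarrow> y \<in> Zd d \<and> (\<forall>i<d. x i \<le> y i \<and> y i < x i + m)"
proof
  assume r: "y \<in> Zd d \<and> (\<forall>i<d. x i \<le> y i \<and> y i < x i + m)"
  then have "(\<lambda>i. y i - x i) \<in> ibox d 0 m" using assms by (auto simp: ibox_def Zd_def)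
  then show "y \<in> block d x m" unfolding block_def by (rule image_eqI[rotated]) simp
qed (use assms in \<open>auto simp: block_def ibox_def Zd_def\<close>)

text \<open>A residue class modulo \<open>m\<close> is the set of corners of one position of the
  tiling; the sum over the \<open>m ^ d\<close> positions meets every corner once.\<close>

lemma sum_ibox_residues:
  fixes h :: "(nat \<Rightarrow> int) \<Rightarrow> real"
  assumes "0 < m"
  shows "(\<Sum>r\<in>ibox d 0 m. \<Sum>x\<in>{x \<in> ibox d a b. (\<lambda>i. x i mod m) = r}. h x) = (\<Sum>x\<in>ibox d a b. h x)"
proof (rule sum.group)
  show "(\<lambda>x i. x i mod m) ` ibox d a b \<subseteq> ibox d 0 m" using assms by (auto simp: ibox_def Zd_def)
qed simp_all

context cube_functional
begin

text \<open>For each offset \<open>r\<close> the blocks with corners congruent to \<open>r\<close>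
  cover the box, and subadditivity applies. A block meeting the box may start below it, hence the
  lower end \<open>- n - m\<close>.\<close>

lemma block_upper_bound:
  assumes m: "0 < m"
  shows "real_of_int m ^ d * \<Phi> G (ibox d (- n) n) \<le> (\<Sum>x\<in>ibox d (- n - m) n. \<Phi> G (block d x m))"
proof -
  let ?D = "\<lambda>r. {x \<in> ibox d (- n - m) n. (\<lambda>i. x i mod m) = r}"
  have "\<Phi> G (ibox d (- n) n) \<le> (\<Sum>x\<in>?D r. \<Phi> G (block d x m))" if r: "r \<in> ibox d 0 m" for r
  proof -
    have "ibox d (- n) n \<subseteq> (\<Union>x\<in>?D r. block d x m)"
    proof
      fix y assume y: "y \<in> ibox d (- n) n"
      \<comment> \<open>The corner of the tile that contains \<open>y\<close> in the tiling with
        offset \<open>r\<close>.\<close>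
      define x where "x i = y i - (y i - r i) mod m" for i
      have b: "0 \<le> (y i - r i) mod m" "(y i - r i) mod m < m" for i using m by auto
      have yr: "y i = 0" "r i = 0" if "d \<le> i" for i using y r that by (auto simp: ibox_def Zd_def)
      have xZ: "x \<in> Zd d" by (simp add: Zd_def x_def yr)
      have "- n - m \<le> x i \<and> x i < n" if "i < d" for i
        using y that b[of i] by (force simp: ibox_def x_def)
      then have "x \<in> ibox d (- n - m) n" using xZ by (simp add: ibox_def)
      moreover have "x i mod m = r i" for i
      proof -
        have "x i mod m = (y i - (y i - r i)) mod m" unfolding x_def by (rule mod_diff_right_eq)
        also have "\<dots> = r i" using r yr(2)[of i] by (cases "i < d") (auto simp: ibox_def)
        finally show ?thesis .
      qed
      moreover have "x i \<le> y i \<and> y i < x i + m" for i using b[of i] by (simp add: x_def)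
      then have "y \<in> block d x m" using y by (simp add: block_iff[OF xZ] ibox_def)
      ultimately show "y \<in> (\<Union>x\<in>?D r. block d x m)" by blast
    qed
    then have "\<Phi> G (ibox d (- n) n) \<le> \<Phi> G (\<Union>x\<in>?D r. block d x m)" by (intro \<Phi>_mono) auto
    also have "\<dots> \<le> (\<Sum>x\<in>?D r. \<Phi> G (block d x m))" by (intro \<Phi>_UN_le) auto
    finally show ?thesis .
  qed
  then have "(\<Sum>r\<in>ibox d 0 m. \<Phi> G (ibox d (- n) n)) \<le> (\<Sum>r\<in>ibox d 0 m. \<Sum>x\<in>?D r. \<Phi> G (block d x m))"
    by (rule sum_mono)
  then show ?thesis using m by (simp add: sum_ibox_residues real_card_ibox)
qed

text \<open>Blocks of side \<open>m - 1\<close> repeated with period \<open>m\<close> are separated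
  and superadditivity applies. The corners stop at \<open>n - m\<close>, so that even the full block
  of side \<open>m\<close> would fit into the box.\<close>

lemma block_lower_bound:
  assumes m: "0 < m"
  shows "(\<Sum>x\<in>ibox d (- n) (n - m + 1). \<Phi> G (block d x (m - 1))) \<le> real_of_int m ^ d * \<Phi> G (ibox d (- n) n)"
proof -
  let ?D = "\<lambda>r. {x \<in> ibox d (- n) (n - m + 1). (\<lambda>i. x i mod m) = r}"
  have "(\<Sum>x\<in>?D r. \<Phi> G (block d x (m - 1))) \<le> \<Phi> G (ibox d (- n) n)" for r
  proof -
    have "(\<Sum>x\<in>?D r. \<Phi> G (block d x (m - 1))) \<le> \<Phi> G (\<Union>x\<in>?D r. block d x (m - 1))"
    proof (rule \<Phi>_UN_separated)
      fix x x' assume x: "x \<in> ?D r" "x' \<in> ?D r" "x \<noteq> x'"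
      then have Z: "x \<in> Zd d" "x' \<in> Zd d" by (auto simp: ibox_def)
      obtain i where i: "x i \<noteq> x' i" using x(3) by auto
      then have id: "i < d" using Z by (metis (mono_tags, lifting) Zd_def mem_Collect_eq not_le)
      have "x i mod m = x' i mod m" using x(1,2) by (auto dest: fun_cong[of _ _ i])
      then have "m dvd x i - x' i" by (simp add: mod_eq_dvd_iff)
      then have "m \<le> \<bar>x i - x' i\<bar>" using i m dvd_imp_le_int[of "x i - x' i" m] by simp
      \<comment> \<open>Points of a block exceed its corner by at most \<open>m - 2\<close> in each
        coordinate, which leaves a distance of \<open>m - (m - 2)\<close>.\<close>
      then have "2 \<le> \<bar>y i - y' i\<bar>" if "y \<in> block d x (m - 1)" "y' \<in> block d x' (m - 1)" for y y'
        using that id by (fastforce simp: block_iff[OF Z(1)] block_iff[OF Z(2)])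
      then show "separated d (block d x (m - 1)) (block d x' (m - 1))"
        unfolding separated_def using id by blast
    qed auto
    also have "\<dots> \<le> \<Phi> G (ibox d (- n) n)"
    proof (rule \<Phi>_mono)
      show "(\<Union>x\<in>?D r. block d x (m - 1)) \<subseteq> ibox d (- n) n"
      proof (rule UN_least)
        fix x assume x: "x \<in> ?D r"
        then have Z: "x \<in> Zd d" by (simp add: ibox_def)
        show "block d x (m - 1) \<subseteq> ibox d (- n) n"
          using x by (fastforce simp: block_iff[OF Z] ibox_def)
      qed
    qed simp
    finally show ?thesis .
  qed
  then have "(\<Sum>r\<in>ibox d 0 m. \<Sum>x\<in>?D r. \<Phi> G (block d x (m - 1))) \<le> (\<Sum>r\<in>ibox d 0 m. \<Phi> G (ibox d (- n) n))"
    by (intro sum_mono)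
  then show ?thesis using m by (simp add: sum_ibox_residues real_card_ibox)
qed

end

text \<open>No relation between the numbers \<open>c k\<close> is assumed. Since \<open>a\<close>
  lies between every lower and every upper bound, \<open>c j - \<delta> j \<le> c k\<close> for all
  \<open>j\<close> and \<open>k\<close>, which makes \<open>c\<close> a Cauchy sequence.\<close>

lemma tendsto_lim_of_approximations:
  fixes c \<delta> :: "nat \<Rightarrow> real"
  assumes \<delta>: "\<delta> \<longlonglongrightarrow> 0"
    and l: "\<And>k. l k \<longlonglongrightarrow> c k - \<delta> k" and u: "\<And>k. u k \<longlonglongrightarrow> c k"
    and le: "\<And>k. eventually (\<lambda>n. l k n \<le> a n \<and> a n \<le> u k n) sequentially"
  shows "a \<longlonglongrightarrow> lim c"
proof -
  have cc: "c j - \<delta> j \<le> c k" for j k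
  proof (rule tendsto_le[OF _ u l])
    show "eventually (\<lambda>n. l j n \<le> u k n) sequentially"
      using le[of j] le[of k] by eventually_elim auto
  qed simp
  have "Cauchy c"
  proof (rule metric_CauchyI)
    fix e :: real assume "0 < e"
    then obtain N where N: "\<And>n. n \<ge> N \<Longrightarrow> \<bar>\<delta> n\<bar> < e" using LIMSEQ_D[OF \<delta>] by force
    show "\<exists>M. \<forall>m\<ge>M. \<forall>n\<ge>M. dist (c m) (c n) < e"
    proof (intro exI allI impI)
      fix m n assume "N \<le> m" "N \<le> n"
      then show "dist (c m) (c n) < e" using N[of m] N[of n] cc[of m n] cc[of n m] by (simp add: dist_real_def)
    qed
  qed
  then have L: "c \<longlonglongrightarrow> lim c" by (simp add: Cauchy_convergent_iff convergent_LIMSEQ_iff)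
  show ?thesis
  proof (rule LIMSEQ_I)
    fix e :: real assume e: "0 < e"
    have "eventually (\<lambda>k. \<bar>\<delta> k\<bar> < e/3) sequentially"
      using \<delta> e by (auto dest!: tendstoD[of _ _ _ "e/3"] simp: dist_real_def)
    moreover have "eventually (\<lambda>k. \<bar>c k - lim c\<bar> < e/3) sequentially"
      using L e by (auto dest!: tendstoD[of _ _ _ "e/3"] simp: dist_real_def)
    ultimately have "eventually (\<lambda>k. \<bar>\<delta> k\<bar> < e/3 \<and> \<bar>c k - lim c\<bar> < e/3) sequentially"
      by eventually_elim auto
    then obtain k where k: "\<bar>\<delta> k\<bar> < e/3" "\<bar>c k - lim c\<bar> < e/3" by (auto simp: eventually_sequentially)
    have "eventually (\<lambda>n. \<bar>l k n - (c k - \<delta> k)\<bar> < e/3) sequentially"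
      using l[of k] e by (auto dest!: tendstoD[of _ _ _ "e/3"] simp: dist_real_def)
    moreover have "eventually (\<lambda>n. \<bar>u k n - c k\<bar> < e/3) sequentially"
      using u[of k] e by (auto dest!: tendstoD[of _ _ _ "e/3"] simp: dist_real_def)
    ultimately have "eventually (\<lambda>n. norm (a n - lim c) < e) sequentially"
      using le[of k]
    proof eventually_elim
      fix n assume "\<bar>l k n - (c k - \<delta> k)\<bar> < e / 3" "\<bar>u k n - c k\<bar> < e / 3" "l k n \<le> a n \<and> a n \<le> u k n"
      then show "norm (a n - lim c) < e" using k unfolding real_norm_def by linarith
    qed
    then show "\<exists>N. \<forall>n\<ge>N. norm (a n - lim c) < e" by (simp add: eventually_sequentially)
  qed
qed

lemma card_block: "card (block d x m) = card (ibox d 0 m)"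
  unfolding block_def by (rule card_image) (auto simp: inj_on_def fun_eq_iff)

lemma real_card_block: "0 \<le> m \<Longrightarrow> real (card (block d x m)) = real_of_int m ^ d"
  by (simp add: card_block real_card_ibox)

lemma sum_le_sum_subset:
  fixes h :: "'i \<Rightarrow> real"
  assumes "finite B" "A \<subseteq> B" "\<And>x. x \<in> B \<Longrightarrow> h x \<le> C"
  shows "sum h B \<le> sum h A + C * (real (card B) - real (card A))"
proof -
  have fA: "finite A" by (rule finite_subset[OF assms(2,1)])
  have "sum h B = sum h (B - A) + sum h A" by (rule sum.subset_diff[OF assms(2,1)])
  moreover have "sum h (B - A) \<le> real (card (B - A)) * C" using assms by (intro sum_bounded_above) auto
  moreover have "real (card (B - A)) = real (card B) - real (card A)"
    using assms fA card_mono[OF assms(1,2)] by (simp add: card_Diff_subset of_nat_diff)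
  ultimately show ?thesis by (simp add: mult.commute)
qed

context cube_functional
begin

lemma \<Phi>_block_le: "0 \<le> m \<Longrightarrow> \<Phi> G (block d x m) \<le> 2 ^ d * real_of_int m ^ d"
  using \<Phi>_le_card[of "block d x m" G] by (simp add: real_card_block)

lemma \<Phi>_block_pred:
  assumes "0 < m"
  shows "\<Phi> G (block d x m) \<le> \<Phi> G (block d x (m - 1)) + 2 ^ d * (real_of_int m ^ d - (real_of_int m - 1) ^ d)"
proof -
  have "block d x (m - 1) \<subseteq> block d x m" unfolding block_def by (intro image_mono ibox_mono) auto
  from \<Phi>_le_subset[OF _ this, of G] show ?thesis using assms by (simp add: real_card_block)
qed

lemma block_average_upper:
  assumes m: "0 < m" and n: "0 \<le> n"
  shows "real_of_int m ^ d * \<Phi> G (ibox d (- n) n) \<le> (\<Sum>x\<in>ibox d (- n) n. \<Phi> G (block d x m))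
    + 2 ^ d * real_of_int m ^ d * ((2 * real_of_int n + real_of_int m) ^ d - (2 * real_of_int n) ^ d)"
proof -
  have "real_of_int m ^ d * \<Phi> G (ibox d (- n) n) \<le> (\<Sum>x\<in>ibox d (- n - m) n. \<Phi> G (block d x m))"
    by (rule block_upper_bound[OF m])
  also have "\<dots> \<le> (\<Sum>x\<in>ibox d (- n) n. \<Phi> G (block d x m))
      + 2 ^ d * real_of_int m ^ d * (real (card (ibox d (- n - m) n)) - real (card (ibox d (- n) n)))"
    using m by (intro sum_le_sum_subset \<Phi>_block_le ibox_mono) auto
  finally show ?thesis using m n by (simp add: real_card_ibox algebra_simps)
qed

text \<open>There are two losses: one in every block for reducing its side to \<open>m - 1\<close>,
  and one for the corners too close to the upper faces of the box. Divided by \<open>m ^ d\<close>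
  and by the volume, the first is O(1/m) and the second vanishes with \<open>n\<close>. The
  assumption \<open>m \<le> 2 * n\<close> keeps the side of the set of corners nonnegative.\<close>

lemma block_average_lower:
  assumes m: "0 < m" and n: "m \<le> 2 * n"
  shows "(\<Sum>x\<in>ibox d (- n) n. \<Phi> G (block d x m)) \<le> real_of_int m ^ d * \<Phi> G (ibox d (- n) n)
    + (2 * real_of_int n) ^ d * (2 ^ d * (real_of_int m ^ d - (real_of_int m - 1) ^ d))
    + 2 ^ d * real_of_int m ^ d * ((2 * real_of_int n) ^ d - (2 * real_of_int n + (1 - real_of_int m)) ^ d)"
proof -
  let ?D = "ibox d (- n) (n - m + 1)" and ?e = "2 ^ d * (real_of_int m ^ d - (real_of_int m - 1) ^ d)"
  have cD: "real (card ?D) = (2 * real_of_int n + (1 - real_of_int m)) ^ d"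
    using m n by (simp add: real_card_ibox algebra_simps)
  have cB: "real (card (ibox d (- n) n)) = (2 * real_of_int n) ^ d"
    using m n by (simp add: real_card_ibox)
  have DB: "?D \<subseteq> ibox d (- n) n" using m by (intro ibox_mono) auto
  have e: "0 \<le> ?e" using m by (simp add: power_mono)
  have "(\<Sum>x\<in>ibox d (- n) n. \<Phi> G (block d x m)) \<le> (\<Sum>x\<in>?D. \<Phi> G (block d x m))
      + 2 ^ d * real_of_int m ^ d * (real (card (ibox d (- n) n)) - real (card ?D))"
    using m DB by (intro sum_le_sum_subset \<Phi>_block_le) auto
  moreover have "(\<Sum>x\<in>?D. \<Phi> G (block d x m)) \<le> (\<Sum>x\<in>?D. \<Phi> G (block d x (m - 1)) + ?e)"
    by (intro sum_mono \<Phi>_block_pred m)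
  moreover have "(\<Sum>x\<in>?D. \<Phi> G (block d x (m - 1)) + ?e) = (\<Sum>x\<in>?D. \<Phi> G (block d x (m - 1))) + real (card ?D) * ?e"
    by (simp add: sum.distrib)
  moreover have "(\<Sum>x\<in>?D. \<Phi> G (block d x (m - 1))) \<le> real_of_int m ^ d * \<Phi> G (ibox d (- n) n)"
    by (rule block_lower_bound[OF m])
  moreover have "real (card ?D) * ?e \<le> real (card (ibox d (- n) n)) * ?e"
    using e DB by (intro mult_right_mono of_nat_mono card_mono) auto
  ultimately show ?thesis unfolding cD cB by linarith
qed

end

section \<open>The cubes of the random set and their translates\<close>

definition active :: "nat \<Rightarrow> real \<Rightarrow> config \<Rightarrow> cube set" where
  "active d t \<omega> = {Q \<in> Kd d. \<exists>R\<in>Kd d. \<omega> R \<le> t \<and> cube_set Q \<subseteq> cube_set R}"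

definition cubes_Lambda :: "nat \<Rightarrow> nat \<Rightarrow> cube set" where
  "cubes_Lambda d n = {Q \<in> Kd d. cube_set Q \<subseteq> Lambda d n}"

text \<open>The midpoint has half-integral coordinates exactly in the nondegenerate directions, so
  it lies in the relative interior of \<open>Q\<close>; an elementary cube containing it must
  contain all of \<open>Q\<close>. Containment in a union of cubes thus reduces to containment in
  one of them.\<close>

lemma cube_subset_if_midpoint:
  assumes "(\<lambda>i. real_of_int (fst (Q i)) + (if snd (Q i) then 1/2 else 0)) \<in> cube_set R"
  shows "cube_set Q \<subseteq> cube_set R"
proof
  fix x assume x: "x \<in> cube_set Q"
  have "if snd (R i) then real_of_int (fst (R i)) \<le> x i \<and> x i \<le> real_of_int (fst (R i)) + 1
       else x i = real_of_int (fst (R i))" for i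
  proof -
    obtain l b where Q: "Q i = (l, b)" by (cases "Q i")
    obtain l' b' where R: "R i = (l', b')" by (cases "R i")
    have xi: "if b then real_of_int l \<le> x i \<and> x i \<le> real_of_int l + 1 else x i = real_of_int l"
      using x[unfolded cube_set_def mem_Collect_eq, rule_format, of i] unfolding Q fst_conv snd_conv .
    have mi: "if b' then real_of_int l' \<le> real_of_int l + (if b then 1/2 else 0) \<and>
        real_of_int l + (if b then 1/2 else 0) \<le> real_of_int l' + 1
       else real_of_int l + (if b then 1/2 else 0) = real_of_int l'"
      using assms[unfolded cube_set_def mem_Collect_eq, rule_format, of i] unfolding Q R fst_conv snd_conv .
    show ?thesis
    proof (cases b')
      case True
      show ?thesis
      proof (cases b)
        case True
        then have "real_of_int l' \<le> real_of_int l + 1/2" "real_of_int l + 1/2 \<le> real_of_int l' + 1"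
          using mi \<open>b'\<close> by auto
        then have "l = l'" by linarith
        then show ?thesis using xi True \<open>b'\<close> R by simp
      next
        case False
        then show ?thesis using xi mi \<open>b'\<close> R by simp
      qed
    next
      case False
      have "\<not> b"
      proof
        assume b
        then have "real_of_int l + 1/2 = real_of_int l'" using mi False by simp
        then have "2 * l + 1 = 2 * l'" by linarith
        then show False by presburger
      qed
      then show ?thesis using xi mi False R by simp
    qed
  qed
  then show "x \<in> cube_set R" by (simp add: cube_set_def)
qed

text \<open>A cube lying in the random set may have a value above \<open>t\<close> itself and be
  covered only as a face of a larger cube; this is why \<open>active\<close> quantifies over
  \<open>R\<close>.\<close>

lemma cube_set_subset_Xt_iff:
  assumes "Q \<in> Kd d"
  shows "cube_set Q \<subseteq> Xt d \<omega> t \<longleftrightarrow> Q \<in> active d t \<omega>"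
proof
  assume sub: "cube_set Q \<subseteq> Xt d \<omega> t"
  let ?m = "\<lambda>i. real_of_int (fst (Q i)) + (if snd (Q i) then 1/2 else 0)"
  have "?m \<in> cube_set Q" by (simp add: cube_set_def)
  then obtain R where "R \<in> Kd d" "\<omega> R \<le> t" "?m \<in> cube_set R" using sub by (auto simp: Xt_def)
  then show "Q \<in> active d t \<omega>" using cube_subset_if_midpoint[of Q R] assms by (auto simp: active_def)
qed (auto simp: active_def Xt_def)

lemma cubes_in_Xt_Lambda:
  "cubes_in d (Xt d \<omega> t \<inter> Lambda d n) k = {Q \<in> active d t \<omega> \<inter> cubes_Lambda d n. cdim d Q = k}"
proof (rule set_eqI)
  fix Q
  show "Q \<in> cubes_in d (Xt d \<omega> t \<inter> Lambda d n) k \<longleftrightarrow> Q \<in> {Q \<in> active d t \<omega> \<inter> cubes_Lambda d n. cdim d Q = k}"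
  proof (cases "Q \<in> Kd d")
    case True
    then show ?thesis
      by (auto simp: cubes_in_def cubes_Lambda_def cube_set_subset_Xt_iff[OF True, symmetric])
  qed (auto simp: cubes_in_def cubes_Lambda_def)
qed

lemma cubes_at_subset_Lambda: "cubes_at d (ibox d (- int n) (int n)) \<subseteq> cubes_Lambda d n"
proof
  fix Q assume Q: "Q \<in> cubes_at d (ibox d (- int n) (int n))"
  have "x \<in> Lambda d n" if x: "x \<in> cube_set Q" for x
  proof -
    have xi: "if snd (Q i) then real_of_int (fst (Q i)) \<le> x i \<and> x i \<le> real_of_int (fst (Q i)) + 1
       else x i = real_of_int (fst (Q i))" for i
      using x by (simp add: cube_set_def)
    have "- real n \<le> x i \<and> x i \<le> real n" if "i < d" for i
    proof -
      have "- int n \<le> fst (Q i)" "fst (Q i) + 1 \<le> int n"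
        using Q that by (auto simp: cubes_at_def ibox_def corner_def)
      then have "- real n \<le> real_of_int (fst (Q i))" "real_of_int (fst (Q i)) + 1 \<le> real n" by linarith+
      then show ?thesis using xi[of i] by (auto split: if_splits)
    qed
    moreover have "x i = 0" if "d \<le> i" for i
      using xi[of i] Q that by (simp add: cubes_at_def Kd_def)
    ultimately show ?thesis by (simp add: Lambda_def)
  qed
  then show "Q \<in> cubes_Lambda d n" using Q by (auto simp: cubes_Lambda_def cubes_at_def)
qed

text \<open>A corner coordinate equal to \<open>n\<close> does occur, for cubes degenerate in that
  direction and lying in an upper face of the closed box; hence the upper end
  \<open>n + 1\<close>.\<close>

lemma cubes_Lambda_subset: "cubes_Lambda d n \<subseteq> cubes_at d (ibox d (- int n) (int n + 1))"
proof
  fix Q assume Q: "Q \<in> cubes_Lambda d n"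
  have "(\<lambda>i. real_of_int (fst (Q i))) \<in> cube_set Q" by (simp add: cube_set_def)
  then have "(\<lambda>i. real_of_int (fst (Q i))) \<in> Lambda d n" using Q by (auto simp: cubes_Lambda_def)
  then have b: "- real n \<le> real_of_int (fst (Q i)) \<and> real_of_int (fst (Q i)) \<le> real n" if "i < d" for i
    using that by (simp add: Lambda_def)
  have "- int n \<le> fst (Q i) \<and> fst (Q i) < int n + 1" if "i < d" for i
    using b[OF that] by linarith
  then show "Q \<in> cubes_at d (ibox d (- int n) (int n + 1))"
    using Q corner_Zd[of Q d] by (simp add: cubes_at_def ibox_def cubes_Lambda_def corner_def)
qed

lemma cube_shift_shift: "cube_shift x (cube_shift y Q) = cube_shift (\<lambda>i. x i + y i) Q"
  by (simp add: cube_shift_def fun_eq_iff add_ac)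

lemma cube_shift_cancel [simp]:
  "cube_shift x (cube_shift (\<lambda>i. - x i) Q) = Q" "cube_shift (\<lambda>i. - x i) (cube_shift x Q) = Q"
  by (simp_all add: cube_shift_def)

lemma inj_cube_shift: "inj (cube_shift x)"
  by (rule inj_on_inverseI[of _ "cube_shift (\<lambda>i. - x i)"]) simp

lemma cube_shift_Kd: "x \<in> Zd d \<Longrightarrow> cube_shift x Q \<in> Kd d \<longleftrightarrow> Q \<in> Kd d"
  by (auto simp: cube_shift_def Kd_def Zd_def prod_eq_iff)

lemma uminus_Zd: "x \<in> Zd d \<Longrightarrow> (\<lambda>i. - x i) \<in> Zd d"
  by (simp add: Zd_def)

lemma mem_cube_set_shift: "p \<in> cube_set (cube_shift x Q) \<longleftrightarrow> (\<lambda>i. p i - real_of_int (x i)) \<in> cube_set Q"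
proof -
  have "(if snd (cube_shift x Q i) then real_of_int (fst (cube_shift x Q i)) \<le> p i \<and> p i \<le> real_of_int (fst (cube_shift x Q i)) + 1
       else p i = real_of_int (fst (cube_shift x Q i))) \<longleftrightarrow>
    (if snd (Q i) then real_of_int (fst (Q i)) \<le> p i - real_of_int (x i) \<and> p i - real_of_int (x i) \<le> real_of_int (fst (Q i)) + 1
       else p i - real_of_int (x i) = real_of_int (fst (Q i)))" for i
    by (auto simp: cube_shift_def)
  then show ?thesis unfolding cube_set_def mem_Collect_eq by presburger
qed

lemma cube_set_shift_subset:
  "cube_set (cube_shift x Q) \<subseteq> cube_set (cube_shift x R) \<longleftrightarrow> cube_set Q \<subseteq> cube_set R"
proof
  assume sub: "cube_set (cube_shift x Q) \<subseteq> cube_set (cube_shift x R)"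
  show "cube_set Q \<subseteq> cube_set R"
  proof
    fix p assume "p \<in> cube_set Q"
    then have "(\<lambda>i. p i + real_of_int (x i)) \<in> cube_set (cube_shift x Q)" by (simp add: mem_cube_set_shift)
    then have "(\<lambda>i. p i + real_of_int (x i)) \<in> cube_set (cube_shift x R)" using sub by blast
    then show "p \<in> cube_set R" by (simp add: mem_cube_set_shift)
  qed
qed (auto simp: mem_cube_set_shift)

text \<open>\<open>tau d x\<close> reads the configuration at the cube moved by \<open>- x\<close>.
  Bringing what happens around \<open>x\<close> to the origin therefore takes the shift by
  \<open>- x\<close>, and the action used later is that of the negated vectors.\<close>

lemma active_tau:
  assumes x: "x \<in> Zd d"
  shows "Q \<in> active d t (tau d (\<lambda>i. - x i) \<omega>) \<longleftrightarrow> cube_shift x Q \<in> active d t \<omega>"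
proof
  assume "Q \<in> active d t (tau d (\<lambda>i. - x i) \<omega>)"
  then obtain R where "Q \<in> Kd d" "R \<in> Kd d" "\<omega> (cube_shift x R) \<le> t" "cube_set Q \<subseteq> cube_set R"
    by (auto simp: active_def tau_def)
  then show "cube_shift x Q \<in> active d t \<omega>"
    using cube_set_shift_subset[of x Q R] cube_shift_Kd[OF x] by (auto simp: active_def)
next
  assume "cube_shift x Q \<in> active d t \<omega>"
  then obtain R where R: "Q \<in> Kd d" "R \<in> Kd d" "\<omega> R \<le> t" "cube_set (cube_shift x Q) \<subseteq> cube_set R"
    using cube_shift_Kd[OF x] by (auto simp: active_def)
  let ?R = "cube_shift (\<lambda>i. - x i) R"
  have "?R \<in> Kd d" using R cube_shift_Kd[OF uminus_Zd[OF x]] by simp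
  moreover have "cube_set Q \<subseteq> cube_set ?R" using R(4) cube_set_shift_subset[of x Q ?R] by simp
  moreover have "tau d (\<lambda>i. - x i) \<omega> ?R \<le> t" using \<open>?R \<in> Kd d\<close> R(3) by (simp add: tau_def)
  ultimately show "Q \<in> active d t (tau d (\<lambda>i. - x i) \<omega>)" using R(1) by (auto simp: active_def)
qed

text \<open>The values on all blocks of a given side are one observable, evaluated along the orbit
  of the configuration. This turns sums over blocks into ergodic averages.\<close>

lemma (in cube_functional) \<Phi>_block_tau:
  assumes x: "x \<in> Zd d"
  shows "\<Phi> (active d t \<omega>) (block d x m) = \<Phi> (active d t (tau d (\<lambda>i. - x i) \<omega>)) (ibox d 0 m)"
proof -
  let ?B = "active d t (tau d (\<lambda>i. - x i) \<omega>) \<inter> cubes_at d (ibox d 0 m)"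
  have "active d t \<omega> \<inter> cubes_at d (block d x m) = cube_shift x ` ?B"
  proof (intro equalityI subsetI)
    fix Q assume Q: "Q \<in> active d t \<omega> \<inter> cubes_at d (block d x m)"
    let ?Q = "cube_shift (\<lambda>i. - x i) Q"
    have QK: "Q \<in> Kd d" using Q by (simp add: cubes_at_def)
    obtain y where y: "y \<in> ibox d 0 m" "corner Q = (\<lambda>i. x i + y i)" using Q by (auto simp: cubes_at_def block_def)
    have "corner ?Q = (\<lambda>i. corner Q i - x i)" by (simp add: corner_def cube_shift_def)
    then have "corner ?Q = y" by (simp add: y(2))
    then have "?Q \<in> ?B" using Q y QK by (simp add: active_tau[OF x] cubes_at_def cube_shift_Kd[OF uminus_Zd[OF x]])
    then show "Q \<in> cube_shift x ` ?B" by (rule image_eqI[rotated]) simp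
  next
    fix Q assume "Q \<in> cube_shift x ` ?B"
    then obtain R where R: "R \<in> ?B" "Q = cube_shift x R" by auto
    have "corner Q = (\<lambda>i. x i + corner R i)" by (simp add: R(2) corner_def cube_shift_def add.commute)
    then have "corner Q \<in> block d x m" using R(1) by (auto simp: block_def cubes_at_def)
    then show "Q \<in> active d t \<omega> \<inter> cubes_at d (block d x m)"
      using R by (simp add: active_tau[OF x] cubes_at_def cube_shift_Kd[OF x])
  qed
  moreover have "?B \<subseteq> Kd d" by (auto simp: cubes_at_def)
  ultimately show ?thesis unfolding \<Phi>_def using F_shift[OF x, of ?B] by simp
qed

section \<open>The cube count and the boundary rank as functionals\<close>

lemma cdim_cube_shift: "cdim d (cube_shift x Q) = cdim d Q"
  by (simp add: cdim_def cube_shift_def)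

lemma image_Collect_cdim:
  "{Q \<in> cube_shift x ` A. cdim d Q = k} = cube_shift x ` {Q \<in> A. cdim d Q = k}"
  by (auto simp: cdim_cube_shift)

lemma cube_functional_card: "cube_functional d (\<lambda>A. real (card {Q \<in> A. cdim d Q = k}))"
proof
  fix A B :: "cube set" and x
  show "finite A \<Longrightarrow> real (card {Q \<in> A. cdim d Q = k}) \<le> real (card A)"
    by (intro of_nat_mono card_mono) auto
  show "finite B \<Longrightarrow> A \<subseteq> B \<Longrightarrow> real (card {Q \<in> A. cdim d Q = k}) \<le> real (card {Q \<in> B. cdim d Q = k})"
    by (intro of_nat_mono card_mono) auto
  have Un: "{Q \<in> A \<union> B. cdim d Q = k} = {Q \<in> A. cdim d Q = k} \<union> {Q \<in> B. cdim d Q = k}" by auto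
  show "real (card {Q \<in> A \<union> B. cdim d Q = k}) \<le> real (card {Q \<in> A. cdim d Q = k}) + real (card {Q \<in> B. cdim d Q = k})"
    unfolding Un of_nat_add[symmetric] by (intro of_nat_mono card_Un_le)
  show "real (card {Q \<in> A. cdim d Q = k}) + real (card {Q \<in> B. cdim d Q = k}) \<le> real (card {Q \<in> A \<union> B. cdim d Q = k})"
    if fin: "finite A" "finite B" and sep: "separated d (corner ` A) (corner ` B)"
  proof -
    have "A \<inter> B = {}" using sep by (fastforce simp: separated_def)
    then have "card {Q \<in> A \<union> B. cdim d Q = k} = card {Q \<in> A. cdim d Q = k} + card {Q \<in> B. cdim d Q = k}"
      unfolding Un using fin by (intro card_Un_disjoint) auto
    then show ?thesis by simp
  qed
  show "real (card {Q \<in> cube_shift x ` A. cdim d Q = k}) = real (card {Q \<in> A. cdim d Q = k})"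
    unfolding image_Collect_cdim by (simp add: card_image inj_on_subset[OF inj_cube_shift])
qed simp

lemma (in vector_space_pair) dim_image_inj:
  assumes "Vector_Spaces.linear s1 s2 f" "inj f"
  shows "vs2.dim (f ` S) = vs1.dim S"
proof -
  interpret f: Vector_Spaces.linear s1 s2 f by fact
  obtain B where B: "B \<subseteq> S" "vs1.independent B" "S \<subseteq> vs1.span B" "card B = vs1.dim S"
    by (rule vs1.basis_exists)
  have "vs2.independent (f ` B)"
    by (rule f.independent_injective_image[OF B(2) inj_on_subset[OF assms(2) subset_UNIV]])
  moreover have "f ` S \<subseteq> vs2.span (f ` B)" using B(3) by (auto simp: f.span_image)
  moreover have "f ` B \<subseteq> f ` S" using B(1) by (rule image_mono)
  ultimately have "card (f ` B) = vs2.dim (f ` S)" by (intro vs2.basis_card_eq_dim)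
  then show ?thesis using B(4) by (simp add: card_image inj_on_subset[OF assms(2)])
qed

lemma bd_cube_shift: "bd_cube d (cube_shift x Q) (cube_shift x P) = bd_cube d Q P"
proof -
  have "ndeg d (cube_shift x Q) = ndeg d Q" "face_sign (cube_shift x Q) = face_sign Q"
    "face_up (cube_shift x Q) i = cube_shift x (face_up Q i)"
    "face_down (cube_shift x Q) i = cube_shift x (face_down Q i)" for i
    by (auto simp: ndeg_def face_sign_def face_up_def face_down_def cube_shift_def fun_eq_iff)
  then show ?thesis unfolding bd_cube_alt by (simp add: inj_eq[OF inj_cube_shift])
qed

lemma bd_rank_shift: "bd_rank d (cube_shift x ` A) = bd_rank d A"
proof -
  define T :: "(cube \<Rightarrow> rat) \<Rightarrow> cube \<Rightarrow> rat" where "T f = (\<lambda>P. f (cube_shift (\<lambda>i. - x i) P))" for f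
  interpret T: Vector_Spaces.linear fscale fscale T
    by unfold_locales (auto simp: T_def fun_eq_iff)
  have "inj T"
  proof (rule injI)
    fix f g assume "T f = T g"
    then have "T f (cube_shift x P) = T g (cube_shift x P)" for P by simp
    then show "f = g" by (simp add: T_def fun_eq_iff)
  qed
  have "bd_vec d (cube_shift x Q) = T (bd_vec d Q)" for Q
  proof
    fix P
    show "bd_vec d (cube_shift x Q) P = T (bd_vec d Q) P"
      using bd_cube_shift[of d x Q "cube_shift (\<lambda>i. - x i) P"] by (simp add: bd_vec_def T_def)
  qed
  then have "bd_vec d ` cube_shift x ` A = T ` bd_vec d ` A" by (simp add: image_image)
  then show ?thesis unfolding bd_rank_def using fsp.dim_image_inj[OF T.linear_axioms \<open>inj T\<close>] by simp
qed

lemma bd_vec_support: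
  assumes "bd_vec d Q P \<noteq> 0"
  shows "fst (P i) \<in> {fst (Q i), fst (Q i) + 1}"
proof (rule ccontr)
  assume a: "fst (P i) \<notin> {fst (Q i), fst (Q i) + 1}"
  have "P \<noteq> face_up Q j" "P \<noteq> face_down Q j" for j
    using a by (cases "i = j"; force simp: face_up_def face_down_def)+
  then show False using assms by (simp add: bd_vec_def bd_cube_alt)
qed

lemma span_bd_vec_support:
  assumes "f \<in> fs.span (bd_vec d ` A)" "f P \<noteq> 0"
  shows "\<exists>Q\<in>A. \<forall>i. fst (P i) \<in> {fst (Q i), fst (Q i) + 1}"
proof (rule ccontr)
  assume n: "\<not> ?thesis"
  have "fs.subspace {f. f P = 0}" by (auto simp: fs.subspace_def)
  moreover have "bd_vec d ` A \<subseteq> {f. f P = 0}" using n bd_vec_support by blast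
  ultimately have "fs.span (bd_vec d ` A) \<subseteq> {f. f P = 0}" by (intro fs.span_minimal)
  then show False using assms by auto
qed

text \<open>For separated sets the boundaries have disjoint supports: a cube in both supports would
  have corner coordinates within 1 of those of a cube from either set. The two spans then meet only
  in 0 and the ranks add.\<close>

lemma cube_functional_rank: "cube_functional d (\<lambda>A. real (bd_rank d {Q \<in> A. cdim d Q = k}))"
proof
  fix A B :: "cube set" and x
  show "real (bd_rank d {Q \<in> A. cdim d Q = k}) \<le> real (card A)" if "finite A"
  proof -
    have "bd_rank d {Q \<in> A. cdim d Q = k} \<le> card (bd_vec d ` {Q \<in> A. cdim d Q = k})"
      unfolding bd_rank_def using that by (intro fs.dim_le_card fs.span_superset) auto
    also have "\<dots> \<le> card {Q \<in> A. cdim d Q = k}" using that by (intro card_image_le) auto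
    also have "\<dots> \<le> card A" using that by (intro card_mono) auto
    finally show ?thesis by simp
  qed
  show "real (bd_rank d {Q \<in> A. cdim d Q = k}) \<le> real (bd_rank d {Q \<in> B. cdim d Q = k})"
    if "finite B" "A \<subseteq> B"
  proof -
    have "bd_vec d ` {Q \<in> A. cdim d Q = k} \<subseteq> bd_vec d ` {Q \<in> B. cdim d Q = k}" using that by auto
    then have "bd_vec d ` {Q \<in> A. cdim d Q = k} \<subseteq> fs.span (bd_vec d ` {Q \<in> B. cdim d Q = k})"
      using fs.span_superset by (rule order_trans)
    then show ?thesis unfolding bd_rank_def using that by (intro of_nat_mono fs.dim_mono_finite) auto
  qed
  have Un: "bd_vec d ` {Q \<in> A \<union> B. cdim d Q = k} = bd_vec d ` {Q \<in> A. cdim d Q = k} \<union> bd_vec d ` {Q \<in> B. cdim d Q = k}"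
    by auto
  show "real (bd_rank d {Q \<in> A \<union> B. cdim d Q = k}) \<le> real (bd_rank d {Q \<in> A. cdim d Q = k}) + real (bd_rank d {Q \<in> B. cdim d Q = k})"
    if "finite A" "finite B"
    unfolding bd_rank_def Un of_nat_add[symmetric] using that by (intro of_nat_mono fs.dim_Un_le) auto
  show "real (bd_rank d {Q \<in> A. cdim d Q = k}) + real (bd_rank d {Q \<in> B. cdim d Q = k}) \<le> real (bd_rank d {Q \<in> A \<union> B. cdim d Q = k})"
    if fin: "finite A" "finite B" and sep: "separated d (corner ` A) (corner ` B)"
  proof -
    let ?A = "{Q \<in> A. cdim d Q = k}" and ?B = "{Q \<in> B. cdim d Q = k}"
    have "fs.span (bd_vec d ` ?A) \<inter> fs.span (bd_vec d ` ?B) \<subseteq> {0}"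
    proof (rule subsetI, rule ccontr)
      fix f assume f: "f \<in> fs.span (bd_vec d ` ?A) \<inter> fs.span (bd_vec d ` ?B)" and "f \<notin> {0}"
      then obtain P where P: "f P \<noteq> 0" by (auto simp: fun_eq_iff)
      obtain Q where Q: "Q \<in> A" "\<And>i. fst (P i) \<in> {fst (Q i), fst (Q i) + 1}"
        using span_bd_vec_support[of f d ?A P] f P by blast
      obtain R where R: "R \<in> B" "\<And>i. fst (P i) \<in> {fst (R i), fst (R i) + 1}"
        using span_bd_vec_support[of f d ?B P] f P by blast
      obtain i where "2 \<le> \<bar>fst (Q i) - fst (R i)\<bar>"
        using sep Q(1) R(1) by (auto simp: separated_def corner_def)
      then show False using Q(2)[of i] R(2)[of i] by auto
    qed
    then have "fs.dim (bd_vec d ` ?A \<union> bd_vec d ` ?B) = fs.dim (bd_vec d ` ?A) + fs.dim (bd_vec d ` ?B)"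
      using fin by (intro fs.dim_Un_direct) auto
    then show ?thesis unfolding bd_rank_def Un by simp
  qed
  show "real (bd_rank d {Q \<in> cube_shift x ` A. cdim d Q = k}) = real (bd_rank d {Q \<in> A. cdim d Q = k})"
    unfolding image_Collect_cdim bd_rank_shift ..
qed simp

section \<open>Random cubical sets\<close>

lemma countable_Kd: "countable (Kd d)"
proof (rule countableI')
  show "inj_on (\<lambda>Q. map Q [0..<d]) (Kd d)"
  proof (rule inj_onI, rule ext)
    fix Q R i assume a: "Q \<in> Kd d" "R \<in> Kd d" "map Q [0..<d] = map R [0..<d]"
    show "Q i = R i"
    proof (cases "i < d")
      case True
      then show ?thesis using a(3) by (auto simp: map_eq_conv)
    qed (use a in \<open>simp add: Kd_def\<close>)
  qed
qed

context
  fixes d :: nat and P :: "config measure"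
  assumes sets_P: "sets P = sets (Omega_space d)"
begin

lemma coord_measurable: "Q \<in> Kd d \<Longrightarrow> (\<lambda>\<omega>. \<omega> Q) \<in> measurable P (restrict_space borel {0..1::real})"
  unfolding measurable_cong_sets[OF sets_P refl] Omega_space_def by (rule measurable_component_singleton)

lemma borel_measurable_coord: "Q \<in> Kd d \<Longrightarrow> (\<lambda>\<omega>. \<omega> Q) \<in> borel_measurable P"
  using coord_measurable by (auto simp: measurable_restrict_space2_iff)

lemma active_measurable: "{\<omega> \<in> space P. Q \<in> active d t \<omega>} \<in> sets P"
proof (cases "Q \<in> Kd d")
  case True
  have "{\<omega> \<in> space P. Q \<in> active d t \<omega>} =
      (\<Union>R\<in>{R \<in> Kd d. cube_set Q \<subseteq> cube_set R}. {\<omega> \<in> space P. \<omega> R \<le> t})"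
    using True by (auto simp: active_def)
  also have "\<dots> \<in> sets P"
  proof (rule sets.countable_UN')
    show "countable {R \<in> Kd d. cube_set Q \<subseteq> cube_set R}" by (rule countable_subset[OF _ countable_Kd]) auto
    have "{\<omega> \<in> space P. \<omega> R \<le> t} \<in> sets P" if "R \<in> Kd d" for R
      using borel_measurable_coord[OF that] by (intro borel_measurable_le) auto
    then show "(\<lambda>R. {\<omega> \<in> space P. \<omega> R \<le> t}) ` {R \<in> Kd d. cube_set Q \<subseteq> cube_set R} \<subseteq> sets P" by auto
  qed
  finally show ?thesis .
qed (simp add: active_def)

text \<open>The configuration enters only through a subset of the finite set \<open>E\<close>, so
  the function takes finitely many values, each on a measurable event, whatever \<open>F\<close>
  is.\<close>

lemma borel_measurable_functional_active:
  fixes F :: "cube set \<Rightarrow> real"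
  assumes "finite E"
  shows "(\<lambda>\<omega>. F (active d t \<omega> \<inter> E)) \<in> borel_measurable P"
proof -
  have "{\<omega> \<in> space P. active d t \<omega> \<inter> E = B} \<in> sets P" if B: "B \<subseteq> E" for B
  proof -
    have "{\<omega> \<in> space P. active d t \<omega> \<inter> E = B} = {\<omega> \<in> space P. \<forall>Q\<in>E. Q \<in> active d t \<omega> \<longleftrightarrow> Q \<in> B}"
      using B by auto
    also have "\<dots> \<in> sets P"
    proof (rule sets.sets_Collect_finite_All[OF _ assms])
      fix Q
      show "{\<omega> \<in> space P. Q \<in> active d t \<omega> \<longleftrightarrow> Q \<in> B} \<in> sets P"
        using active_measurable[of Q t] sets.sets_Collect_neg[OF active_measurable[of Q t]]
        by (cases "Q \<in> B") auto
    qed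
    finally show ?thesis .
  qed
  then have "(\<lambda>\<omega>. \<Sum>B\<in>Pow E. F B * indicator {\<omega> \<in> space P. active d t \<omega> \<inter> E = B} \<omega>) \<in> borel_measurable P"
    by (intro borel_measurable_sum borel_measurable_times borel_measurable_const borel_measurable_indicator) auto
  moreover have "(\<Sum>B\<in>Pow E. F B * indicator {\<omega> \<in> space P. active d t \<omega> \<inter> E = B} \<omega>) = F (active d t \<omega> \<inter> E)"
    if "\<omega> \<in> space P" for \<omega>
  proof -
    have "(\<Sum>B\<in>Pow E. F B * indicator {\<omega> \<in> space P. active d t \<omega> \<inter> E = B} \<omega>)
        = (\<Sum>B\<in>Pow E. if B = active d t \<omega> \<inter> E then F B else 0)"
      using that by (intro sum.cong) (auto simp: indicator_def)
    also have "\<dots> = F (active d t \<omega> \<inter> E)" using assms by simp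
    finally show ?thesis .
  qed
  ultimately show ?thesis by (simp cong: measurable_cong)
qed

lemma tau_measurable:
  assumes "x \<in> Zd d"
  shows "tau d x \<in> measurable P P"
proof -
  have "tau d x \<in> measurable P (Omega_space d)"
    unfolding Omega_space_def tau_def[abs_def]
    using cube_shift_Kd[OF uminus_Zd[OF assms]] by (intro measurable_restrict coord_measurable) auto
  then show ?thesis unfolding measurable_cong_sets[OF refl sets_P] .
qed

lemma lattice_action_tau:
  assumes "prob_space P" and space_P: "space P = space (Omega_space d)" and "stationary d P"
  shows "lattice_action d P (\<lambda>x. tau d (\<lambda>i. - x i))"
proof -
  interpret prob_space P by fact
  have "mpt P (tau d x)" if x: "x \<in> Zd d" for x
  proof -
    have "distr P P (tau d x) = P"
    proof (rule measure_eqI)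
      fix A assume "A \<in> sets (distr P P (tau d x))"
      then have A: "A \<in> sets P" by simp
      then have "measure P (tau d x -` A \<inter> space P) = measure P A"
        using assms(3) x by (simp add: stationary_def)
      then show "emeasure (distr P P (tau d x)) A = emeasure P A"
        using A by (simp add: emeasure_distr tau_measurable[OF x] emeasure_eq_measure)
    qed simp
    then show ?thesis using tau_measurable[OF x] by (simp add: mpt_def)
  qed
  \<comment> \<open>\<open>tau\<close> restricts its result to \<open>Kd d\<close>; it returns the
    same function because points of the product space are undefined off \<open>Kd d\<close>.\<close>
  moreover have "tau d (\<lambda>i. - 0) \<omega> = \<omega>" if "\<omega> \<in> space P" for \<omega>
  proof -
    have "\<omega> \<in> extensional (Kd d)" using that unfolding space_P Omega_space_def by (auto simp: space_PiM PiE_def)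
    moreover have "cube_shift (\<lambda>i. 0) Q = Q" for Q by (simp add: cube_shift_def)
    ultimately show ?thesis by (auto simp: tau_def extensional_def)
  qed
  moreover have "tau d (\<lambda>i. - (x i + y i)) \<omega> = tau d (\<lambda>i. - x i) (tau d (\<lambda>i. - y i) \<omega>)"
    if "x \<in> Zd d" "y \<in> Zd d" for x y \<omega>
  proof
    fix Q
    show "tau d (\<lambda>i. - (x i + y i)) \<omega> Q = tau d (\<lambda>i. - x i) (tau d (\<lambda>i. - y i) \<omega>) Q"
      using cube_shift_Kd[OF that(1)] by (simp add: tau_def cube_shift_shift add.commute)
  qed
  ultimately show ?thesis by (simp add: lattice_action_def uminus_Zd)
qed

lemma ergodic_tau:
  assumes "ergodic d P" "A \<in> sets P" "\<forall>x\<in>Zd d. tau d (\<lambda>i. - x i) -` A \<inter> space P = A"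
  shows "measure P A = 0 \<or> measure P A = 1"
proof -
  have "tau d x -` A \<inter> space P = A" if "x \<in> Zd d" for x
    using assms(3)[rule_format, OF uminus_Zd[OF that]] by simp
  then show ?thesis using assms(1,2) by (simp add: ergodic_def)
qed

end

section \<open>Almost sure convergence of densities\<close>

lemma (in cube_functional) box_density_tendsto:
  fixes c :: "nat \<Rightarrow> real"
  assumes lim: "\<And>k. (\<lambda>n. (\<Sum>x\<in>ibox d (- int n) (int n). \<Phi> G (block d x (int (Suc k)))) / real (Suc k) ^ d / (2 * real n) ^ d)
      \<longlonglongrightarrow> c k"
  shows "(\<lambda>n. \<Phi> G (ibox d (- int n) (int n)) / (2 * real n) ^ d) \<longlonglongrightarrow> lim c"
proof -
  define A where "A k n = (\<Sum>x\<in>ibox d (- int n) (int n). \<Phi> G (block d x (int (Suc k)))) / real (Suc k) ^ d / (2 * real n) ^ d" for k n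
  define \<rho> where "\<rho> s n = ((2 * real n + s) ^ d - (2 * real n) ^ d) / (2 * real n) ^ d" for s n
  \<comment> \<open>The block side is \<open>m = Suc k\<close>, so \<open>m - 1\<close> is
    \<open>k\<close>; this is the normalised cost
    \<open>2 ^ d * (m ^ d - (m - 1) ^ d) / m ^ d\<close> of shrinking a block.\<close>
  define \<delta> where "\<delta> k = 2 ^ d * (1 - (real k / real (Suc k)) ^ d)" for k
  have \<rho>: "\<rho> s \<longlonglongrightarrow> 0" for s unfolding \<rho>_def by (rule power_shift_ratio_tendsto)
  show ?thesis
  proof (rule tendsto_lim_of_approximations)
    have "(\<lambda>k. 2 ^ d * (1 - (real k / real (Suc k)) ^ d)) \<longlonglongrightarrow> 2 ^ d * (1 - 1 ^ d)"
      by (intro tendsto_intros LIMSEQ_n_over_Suc_n)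
    then show "\<delta> \<longlonglongrightarrow> 0" by (simp add: \<delta>_def[abs_def])
    fix k
    define m where "m = real (Suc k)"
    have m: "0 < m" by (simp add: m_def)
    have Ak: "A k \<longlonglongrightarrow> c k" unfolding A_def by (rule lim)
    have "(\<lambda>n. A k n + 2 ^ d * \<rho> m n) \<longlonglongrightarrow> c k + 2 ^ d * 0" by (intro tendsto_intros Ak \<rho>)
    then show "(\<lambda>n. A k n + 2 ^ d * \<rho> m n) \<longlonglongrightarrow> c k" by simp
    have "(\<lambda>n. A k n - \<delta> k + 2 ^ d * \<rho> (1 - m) n) \<longlonglongrightarrow> c k - \<delta> k + 2 ^ d * 0" by (intro tendsto_intros Ak \<rho>)
    then show "(\<lambda>n. A k n - \<delta> k + 2 ^ d * \<rho> (1 - m) n) \<longlonglongrightarrow> c k - \<delta> k" by simp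
    show "eventually (\<lambda>n. A k n - \<delta> k + 2 ^ d * \<rho> (1 - m) n \<le> \<Phi> G (ibox d (- int n) (int n)) / (2 * real n) ^ d \<and>
        \<Phi> G (ibox d (- int n) (int n)) / (2 * real n) ^ d \<le> A k n + 2 ^ d * \<rho> m n) sequentially"
      using eventually_ge_at_top[of "Suc k"]
    proof eventually_elim
      fix n assume n: "Suc k \<le> n"
      define p where "p = \<Phi> G (ibox d (- int n) (int n))"
      define H where "H = (\<Sum>x\<in>ibox d (- int n) (int n). \<Phi> G (block d x (int (Suc k))))"
      define N where "N = (2 * real n) ^ d"
      define M where "M = m ^ d"
      have NM: "0 < N" "0 < M" using n m by (auto simp: N_def M_def)
      have A: "A k n = H / (M * N)" by (simp add: A_def H_def M_def N_def m_def)
      have \<rho>': "\<rho> s n = ((2 * real n + s) ^ d - N) / N" for s by (simp add: \<rho>_def N_def)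
      have "M * p \<le> H + 2 ^ d * M * ((2 * real n + m) ^ d - N)"
        using block_average_upper[of "int (Suc k)" "int n" G]
        by (simp add: p_def H_def M_def N_def m_def)
      then have "M * p / (M * N) \<le> (H + 2 ^ d * M * ((2 * real n + m) ^ d - N)) / (M * N)"
        using NM by (intro divide_right_mono) auto
      then have up: "p / N \<le> A k n + 2 ^ d * \<rho> m n"
        unfolding A \<rho>' using NM by (simp add: add_divide_distrib)
      have "H \<le> M * p + N * (2 ^ d * (M - real k ^ d)) + 2 ^ d * M * (N - (2 * real n + (1 - m)) ^ d)"
        using block_average_lower[of "int (Suc k)" "int n" G] n
        by (simp add: p_def H_def M_def N_def m_def)
      then have "H / (M * N) \<le> (M * p + N * (2 ^ d * (M - real k ^ d)) + 2 ^ d * M * (N - (2 * real n + (1 - m)) ^ d)) / (M * N)"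
        using NM by (intro divide_right_mono) auto
      also have "\<dots> = p / N + 2 ^ d * (1 - real k ^ d / M) - 2 ^ d * \<rho> (1 - m) n"
        unfolding \<rho>' using NM by (simp add: field_simps)
      also have "2 ^ d * (1 - real k ^ d / M) = \<delta> k" by (simp add: \<delta>_def M_def m_def power_divide)
      finally have "A k n - \<delta> k + 2 ^ d * \<rho> (1 - m) n \<le> p / N" unfolding A by simp
      with up show "A k n - \<delta> k + 2 ^ d * \<rho> (1 - m) n \<le> \<Phi> G (ibox d (- int n) (int n)) / (2 * real n) ^ d \<and>
        \<Phi> G (ibox d (- int n) (int n)) / (2 * real n) ^ d \<le> A k n + 2 ^ d * \<rho> m n"
        by (simp add: p_def N_def)
    qed
  qed
qed

text \<open>The cubes in the closed box lie between those with corners in the half-open boxes ending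
  at \<open>n\<close> and at \<open>n + 1\<close>, which differ by a surface layer only.\<close>

lemma (in cube_functional) Lambda_density_tendsto:
  assumes "(\<lambda>n. \<Phi> G (ibox d (- int n) (int n)) / (2 * real n) ^ d) \<longlonglongrightarrow> c"
  shows "(\<lambda>n. F (G \<inter> cubes_Lambda d n) / (2 * real n) ^ d) \<longlonglongrightarrow> c"
proof (rule tendsto_sandwich[OF _ _ assms])
  let ?u = "\<lambda>n. \<Phi> G (ibox d (- int n) (int n)) / (2 * real n) ^ d
      + 2 ^ d * (((2 * real n + 1) ^ d - (2 * real n) ^ d) / (2 * real n) ^ d)"
  have "?u \<longlonglongrightarrow> c + 2 ^ d * 0" by (intro tendsto_intros assms power_shift_ratio_tendsto)
  then show "?u \<longlonglongrightarrow> c" by simp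
  have fin: "finite (cubes_Lambda d n)" for n
    by (rule finite_subset[OF cubes_Lambda_subset]) (simp add: cubes_at_finite_card)
  have "\<Phi> G (ibox d (- int n) (int n)) \<le> F (G \<inter> cubes_Lambda d n)" for n
    unfolding \<Phi>_def using fin cubes_at_subset_Lambda by (intro F_mono) auto
  then show "eventually (\<lambda>n. \<Phi> G (ibox d (- int n) (int n)) / (2 * real n) ^ d \<le> F (G \<inter> cubes_Lambda d n) / (2 * real n) ^ d) sequentially"
    by (intro always_eventually allI divide_right_mono) auto
  have "F (G \<inter> cubes_Lambda d n) / (2 * real n) ^ d \<le> ?u n" for n
  proof -
    have "F (G \<inter> cubes_Lambda d n) \<le> \<Phi> G (ibox d (- int n) (int n + 1))"
      unfolding \<Phi>_def using cubes_Lambda_subset by (intro F_mono finite_G_cubes_at) auto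
    also have "\<dots> \<le> \<Phi> G (ibox d (- int n) (int n)) + 2 ^ d * ((2 * real n + 1) ^ d - (2 * real n) ^ d)"
      using \<Phi>_le_subset[of "ibox d (- int n) (int n + 1)" "ibox d (- int n) (int n)" G] ibox_mono[of "- int n" "- int n" "int n" "int n + 1" d]
      by (simp add: real_card_ibox algebra_simps)
    finally have "F (G \<inter> cubes_Lambda d n) / (2 * real n) ^ d
        \<le> (\<Phi> G (ibox d (- int n) (int n)) + 2 ^ d * ((2 * real n + 1) ^ d - (2 * real n) ^ d)) / (2 * real n) ^ d"
      by (intro divide_right_mono) auto
    then show ?thesis by (simp add: add_divide_distrib)
  qed
  then show "eventually (\<lambda>n. F (G \<inter> cubes_Lambda d n) / (2 * real n) ^ d \<le> ?u n) sequentially"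
    by (intro always_eventually allI)
qed

text \<open>For each block size ergodicity gives a constant \<open>c k\<close>. Countably many sizes
  share one null set, and off it the density converges to \<open>lim c\<close>, which is built from
  constants and hence not random.\<close>

lemma (in cube_functional) AE_density_tendsto:
  assumes "prob_space P" and sets_P: "sets P = sets (Omega_space d)" and space_P: "space P = space (Omega_space d)"
    and st: "stationary d P" and erg: "ergodic d P"
  shows "\<exists>c. AE \<omega> in P. (\<lambda>n. F (active d t \<omega> \<inter> cubes_Lambda d n) / (2 * real n) ^ d) \<longlonglongrightarrow> c"
proof -
  interpret prob_space P by fact
  let ?S = "\<lambda>x. tau d (\<lambda>i. - x i)"
  have S: "lattice_action d P ?S" by (rule lattice_action_tau[OF sets_P assms(1) space_P st])
  define f where "f k \<omega> = \<Phi> (active d t \<omega>) (ibox d 0 (int (Suc k))) / real (Suc k) ^ d" for k \<omega>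
  have "\<exists>c. AE \<omega> in P. (\<lambda>n. box_avg d ?S (f k) n \<omega>) \<longlonglongrightarrow> c" for k
  proof (rule ergodic_box_avg_tendsto[OF S])
    show "prob A = 0 \<or> prob A = 1" if "A \<in> sets P" "\<forall>x\<in>Zd d. ?S x -` A \<inter> space P = A" for A
      using ergodic_tau[OF sets_P erg that] .
    have "(\<lambda>\<omega>. \<Phi> (active d t \<omega>) (ibox d 0 (int (Suc k)))) \<in> borel_measurable P"
      unfolding \<Phi>_def by (intro borel_measurable_functional_active[OF sets_P]) (simp add: cubes_at_finite_card)
    then show "f k \<in> borel_measurable P" unfolding f_def[abs_def] by measurable
    have "\<Phi> (active d t \<omega>) (ibox d 0 (int (Suc k))) \<le> 2 ^ d * real (Suc k) ^ d" for \<omega>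
      using \<Phi>_le_card[of "ibox d 0 (int (Suc k))" "active d t \<omega>"] by (simp add: real_card_ibox)
    then show "\<forall>\<omega>\<in>space P. 0 \<le> f k \<omega> \<and> f k \<omega> \<le> 2 ^ d"
      by (auto simp: f_def \<Phi>_nonneg divide_le_eq)
  qed
  then obtain c where c: "\<And>k. AE \<omega> in P. (\<lambda>n. box_avg d ?S (f k) n \<omega>) \<longlonglongrightarrow> c k" by metis
  then have "AE \<omega> in P. \<forall>k. (\<lambda>n. box_avg d ?S (f k) n \<omega>) \<longlonglongrightarrow> c k" by (simp add: AE_all_countable)
  then have "AE \<omega> in P. (\<lambda>n. F (active d t \<omega> \<inter> cubes_Lambda d n) / (2 * real n) ^ d) \<longlonglongrightarrow> lim c"
  proof eventually_elim
    fix \<omega> assume l: "\<forall>k. (\<lambda>n. box_avg d ?S (f k) n \<omega>) \<longlonglongrightarrow> c k"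
    have eq: "box_avg d ?S (f k) n \<omega>
        = (\<Sum>x\<in>ibox d (- int n) (int n). \<Phi> (active d t \<omega>) (block d x (int (Suc k)))) / real (Suc k) ^ d / (2 * real n) ^ d" for k n
    proof -
      have "(\<Sum>x\<in>ibox d (- int n) (int n). f k (?S x \<omega>))
          = (\<Sum>x\<in>ibox d (- int n) (int n). \<Phi> (active d t \<omega>) (block d x (int (Suc k))) / real (Suc k) ^ d)"
        by (intro sum.cong refl) (simp add: f_def \<Phi>_block_tau ibox_def)
      then show ?thesis by (simp add: box_avg_def sum_divide_distrib)
    qed
    show "(\<lambda>n. F (active d t \<omega> \<inter> cubes_Lambda d n) / (2 * real n) ^ d) \<longlonglongrightarrow> lim c"
      using l unfolding eq by (intro Lambda_density_tendsto box_density_tendsto) blast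
  qed
  then show ?thesis ..
qed

lemma betti_n_eq:
  "real (betti_n d q \<omega> t n) = real (card {Q \<in> active d t \<omega> \<inter> cubes_Lambda d n. cdim d Q = q})
    - real (bd_rank d {Q \<in> active d t \<omega> \<inter> cubes_Lambda d n. cdim d Q = q})
    - real (bd_rank d {Q \<in> active d t \<omega> \<inter> cubes_Lambda d n. cdim d Q = Suc q})"
proof -
  have "finite (cubes_Lambda d n)"
    by (rule finite_subset[OF cubes_Lambda_subset]) (simp add: cubes_at_finite_card)
  then have "finite (cubes_in d (Xt d \<omega> t \<inter> Lambda d n) k)" for k
    unfolding cubes_in_Xt_Lambda by simp
  from betti_eq[OF this this, of q] show ?thesis
    unfolding cubes_in_Xt_Lambda betti_n_def by linarith
qed

theorem theorem2p8:
  fixes d q :: nat and t :: real and P :: "config measure"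
  assumes "prob_space P"
    and "sets P = sets (Omega_space d)" and "space P = space (Omega_space d)"
    and "stationary d P" and "ergodic d P"
    and "q < d" and "0 \<le> t" and "t \<le> 1"
  shows "\<exists>c::real. AE \<omega> in P.
           (\<lambda>n. real (betti_n d q \<omega> t n) / (2 * real n) ^ d) \<longlonglongrightarrow> c"
proof -
  note P = assms(1-5)
  obtain a where a: "AE \<omega> in P. (\<lambda>n. real (card {Q \<in> active d t \<omega> \<inter> cubes_Lambda d n. cdim d Q = q}) / (2 * real n) ^ d) \<longlonglongrightarrow> a"
    using cube_functional.AE_density_tendsto[OF cube_functional_card P] by blast
  obtain b where b: "AE \<omega> in P. (\<lambda>n. real (bd_rank d {Q \<in> active d t \<omega> \<inter> cubes_Lambda d n. cdim d Q = q}) / (2 * real n) ^ d) \<longlonglongrightarrow> b"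
    using cube_functional.AE_density_tendsto[OF cube_functional_rank P] by blast
  obtain c where c: "AE \<omega> in P. (\<lambda>n. real (bd_rank d {Q \<in> active d t \<omega> \<inter> cubes_Lambda d n. cdim d Q = Suc q}) / (2 * real n) ^ d) \<longlonglongrightarrow> c"
    using cube_functional.AE_density_tendsto[OF cube_functional_rank P] by blast
  have "AE \<omega> in P. (\<lambda>n. real (betti_n d q \<omega> t n) / (2 * real n) ^ d) \<longlonglongrightarrow> a - b - c"
    using a b c
  proof eventually_elim
    case (elim \<omega>)
    show ?case unfolding betti_n_eq diff_divide_distrib by (intro tendsto_diff elim)
  qed
  then show ?thesis ..
qed

end
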